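(* Let $G=[-\tfrac1{\sqrt2},\tfrac1{\sqrt2}]\times[0,2\pi)$, $S=[-\tfrac12,\tfrac12]^2$, $T_\theta$ the rotation of $\mathbb R^2$ by angle $\theta$, $S_{r,\theta}=(r,0)+T_\theta S$, and $$\mathcal A_\infty(r,\theta)=\operatorname{Area}\{(x,y)\in S_{r,\theta}: x\le 0\},$$ regarded as a random variable with $(r,\theta)$ uniformly distributed on $G$. For $R>0$ let $\Gamma_R=\mathbb Z^2\cap\{z: R-\tfrac1{\sqrt2}<\|z\|<R+\tfrac1{\sqrt2}\}$ and $\mathcal A_R(\lambda)=\operatorname{Area}((\lambda+S)\cap B(R))$ for $\lambda\in\Gamma_R$, with $B(R)$ the open disc of radius $R$ centred at $0$. Then: (i) as $R\to\infty$, the random variable $\mathcal A_R(\lambda)$, with $\lambda$ drawn uniformly from $\Gamma_R$, converges in distribution to $\mathcal A_\infty$; (ii) $\operatorname{Var}(\mathcal A_\infty)=c_0$, where $c_0=\frac14-\frac{1}{2\pi\sqrt2}\big(\frac4{15}+\frac{2\log(1+\sqrt2)}3+\frac{2\sqrt2}{15}\big)$. *)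

theory Defs
  imports "HOL-Probability.Probability"
begin

text \<open>The library's \<open>weak_conv_m\<close> covers sequences of measures only; here the index is a
  real number tending to infinity.\<close>

definition weak_conv_along :: "('i \<Rightarrow> real measure) \<Rightarrow> real measure \<Rightarrow> 'i filter \<Rightarrow> bool" where
  "weak_conv_along \<mu> M F \<longleftrightarrow>
     (\<forall>x. isCont (cdf M) x \<longrightarrow> ((\<lambda>i. cdf (\<mu> i) x) \<longlongrightarrow> cdf M x) F)"

lemma weak_conv_along_sequentially: "weak_conv_along \<mu> M sequentially \<longleftrightarrow> weak_conv_m \<mu> M"
  by (simp add: weak_conv_along_def weak_conv_m_def weak_conv_def)

definition area :: "(real \<times> real) set \<Rightarrow> real" where
  "area X = measure lborel X"

definition unit_square :: "(real \<times> real) set" where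
  "unit_square = {-1/2..1/2} \<times> {-1/2..1/2}"

definition rotation :: "real \<Rightarrow> real \<times> real \<Rightarrow> real \<times> real" where
  "rotation \<theta> = (\<lambda>(x, y). (x * cos \<theta> - y * sin \<theta>, x * sin \<theta> + y * cos \<theta>))"

definition param_rect :: "(real \<times> real) set" where
  "param_rect = {- (1 / sqrt 2)..1 / sqrt 2} \<times> {0..<2 * pi}"

definition moved_square :: "real \<Rightarrow> real \<Rightarrow> (real \<times> real) set" where
  "moved_square r \<theta> = (\<lambda>z. (r, 0) + z) ` rotation \<theta> ` unit_square"

definition area_limit :: "real \<times> real \<Rightarrow> real" where
  "area_limit = (\<lambda>(r, \<theta>). area {(x, y). (x, y) \<in> moved_square r \<theta> \<and> x \<le> 0})"

definition boundary_lattice :: "real \<Rightarrow> (real \<times> real) set" where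
  "boundary_lattice R =
     (\<int> \<times> \<int>) \<inter> {z. R - 1 / sqrt 2 < norm z \<and> norm z < R + 1 / sqrt 2}"

definition area_disc :: "real \<Rightarrow> real \<times> real \<Rightarrow> real" where
  "area_disc R l = area (((\<lambda>z. l + z) ` unit_square) \<inter> ball 0 R)"

definition c0 :: real where
  "c0 = 1/4 - 1 / (2 * pi * sqrt 2) * (4/15 + 2 * ln (1 + sqrt 2) / 3 + 2 * sqrt 2 / 15)"

end

theory Submission
  imports Defs "HOL-Real_Asymp.Real_Asymp"
begin

text \<open>
  Near a lattice point \<open>\<lambda>\<close> of the annulus the circle is a line up to \<open>O(1/R)\<close>, so
  \<open>\<A>\<^sub>R(\<lambda>)\<close> is close to the area of the unit square cut by a line with the normal of
  the circle at signed distance \<open>\<parallel>\<lambda>\<parallel> - R\<close>. In the quarter of the annulus around the positive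
  vertical axis the lattice points form columns over \<open>m = R u\<close>, and the distance is determined by \<open>u\<close>
  and the fractional part of \<open>R F(u)\<close> with \<open>F(u) = sqrt (1 - u\<^sup>2)\<close>. Since \<open>F'\<close> is injective, a
  van der Corput type averaging over \<open>K\<close> neighbouring columns, on which \<open>R F\<close> is nearly linear, shows
  that the exponential sums over the columns are \<open>o(R)\<close>; by Stone-Weierstrass the pairs of \<open>u\<close> and the
  fractional part equidistribute. The substitution \<open>u = sin \<theta>\<close> turns the limit into the average over
  \<open>G\<close>. The variance is the integral of an explicit piecewise polynomial in \<open>r\<close>, followed by an
  elementary integral in \<open>\<theta>\<close> over an eighth of the circle.
\<close>

section \<open>Riemann sums\<close>

text \<open>Equidistribution only sees continuous test functions, whereas membership in the annulus
  is a jump in the signed distance r at \<open>half_diag\<close> and \<open>- half_diag\<close>. The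
  indicator is therefore replaced by the continuous \<open>cutoff\<close>, and the error is
  dominated by a second continuous test function, \<open>edge_bump\<close>, whose limit is O(e). The
  uniform law on G arises as follows. One step up a column changes r by about \<open>circ u\<close>,
  the cosine of the angle between the normal and the vertical, so a column spreads r with density
  \<open>1 / circ u\<close>. This weight cancels the Jacobian of u = sin \<theta>, which leaves
  Lebesgue measure in (r, \<theta>). Staying in a quarter keeps \<open>circ u\<close> above 1/2: six
  lattice points per column suffice and the slope is bounded. The quarter turn, a symmetry of
  lattice, square and disc, supplies the rest up to boundedly many points near the diagonals. The
  number of lattice points, the denominator of the average, comes from the same limit for the
  constant 1. The mean is 1/2 because the point reflection of the square pairs r with -r.\<close>

lemma uniformly_continuous_clamped:
  fixes g :: "real \<Rightarrow> 'b::metric_space"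
  assumes "a \<le> b" "continuous_on {a..b} g"
  shows "uniformly_continuous_on UNIV (\<lambda>x. g (max a (min b x)))"
proof -
  have uc: "uniformly_continuous_on {a..b} g"
    using assms compact_uniformly_continuous by blast
  show ?thesis
    unfolding uniformly_continuous_on_def
  proof (intro allI impI)
    fix e :: real assume "0 < e"
    then obtain d where d: "d > 0" "\<And>x y. x \<in> {a..b} \<Longrightarrow> y \<in> {a..b} \<Longrightarrow> dist y x < d \<Longrightarrow> dist (g y) (g x) < e"
      using uc unfolding uniformly_continuous_on_def by metis
    have "dist (g (max a (min b y))) (g (max a (min b x))) < e" if "dist y x < d" for x y
      using that assms(1) by (intro d(2)) (auto simp: dist_real_def)
    then show "\<exists>d>0. \<forall>x\<in>UNIV. \<forall>x'\<in>UNIV. dist x' x < d \<longrightarrow> dist (g (max a (min b x'))) (g (max a (min b x))) < e"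
      using d(1) by blast
  qed
qed

lemma sum_telescope_int:
  fixes f :: "int \<Rightarrow> 'b::ab_group_add"
  assumes "p \<le> q + 1"
  shows "(\<Sum>m\<in>{p..q}. f (m + 1) - f m) = f (q + 1) - f p"
proof -
  have "p - 1 \<le> q" using assms by simp
  then show ?thesis
  proof (induction q rule: int_ge_induct)
    case base
    then show ?case by simp
  next
    case (step q)
    have "{p..q + 1} = insert (q + 1) {p..q}" using step by auto
    then show ?case using step by simp
  qed
qed

lemma tendsto_ceiling_div: "((\<lambda>R::real. of_int \<lceil>a * R\<rceil> / R) \<longlongrightarrow> (a::real)) at_top"
proof (rule tendsto_sandwich)
  show "\<forall>\<^sub>F R in at_top. a \<le> of_int \<lceil>a * R\<rceil> / R"
    using eventually_gt_at_top[of "0::real"]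
    by eventually_elim (simp add: field_simps)
  show "\<forall>\<^sub>F R in at_top. of_int \<lceil>a * R\<rceil> / R \<le> a + 1 / R"
    using eventually_gt_at_top[of "0::real"]
    by eventually_elim (simp add: field_simps, linarith)
  show "((\<lambda>R. a + 1 / R) \<longlongrightarrow> a) at_top"
    by real_asymp
qed simp

lemma tendsto_floor_Suc_div: "((\<lambda>R::real. (of_int \<lfloor>a * R\<rfloor> + 1) / R) \<longlongrightarrow> (a::real)) at_top"
proof (rule tendsto_sandwich)
  show "\<forall>\<^sub>F R in at_top. a \<le> (of_int \<lfloor>a * R\<rfloor> + 1) / R"
    using eventually_gt_at_top[of "0::real"]
    by eventually_elim (simp add: field_simps, linarith)
  show "\<forall>\<^sub>F R in at_top. (of_int \<lfloor>a * R\<rfloor> + 1) / R \<le> a + 1 / R"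
    using eventually_gt_at_top[of "0::real"]
    by eventually_elim (simp add: field_simps)
  show "((\<lambda>R. a + 1 / R) \<longlongrightarrow> a) at_top"
    by real_asymp
qed simp

text \<open>This is the side condition \<open>p \<le> q + 1\<close> of telescoping. The range of
  \<open>m\<close> may be empty, but then \<open>p = q + 1\<close> exactly, so the telescoped value
  and the cardinality formula remain right without a case split.\<close>

lemma ceiling_le_Suc_floor:
  fixes a b R :: real
  assumes "a \<le> b" "0 \<le> R"
  shows "\<lceil>a * R\<rceil> \<le> \<lfloor>b * R\<rfloor> + 1"
proof -
  have "a * R \<le> b * R" using assms by (simp add: mult_right_mono)
  then show ?thesis by linarith
qed

lemma card_scaled_interval_le:
  fixes a b R :: real
  assumes "a \<le> b" "R \<ge> 1"
  shows "real (card {\<lceil>a * R\<rceil>..\<lfloor>b * R\<rfloor>}) \<le> (b - a + 1) * R"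
proof -
  have "real (card {\<lceil>a * R\<rceil>..\<lfloor>b * R\<rfloor>}) = real_of_int (\<lfloor>b * R\<rfloor> + 1 - \<lceil>a * R\<rceil>)"
    using ceiling_le_Suc_floor[of a b R] assms by simp
  also have "\<dots> \<le> b * R - a * R + 1" by linarith
  also have "\<dots> \<le> (b - a + 1) * R" using assms by (simp add: algebra_simps)
  finally show ?thesis .
qed

lemma integral_diff_const_le:
  fixes g :: "real \<Rightarrow> 'b::euclidean_space"
  assumes "x \<le> y" "continuous_on {x..y} g" "\<And>t. t \<in> {x..y} \<Longrightarrow> norm (g t - c) \<le> e"
  shows "norm (integral {x..y} g - (y - x) *\<^sub>R c) \<le> e * (y - x)"
proof -
  have "(g has_integral integral {x..y} g) {x..y}"
    using assms(2) by (simp add: integrable_continuous_real integrable_integral)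
  moreover have "((\<lambda>_. c) has_integral (y - x) *\<^sub>R c) {x..y}"
    using has_integral_const_real[of c x y] assms(1) by simp
  ultimately have "((\<lambda>t. g t - c) has_integral (integral {x..y} g - (y - x) *\<^sub>R c)) {x..y}"
    by (rule has_integral_diff)
  moreover have "0 \<le> e" using assms(3)[of x] assms(1) norm_ge_zero[of "g x - c"] by (simp, linarith)
  ultimately show ?thesis
    using has_integral_bound_real[of e "{}" "\<lambda>t. g t - c" _ x y] assms(1,3) by fastforce
qed

text \<open>By uniform continuity a cell of width \<open>1 / R\<close> contributes
  \<open>g (m / R) / R\<close> up to \<open>e / R\<close>, and there are O(R) cells. They tile from
  \<open>\<lceil>a * R\<rceil> / R\<close> to \<open>(\<lfloor>b * R\<rfloor> + 1) / R\<close>,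
  which need not be \<open>a\<close> and \<open>b\<close> but converge to them.\<close>

lemma riemann_sum_tendsto:
  fixes g :: "real \<Rightarrow> 'b::euclidean_space"
  assumes "a \<le> b" "continuous_on {a..b} g"
  shows "((\<lambda>R. (\<Sum>m\<in>{\<lceil>a * R\<rceil>..\<lfloor>b * R\<rfloor>}. g (of_int m / R)) /\<^sub>R R) \<longlongrightarrow> integral {a..b} g) at_top"
proof -
  \<comment> \<open>The last cell can stick out beyond \<open>b\<close>; the constant extension
    \<open>k\<close> of \<open>g\<close> lets it be treated like the others.\<close>
  define k where "k x = g (max a (min b x))" for x
  have uc: "uniformly_continuous_on UNIV k"
    using uniformly_continuous_clamped[OF assms] by (simp add: k_def[abs_def])
  then have ck: "continuous_on A k" for A
    by (meson continuous_on_subset subset_UNIV uniformly_continuous_imp_continuous)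
  \<comment> \<open>Starting one unit before \<open>a\<close> makes \<open>a\<close> an interior
    point, so that \<open>P\<close> is continuous at both limits \<open>a\<close> and
    \<open>b\<close>.\<close>
  define P where "P x = integral {a - 1..x} k" for x
  have P: "integral {x..y} k = P y - P x" if "a - 1 \<le> x" "x \<le> y" for x y
    using Henstock_Kurzweil_Integration.integral_combine[of "a-1" x y k] that integrable_continuous_real[OF ck]
    by (simp add: P_def algebra_simps)
  have cP: "isCont P x" if "a - 1 < x" for x
  proof -
    have "continuous_on {a - 1..x + 1} P"
      unfolding P_def by (rule indefinite_integral_continuous_1[OF integrable_continuous_real[OF ck]])
    then show ?thesis using that by (intro continuous_on_interior) auto
  qed
  have key: "\<forall>\<^sub>F R in at_top. norm ((\<Sum>m\<in>{\<lceil>a * R\<rceil>..\<lfloor>b * R\<rfloor>}. g (of_int m / R)) /\<^sub>R R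
        - (P ((of_int \<lfloor>b * R\<rfloor> + 1) / R) - P (of_int \<lceil>a * R\<rceil> / R))) \<le> e * (b - a + 1)" if "e > 0" for e
  proof -
    obtain d where d: "d > 0" "\<And>x y. dist y x < d \<Longrightarrow> dist (k y) (k x) < e"
      using uc \<open>e > 0\<close> unfolding uniformly_continuous_on_def by (metis UNIV_I)
    show ?thesis
      using eventually_gt_at_top[of "1 / d"] eventually_gt_at_top[of 1]
    proof eventually_elim
      case (elim R)
      let ?p = "\<lceil>a * R\<rceil>" and ?q = "\<lfloor>b * R\<rfloor>"
      have R: "R > 1" "1 / R < d" using elim d(1) by (auto simp: field_simps)
      have bd: "norm (P (of_int (m + 1) / R) - P (of_int m / R) - g (of_int m / R) /\<^sub>R R) \<le> e / R"
        if "m \<in> {?p..?q}" for m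
      proof -
        have m: "a * R \<le> of_int m" "of_int m \<le> b * R" using that by (auto simp: ceiling_le_iff le_floor_iff)
        then have m': "a \<le> of_int m / R" "of_int m / R \<le> b" using R by (auto simp: field_simps)
        have w: "of_int (m + 1) / R - of_int m / R = 1 / R" by (simp add: diff_divide_distrib[symmetric])
        have "norm (integral {of_int m / R..of_int (m + 1) / R} k - (of_int (m + 1) / R - of_int m / R) *\<^sub>R k (of_int m / R))
            \<le> e * (of_int (m + 1) / R - of_int m / R)"
        proof (rule integral_diff_const_le)
          show "of_int m / R \<le> of_int (m + 1) / R" using R by (simp add: divide_right_mono)
        next
          fix t assume t: "t \<in> {of_int m / R..of_int (m + 1) / R}"
          then have "dist t (of_int m / R) < d" using w R by (auto simp: dist_real_def)
          then show "norm (k t - k (of_int m / R)) \<le> e" using d(2)[of t "of_int m / R"] by (simp add: dist_norm)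
        qed (rule ck)
        moreover have "integral {of_int m / R..of_int (m + 1) / R} k = P (of_int (m + 1) / R) - P (of_int m / R)"
          using m' R by (intro P) (auto simp: divide_right_mono)
        moreover have "k (of_int m / R) = g (of_int m / R)" using m' by (simp add: k_def)
        ultimately show ?thesis unfolding w by (simp add: divide_inverse)
      qed
      have "P ((of_int ?q + 1) / R) - P (of_int ?p / R) = (\<Sum>m\<in>{?p..?q}. P (of_int (m + 1) / R) - P (of_int m / R))"
        using sum_telescope_int[of ?p ?q "\<lambda>m. P (of_int m / R)"] ceiling_le_Suc_floor[of a b R] R assms(1) by simp
      then have "norm ((P ((of_int ?q + 1) / R) - P (of_int ?p / R)) - (\<Sum>m\<in>{?p..?q}. g (of_int m / R)) /\<^sub>R R)
          = norm (\<Sum>m\<in>{?p..?q}. P (of_int (m + 1) / R) - P (of_int m / R) - g (of_int m / R) /\<^sub>R R)"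
        by (simp add: sum_subtractf scaleR_right.sum)
      also have "\<dots> \<le> (\<Sum>m\<in>{?p..?q}. e / R)" by (intro sum_norm_le bd)
      also have "\<dots> = card {?p..?q} * (e / R)" by simp
      also have "\<dots> \<le> ((b - a + 1) * R) * (e / R)"
        using card_scaled_interval_le[of a b R] assms(1) R \<open>e > 0\<close> by (intro mult_right_mono) auto
      also have "\<dots> = e * (b - a + 1)" using R by simp
      finally show ?case by (simp add: norm_minus_commute)
    qed
  qed
  have "((\<lambda>R. (\<Sum>m\<in>{\<lceil>a * R\<rceil>..\<lfloor>b * R\<rfloor>}. g (of_int m / R)) /\<^sub>R R
        - (P ((of_int \<lfloor>b * R\<rfloor> + 1) / R) - P (of_int \<lceil>a * R\<rceil> / R))) \<longlongrightarrow> 0) at_top"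
    unfolding tendsto_iff
  proof (intro allI impI)
    fix e :: real assume "e > 0"
    then have "0 < e / (2 * (b - a + 1))" using assms(1) by simp
    from key[OF this] show "\<forall>\<^sub>F R in at_top. dist ((\<Sum>m\<in>{\<lceil>a * R\<rceil>..\<lfloor>b * R\<rfloor>}. g (of_int m / R)) /\<^sub>R R
        - (P ((of_int \<lfloor>b * R\<rfloor> + 1) / R) - P (of_int \<lceil>a * R\<rceil> / R))) 0 < e"
    proof eventually_elim
      case (elim R)
      have "e / (2 * c) * c < e" if "c > 0" for c using that \<open>e > 0\<close> by (simp add: field_simps)
      from this[of "b - a + 1"] have "e / (2 * (b - a + 1)) * (b - a + 1) < e" using assms(1) by simp
      with elim show ?case unfolding dist_norm diff_zero by (rule le_less_trans)
    qed
  qed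
  moreover have "((\<lambda>R. P ((of_int \<lfloor>b * R\<rfloor> + 1) / R) - P (of_int \<lceil>a * R\<rceil> / R)) \<longlongrightarrow> P b - P a) at_top"
    using assms(1) by (intro tendsto_diff isCont_tendsto_compose[OF cP] tendsto_ceiling_div tendsto_floor_Suc_div) auto
  ultimately have "((\<lambda>R. (\<Sum>m\<in>{\<lceil>a * R\<rceil>..\<lfloor>b * R\<rfloor>}. g (of_int m / R)) /\<^sub>R R) \<longlongrightarrow> P b - P a) at_top"
    by (rule Lim_transform[rotated])
  moreover have "P b - P a = integral {a..b} g"
    using P[of a b] assms(1) integral_cong[of "{a..b}" k g] by (simp add: k_def)
  ultimately show ?thesis by simp
qed

section \<open>Exponential sums along a curve\<close>

text \<open>The geometric sum is bounded by \<open>2 / norm (cis x - 1)\<close> uniformly in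
  \<open>K\<close>, so dividing by \<open>K\<close> kills it.\<close>

lemma cis_average_tendsto_0:
  assumes "cis x \<noteq> 1"
  shows "(\<lambda>K::nat. norm (\<Sum>k<K. cis (real k * x)) / real K) \<longlonglongrightarrow> 0"
proof (rule tendsto_sandwich[where f = "\<lambda>_. 0"])
  show "\<forall>\<^sub>F K in sequentially. norm (\<Sum>k<K. cis (real k * x)) / real K \<le> (2 / norm (cis x - 1)) / real K"
  proof (rule always_eventually, rule allI, rule divide_right_mono)
    fix K :: nat
    have "(\<Sum>k<K. cis (real k * x)) = (cis (real K * x) - 1) / (cis x - 1)"
      by (simp add: Complex.DeMoivre[symmetric] geometric_sum assms)
    also have "norm \<dots> \<le> 2 / norm (cis x - 1)"
      unfolding norm_divide
      by (rule divide_right_mono) (use norm_triangle_ineq4[of "cis (real K * x)" 1] in auto)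
    finally show "norm (\<Sum>k<K. cis (real k * x)) \<le> 2 / norm (cis x - 1)" .
  qed simp
  show "(\<lambda>K. (2 / norm (cis x - 1)) / real K) \<longlonglongrightarrow> 0"
    by (rule lim_const_over_n)
qed auto

lemma norm_cis_diff_le: "norm (cis x - cis y) \<le> \<bar>x - y\<bar>"
proof -
  have "cis x - cis y = cis y * (cis (x - y) - 1)"
    by (simp add: algebra_simps cis_mult)
  then have "norm (cis x - cis y) = norm (cis (x - y) - 1)"
    by (simp add: norm_mult)
  also have "\<dots> \<le> \<bar>x - y\<bar>"
    using iexp_approx1[of "x - y" 0] by (simp add: cis_conv_exp)
  finally show ?thesis .
qed

text \<open>This is where the curvature of the curve enters. The averages fail to decay only at
  resonances, where \<open>\<theta> * G u\<close> is a multiple of 2 pi; since \<open>G\<close> is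
  injective these \<open>u\<close> form a countable set. Elsewhere the averages tend to 0 pointwise,
  dominated by \<open>norm (w u)\<close>.\<close>

lemma integral_cis_average_tendsto_0:
  fixes G :: "real \<Rightarrow> real" and w :: "real \<Rightarrow> complex"
  assumes "continuous_on {a..b} G" "inj_on G {a..b}" "continuous_on {a..b} w" "\<theta> \<noteq> 0"
  shows "(\<lambda>K::nat. integral {a..b} (\<lambda>u. norm (w u) * (norm (\<Sum>k<K. cis (real k * (\<theta> * G u))) / real K))) \<longlonglongrightarrow> 0"
proof -
  define f where "f K u = norm (w u) * (norm (\<Sum>k<K. cis (real k * (\<theta> * G u))) / real K)" for K :: nat and u
  define S where "S = {u \<in> {a..b}. cis (\<theta> * G u) = 1}"
  have "G ` S \<subseteq> range (\<lambda>n::int. of_int n * 2 * pi / \<theta>)"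
  proof
    fix v assume "v \<in> G ` S"
    then obtain u where u: "v = G u" "cis (\<theta> * G u) = 1" by (auto simp: S_def)
    then have "cos (\<theta> * v) = 1" by (metis cis.sel(1) one_complex.sel(1))
    then obtain n :: int where "\<theta> * v = of_int n * 2 * pi"
      using cos_one_2pi_int by auto
    then show "v \<in> range (\<lambda>n::int. of_int n * 2 * pi / \<theta>)"
      using assms(4) by (auto simp: field_simps)
  qed
  then have "countable (G ` S)"
    by (rule countable_subset) simp
  moreover have "inj_on G S" using assms(2) by (rule inj_on_subset) (auto simp: S_def)
  ultimately have neg: "negligible S"
    by (metis countable_image_inj_on countable_imp_null_set_lborel negligible_iff_null_sets null_sets_completionI)
  have int: "f K integrable_on {a..b}" for K
    unfolding f_def by (cases "K = 0") (auto intro!: integrable_continuous_real continuous_intros assms)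
  \<comment> \<open>Dominated convergence is applied with convergence at every point, so the
    integrand is first set to 0 on the negligible set of resonances.\<close>
  define f' where "f' K u = (if u \<in> S then 0 else f K u)" for K u
  have int': "f' K integrable_on {a..b}" for K
    by (rule integrable_spike[OF int[of K] neg]) (auto simp: f'_def)
  have "(\<lambda>K. integral {a..b} (f' K)) \<longlonglongrightarrow> integral {a..b} (\<lambda>u. 0)"
  proof (rule dominated_convergence(2))
    show "f' K integrable_on {a..b}" for K by (rule int')
    show "(\<lambda>u. norm (w u)) integrable_on {a..b}"
      by (intro integrable_continuous_real continuous_intros assms)
    fix K u assume u: "u \<in> {a..b}"
    have "norm (\<Sum>k<K. cis (real k * (\<theta> * G u))) / real K \<le> 1"
      using norm_sum[of "\<lambda>k. cis (real k * (\<theta> * G u))" "{..<K}"] by (cases "K = 0") (auto simp: divide_simps)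
    then show "norm (f' K u) \<le> norm (w u)"
      using mult_left_mono[of "norm (\<Sum>k<K. cis (real k * (\<theta> * G u))) / real K" 1 "norm (w u)"]
      by (auto simp: f'_def f_def)
  next
    fix u assume u: "u \<in> {a..b}"
    show "(\<lambda>K. f' K u) \<longlonglongrightarrow> 0"
    proof (cases "u \<in> S")
      case False
      then have "cis (\<theta> * G u) \<noteq> 1" using u by (auto simp: S_def)
      from tendsto_mult[OF tendsto_const[of "norm (w u)"] cis_average_tendsto_0[OF this]]
      show ?thesis using False by (simp add: f'_def f_def)
    qed (simp add: f'_def)
  qed
  moreover have "integral {a..b} (f' K) = integral {a..b} (f K)" for K
    by (rule integral_spike[OF neg]) (auto simp: f'_def)
  ultimately have "(\<lambda>K. integral {a..b} (f K)) \<longlonglongrightarrow> 0" by simp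
  then show ?thesis unfolding f_def .
qed

text \<open>A shift by one exchanges one term at each end of the range, so \<open>k\<close> shifts
  cost at most \<open>2 * k\<close> terms.\<close>

lemma norm_sum_shift_diff_le:
  fixes e :: "int \<Rightarrow> 'b::real_normed_vector"
  assumes "\<And>m. norm (e m) \<le> W" "p \<le> q + 1"
  shows "norm ((\<Sum>m\<in>{p..q}. e m) - (\<Sum>m\<in>{p..q}. e (m + int k))) \<le> 2 * real k * W"
proof (induction k)
  case 0
  then show ?case by simp
next
  case (Suc k)
  let ?s = "\<lambda>k. \<Sum>m\<in>{p..q}. e (m + int k)"
  have "?s (Suc k) - ?s k = (\<Sum>m\<in>{p..q}. e ((m + 1) + int k) - e (m + int k))"
    by (simp add: sum_subtractf algebra_simps)
  also have "\<dots> = e (q + 1 + int k) - e (p + int k)"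
    by (rule sum_telescope_int[OF assms(2), of "\<lambda>m. e (m + int k)"])
  finally have "norm (?s (Suc k) - ?s k) \<le> 2 * W"
    using norm_triangle_ineq4[of "e (q + 1 + int k)" "e (p + int k)"] assms(1)[of "q + 1 + int k"] assms(1)[of "p + int k"]
    by simp
  moreover have "(\<Sum>m\<in>{p..q}. e m) - ?s (Suc k) = ((\<Sum>m\<in>{p..q}. e m) - ?s k) - (?s (Suc k) - ?s k)" by simp
  ultimately show ?case
    using Suc norm_triangle_ineq4[of "(\<Sum>m\<in>{p..q}. e m) - ?s k" "?s (Suc k) - ?s k"]
    by (simp add: algebra_simps)
qed

text \<open>Averaging over \<open>K\<close> consecutive terms, the phases \<open>R F((m + k)/R)\<close> are nearly linear in
  \<open>k\<close> with slope \<open>F'(m/R)\<close>; a geometric sum with ratio different from 1 then gains a factor \<open>K\<close>.\<close>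

lemma exp_sum_tendsto_0:
  fixes F G :: "real \<Rightarrow> real" and w :: "real \<Rightarrow> complex"
  assumes ab: "a \<le> b"
    and deriv: "\<And>u. u \<in> {a..b} \<Longrightarrow> (F has_real_derivative G u) (at u within {a..b})"
    and contG: "continuous_on {a..b} G" and inj: "inj_on G {a..b}"
    and contw: "continuous_on {a..b} w" and \<theta>: "\<theta> \<noteq> 0"
  shows "((\<lambda>R. (\<Sum>m\<in>{\<lceil>a * R\<rceil>..\<lfloor>b * R\<rfloor>}. w (of_int m / R) * cis (\<theta> * (R * F (of_int m / R)))) /\<^sub>R R) \<longlongrightarrow> 0) at_top"
proof -
  \<comment> \<open>Windows of \<open>K\<close> columns may run past \<open>b\<close>. Weight and
    slope are extended by constants, and \<open>F\<close> by the antiderivative \<open>f\<close> of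
    the extended slope, so that shifted terms make sense and obey the same estimates.\<close>
  define v where "v x = w (max a (min b x))" for x
  define g where "g x = G (max a (min b x))" for x
  define f where "f x = F a + integral {a..x} g" for x
  have ucv: "uniformly_continuous_on UNIV v" and ucg: "uniformly_continuous_on UNIV g"
    unfolding v_def[abs_def] g_def[abs_def]
    by (intro uniformly_continuous_clamped ab contw contG)+
  then have cg: "continuous_on A g" for A
    by (meson continuous_on_subset subset_UNIV uniformly_continuous_imp_continuous)
  have f_diff: "f y - f x = integral {x..y} g" if "a \<le> x" "x \<le> y" for x y
    using Henstock_Kurzweil_Integration.integral_combine[of a x y g] that integrable_continuous_real[OF cg]
    by (simp add: f_def algebra_simps)
  have f_eq: "f x = F x" if "x \<in> {a..b}" for x
  proof -
    have "(G has_integral (F x - F a)) {a..x}"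
    proof (rule fundamental_theorem_of_calculus)
      fix u assume "u \<in> {a..x}"
      then show "(F has_vector_derivative G u) (at u within {a..x})"
        using that deriv[of u]
        by (auto simp: has_real_derivative_iff_has_vector_derivative intro: has_vector_derivative_within_subset)
    qed (use that in auto)
    then have "integral {a..x} G = F x - F a" by (rule integral_unique)
    moreover have "integral {a..x} g = integral {a..x} G"
      using that by (intro integral_cong) (auto simp: g_def)
    ultimately show ?thesis by (simp add: f_def)
  qed
  have "bounded (w ` {a..b})"
    by (intro compact_imp_bounded compact_continuous_image contw) auto
  then obtain W where W: "W > 0" "\<And>x. x \<in> {a..b} \<Longrightarrow> norm (w x) \<le> W"
    by (auto simp: bounded_pos)
  have vW: "norm (v x) \<le> W" for x
    unfolding v_def using ab by (intro W(2)) auto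
  define D where "D K u = norm (w u) * (norm (\<Sum>k<K. cis (real k * (\<theta> * G u))) / real K)" for K :: nat and u
  define s where "s R = (\<Sum>m\<in>{\<lceil>a * R\<rceil>..\<lfloor>b * R\<rfloor>}. w (of_int m / R) * cis (\<theta> * (R * F (of_int m / R))))" for R
  \<comment> \<open>For fixed \<open>K\<close> and \<open>e\<close> the three terms are the cost of
    the shifts, the error of freezing the weight and linearising the phase over a window of length
    \<open>K / R\<close>, and a Riemann sum of the averaged geometric sums.\<close>
  have main: "\<forall>\<^sub>F R in at_top. norm (s R /\<^sub>R R) \<le> 2 * real K * W / R + e * (1 + W * \<bar>\<theta>\<bar> * real K) * (b - a + 1)
      + (\<Sum>m\<in>{\<lceil>a * R\<rceil>..\<lfloor>b * R\<rfloor>}. D K (of_int m / R)) /\<^sub>R R"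
    if "K > 0" "e > 0" for K e
  proof -
    obtain d1 where d1: "d1 > 0" "\<And>x y. dist y x < d1 \<Longrightarrow> dist (v y) (v x) < e"
      using ucv \<open>e > 0\<close> unfolding uniformly_continuous_on_def by (metis UNIV_I)
    obtain d2 where d2: "d2 > 0" "\<And>x y. dist y x < d2 \<Longrightarrow> dist (g y) (g x) < e"
      using ucg \<open>e > 0\<close> unfolding uniformly_continuous_on_def by (metis UNIV_I)
    show ?thesis
      using eventually_gt_at_top[of "real K / d1"] eventually_gt_at_top[of "real K / d2"] eventually_gt_at_top[of 1]
    proof eventually_elim
      case (elim R)
      have R: "R > 1" "real K / R < d1" "real K / R < d2"
        using elim d1(1) d2(1) by (auto simp: field_simps)
      let ?N = "{\<lceil>a * R\<rceil>..\<lfloor>b * R\<rfloor>}"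
      define E where "E m = v (of_int m / R) * cis (\<theta> * (R * f (of_int m / R)))" for m :: int
      have mN: "of_int m / R \<in> {a..b}" if "m \<in> ?N" for m
        using that R by (auto simp: ceiling_le_iff le_floor_iff field_simps)
      have s_eq: "s R = (\<Sum>m\<in>?N. E m)"
        unfolding s_def E_def using mN f_eq by (intro sum.cong) (auto simp: v_def)
      have pert: "norm (E (m + int k) - v (of_int m / R) * cis (\<theta> * (R * f (of_int m / R))) * cis (real k * (\<theta> * g (of_int m / R))))
          \<le> e * (1 + W * \<bar>\<theta>\<bar> * real K)" if m: "m \<in> ?N" and k: "k < K" for m k
      proof -
        define u where "u = of_int m / R"
        define x where "x = of_int (m + int k) / R"
        have xu: "x - u = real k / R" by (simp add: x_def u_def diff_divide_distrib[symmetric])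
        have "real k / R \<ge> 0" using R by simp
        have kR: "real k / R \<le> real K / R" using k R by (simp add: divide_right_mono)
        have u: "u \<in> {a..b}" using mN[OF m] by (simp add: u_def)
        have "norm (integral {u..x} g - (x - u) *\<^sub>R g u) \<le> e * (x - u)"
        proof (rule integral_diff_const_le)
          fix t assume "t \<in> {u..x}"
          then have "dist t u < d2" using xu kR R by (auto simp: dist_real_def)
          then show "norm (g t - g u) \<le> e" using d2(2)[of t u] by (simp add: dist_norm)
        qed (use xu \<open>real k / R \<ge> 0\<close> cg in auto)
        then have "\<bar>f x - f u - (real k / R) * g u\<bar> \<le> e * (real k / R)"
          using f_diff[of u x] u xu \<open>real k / R \<ge> 0\<close> by simp
        then have "R * \<bar>f x - f u - (real k / R) * g u\<bar> \<le> R * (e * (real k / R))"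
          using R by (intro mult_left_mono) auto
        then have ph: "\<bar>R * f x - R * f u - real k * g u\<bar> \<le> e * real k"
        proof -
          assume "R * \<bar>f x - f u - (real k / R) * g u\<bar> \<le> R * (e * (real k / R))"
          moreover have "R * f x - R * f u - real k * g u = R * (f x - f u - (real k / R) * g u)"
            using R by (simp add: field_simps)
          ultimately show ?thesis using R by (simp add: abs_mult)
        qed
        have "norm (cis (\<theta> * (R * f x)) - cis (\<theta> * (R * f u) + real k * (\<theta> * g u)))
            \<le> \<bar>\<theta> * (R * f x - R * f u - real k * g u)\<bar>"
          using norm_cis_diff_le[of "\<theta> * (R * f x)" "\<theta> * (R * f u) + real k * (\<theta> * g u)"] by (simp add: algebra_simps)
        also have "\<dots> \<le> \<bar>\<theta>\<bar> * (e * real K)"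
          unfolding abs_mult using ph k \<open>e > 0\<close> by (intro mult_left_mono order_trans[OF ph]) auto
        finally have c: "norm (cis (\<theta> * (R * f x)) - cis (\<theta> * (R * f u) + real k * (\<theta> * g u))) \<le> \<bar>\<theta>\<bar> * (e * real K)" .
        have "dist x u < d1" using xu kR R \<open>real k / R \<ge> 0\<close> by (simp add: dist_real_def)
        then have dv: "norm (v x - v u) \<le> e" using d1(2)[of x u] by (simp add: dist_norm)
        have "v x * cis (\<theta> * (R * f x)) - v u * cis (\<theta> * (R * f u)) * cis (real k * (\<theta> * g u))
           = (v x - v u) * cis (\<theta> * (R * f x)) + v u * (cis (\<theta> * (R * f x)) - cis (\<theta> * (R * f u) + real k * (\<theta> * g u)))"
          by (simp add: algebra_simps cis_mult)
        also have "norm \<dots> \<le> e + W * (\<bar>\<theta>\<bar> * (e * real K))"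
          using dv c vW[of u] W(1) by (intro order_trans[OF norm_triangle_ineq] add_mono) (auto simp: norm_mult intro!: mult_mono)
        also have "\<dots> = e * (1 + W * \<bar>\<theta>\<bar> * real K)" by (simp add: algebra_simps)
        finally show ?thesis unfolding E_def x_def u_def .
      qed
      have inner: "norm (\<Sum>k<K. E (m + int k)) \<le> real K * D K (of_int m / R) + real K * (e * (1 + W * \<bar>\<theta>\<bar> * real K))"
        if m: "m \<in> ?N" for m
      proof -
        let ?c = "v (of_int m / R) * cis (\<theta> * (R * f (of_int m / R)))"
        let ?z = "\<lambda>k. cis (real k * (\<theta> * g (of_int m / R)))"
        have "norm (\<Sum>k<K. E (m + int k)) = norm (?c * (\<Sum>k<K. ?z k) + (\<Sum>k<K. E (m + int k) - ?c * ?z k))"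
          by (simp add: sum_subtractf sum_distrib_left)
        also have "\<dots> \<le> norm (?c * (\<Sum>k<K. ?z k)) + (\<Sum>k<K. e * (1 + W * \<bar>\<theta>\<bar> * real K))"
          using pert[OF m] by (intro order_trans[OF norm_triangle_ineq] add_mono order_refl sum_norm_le) auto
        also have "norm (?c * (\<Sum>k<K. ?z k)) = real K * D K (of_int m / R)"
          using mN[OF m] \<open>K > 0\<close> by (simp add: D_def v_def g_def norm_mult)
        finally show ?thesis by simp
      qed
      \<comment> \<open>The sum is written \<open>K\<close> times, the \<open>k\<close>-th copy is
        replaced by the sum shifted by \<open>k\<close>, and the order is swapped: each
        \<open>m\<close> then carries a full window of \<open>K\<close> consecutive terms.\<close>
      have "real K * norm (s R) = norm (\<Sum>k<K. s R)" by (simp add: norm_mult)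
      also have "(\<Sum>k<K. s R) = (\<Sum>k<K. s R - (\<Sum>m\<in>?N. E (m + int k))) + (\<Sum>m\<in>?N. \<Sum>k<K. E (m + int k))"
        by (simp add: sum_subtractf sum.swap[of _ ?N])
      also have "norm \<dots> \<le> (\<Sum>k<K. 2 * real K * W) + (\<Sum>m\<in>?N. real K * D K (of_int m / R) + real K * (e * (1 + W * \<bar>\<theta>\<bar> * real K)))"
      proof (intro order_trans[OF norm_triangle_ineq] add_mono sum_norm_le)
        fix k assume "k \<in> {..<K}"
        have "norm (s R - (\<Sum>m\<in>?N. E (m + int k))) \<le> 2 * real k * W"
          unfolding s_eq using ceiling_le_Suc_floor[of a b R] R ab vW
          by (intro norm_sum_shift_diff_le) (auto simp: E_def norm_mult)
        also have "\<dots> \<le> 2 * real K * W" using \<open>k \<in> {..<K}\<close> W(1) by (intro mult_right_mono) auto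
        finally show "norm (s R - (\<Sum>m\<in>?N. E (m + int k))) \<le> 2 * real K * W" .
      qed (rule inner)
      also have "\<dots> = real K * (2 * real K * W + real (card ?N) * (e * (1 + W * \<bar>\<theta>\<bar> * real K)) + (\<Sum>m\<in>?N. D K (of_int m / R)))"
        by (simp add: sum.distrib sum_distrib_left[symmetric] algebra_simps)
      finally have "norm (s R) \<le> 2 * real K * W + real (card ?N) * (e * (1 + W * \<bar>\<theta>\<bar> * real K)) + (\<Sum>m\<in>?N. D K (of_int m / R))"
        using \<open>K > 0\<close> by simp
      also have "\<dots> \<le> 2 * real K * W + ((b - a + 1) * R) * (e * (1 + W * \<bar>\<theta>\<bar> * real K)) + (\<Sum>m\<in>?N. D K (of_int m / R))"
        using card_scaled_interval_le[of a b R] ab R \<open>e > 0\<close> W(1) by (intro add_mono mult_right_mono) auto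
      finally have "norm (s R) / R \<le> (2 * real K * W + ((b - a + 1) * R) * (e * (1 + W * \<bar>\<theta>\<bar> * real K)) + (\<Sum>m\<in>?N. D K (of_int m / R))) / R"
        using R by (intro divide_right_mono) auto
      also have "\<dots> = 2 * real K * W / R + e * (1 + W * \<bar>\<theta>\<bar> * real K) * (b - a + 1) + (\<Sum>m\<in>?N. D K (of_int m / R)) /\<^sub>R R"
      proof -
        have "(x + (c * R) * y + z) / R = x / R + y * c + z /\<^sub>R R" for x y c z :: real
          using R by (simp add: field_simps)
        then show ?thesis .
      qed
      also have "norm (s R) / R = norm (s R /\<^sub>R R)" using R by (simp add: divide_inverse mult.commute)
      finally show ?case .
    qed
  qed
  have "((\<lambda>R. s R /\<^sub>R R) \<longlongrightarrow> 0) at_top"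
    unfolding tendsto_iff
  proof (intro allI impI)
    fix \<epsilon> :: real assume "\<epsilon> > 0"
    \<comment> \<open>The order of choices matters: \<open>K\<close> is fixed first, making the
      averaged geometric sums small; only then is the tolerance \<open>\<epsilon> / (4 * q)\<close>
      chosen, because \<open>q\<close> grows with \<open>K\<close>; \<open>R\<close> tends to
      infinity last.\<close>
    have "(\<lambda>K. integral {a..b} (D K)) \<longlonglongrightarrow> 0"
      unfolding D_def by (rule integral_cis_average_tendsto_0[OF contG inj contw \<theta>])
    then have "\<forall>\<^sub>F K in sequentially. dist (integral {a..b} (D K)) 0 < \<epsilon> / 4"
      using \<open>\<epsilon> > 0\<close> by (intro tendstoD) auto
    then have "\<forall>\<^sub>F K in sequentially. integral {a..b} (D K) < \<epsilon> / 4 \<and> K > 0"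
      using eventually_gt_at_top[of "0::nat"] by eventually_elim (auto simp: dist_real_def)
    then obtain K where K: "integral {a..b} (D K) < \<epsilon> / 4" "K > 0"
      by (auto simp: eventually_sequentially)
    define q where "q = (1 + W * \<bar>\<theta>\<bar> * real K) * (b - a + 1)"
    have q: "q > 0" unfolding q_def using W(1) ab by (intro mult_pos_pos) (simp_all add: add_pos_nonneg)
    have contD: "continuous_on {a..b} (D K)"
      unfolding D_def by (intro continuous_intros contw contG) (use K in auto)
    have q_eq: "\<epsilon> / (4 * q) * (1 + W * \<bar>\<theta>\<bar> * real K) * (b - a + 1) = \<epsilon> / 4"
    proof -
      have "\<epsilon> / (4 * q) * (1 + W * \<bar>\<theta>\<bar> * real K) * (b - a + 1) = \<epsilon> / (4 * q) * q"
        by (simp only: q_def mult.assoc)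
      then show ?thesis using q by simp
    qed
    have "((\<lambda>R. 2 * real K * W / R + \<epsilon> / 4
      + (\<Sum>m\<in>{\<lceil>a * R\<rceil>..\<lfloor>b * R\<rfloor>}. D K (of_int m / R)) /\<^sub>R R) \<longlongrightarrow> 0 + \<epsilon> / 4 + integral {a..b} (D K)) at_top"
      by (intro tendsto_add tendsto_const riemann_sum_tendsto ab contD) real_asymp
    from order_tendstoD(2)[OF this, of \<epsilon>]
    have "\<forall>\<^sub>F R in at_top. 2 * real K * W / R + \<epsilon> / 4
      + (\<Sum>m\<in>{\<lceil>a * R\<rceil>..\<lfloor>b * R\<rfloor>}. D K (of_int m / R)) /\<^sub>R R < \<epsilon>"
      using K \<open>\<epsilon> > 0\<close> by simp
    moreover have "\<forall>\<^sub>F R in at_top. norm (s R /\<^sub>R R) \<le> 2 * real K * W / R + \<epsilon> / (4 * q) * (1 + W * \<bar>\<theta>\<bar> * real K) * (b - a + 1)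
      + (\<Sum>m\<in>{\<lceil>a * R\<rceil>..\<lfloor>b * R\<rfloor>}. D K (of_int m / R)) /\<^sub>R R"
      using K q \<open>\<epsilon> > 0\<close> by (intro main) auto
    ultimately show "\<forall>\<^sub>F R in at_top. dist (s R /\<^sub>R R) 0 < \<epsilon>"
      unfolding q_eq by eventually_elim (auto simp: dist_norm)
  qed
  then show ?thesis by (simp add: s_def)
qed

section \<open>Equidistribution along a curve\<close>

text \<open>Trigonometric polynomials of period 1 in \<open>t\<close> whose coefficients are
  continuous functions of \<open>u\<close>. Generating them from monomials and sums turns closure
  under products, periodicity and equidistribution into inductions.\<close>

inductive trig_sum :: "real \<Rightarrow> real \<Rightarrow> (real \<Rightarrow> real \<Rightarrow> complex) \<Rightarrow> bool" for a b where
  monomial: "continuous_on {a..b} w \<Longrightarrow> trig_sum a b (\<lambda>u t. w u * cis (2 * pi * of_int h * t))"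
| add: "trig_sum a b p \<Longrightarrow> trig_sum a b q \<Longrightarrow> trig_sum a b (\<lambda>u t. p u t + q u t)"

lemma trig_sum_coeff:
  assumes "continuous_on {a..b} w"
  shows "trig_sum a b (\<lambda>u t. w u)"
  using trig_sum.monomial[OF assms, of 0] by simp

lemma trig_sum_mult:
  assumes "trig_sum a b p" "trig_sum a b q"
  shows "trig_sum a b (\<lambda>u t. p u t * q u t)"
  using assms(1)
proof (induction rule: trig_sum.induct)
  case w: (monomial w h)
  from assms(2) show ?case
  proof (induction rule: trig_sum.induct)
    case (monomial w' h')
    have "trig_sum a b (\<lambda>u t. (w u * w' u) * cis (2 * pi * of_int (h + h') * t))"
      by (intro trig_sum.monomial continuous_intros w monomial)
    moreover have "(\<lambda>u t. (w u * w' u) * cis (2 * pi * of_int (h + h') * t))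
        = (\<lambda>u t. w u * cis (2 * pi * of_int h * t) * (w' u * cis (2 * pi * of_int h' * t)))"
      by (simp add: fun_eq_iff algebra_simps cis_mult)
    ultimately show ?case by simp
  next
    case (add p q)
    from trig_sum.add[OF add.IH] show ?case by (simp add: algebra_simps)
  qed
next
  case (add p q)
  from trig_sum.add[OF add.IH] show ?case by (simp add: algebra_simps)
qed

text \<open>Real and imaginary part of \<open>cis (2 * pi * t)\<close> are combinations of the
  frequencies 1 and -1, so linear functions are trigonometric sums, and these are closed under sums
  and products. This form matches the algebra in which Stone-Weierstrass approximates.\<close>

lemma trig_sum_polynomial:
  fixes g :: "complex \<times> real \<Rightarrow> real"
  assumes "real_polynomial_function g"
  shows "trig_sum a b (\<lambda>u t. of_real (g (cis (2 * pi * t), u)))"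
  using assms
proof (induction rule: real_polynomial_function.induct)
  case (linear g)
  interpret bounded_linear g by fact
  have g: "g (z, u) = Re z * g (1, 0) + Im z * g (\<i>, 0) + u * g (0, 1)" for z u
  proof -
    have "(z, u) = Re z *\<^sub>R (1, 0) + Im z *\<^sub>R (\<i>, 0) + u *\<^sub>R (0, 1)"
      by (simp add: complex_eq_iff)
    then have "g (z, u) = g (Re z *\<^sub>R (1, 0) + Im z *\<^sub>R (\<i>, 0) + u *\<^sub>R (0, 1))" by (rule arg_cong)
    then show ?thesis by (simp only: add scaleR real_scaleR_def)
  qed
  let ?e = "\<lambda>h t. cis (2 * pi * of_int h * t)"
  \<comment> \<open>\<open>A\<close> and \<open>B\<close> are the conjugate Fourier coefficients of
    a real function of frequency 1; conjugacy makes the imaginary parts cancel.\<close>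
  define A where "A = Complex (g (1, 0) / 2) (- g (\<i>, 0) / 2)"
  define B where "B = Complex (g (1, 0) / 2) (g (\<i>, 0) / 2)"
  have "trig_sum a b (\<lambda>u t. A * ?e 1 t + (B * ?e (- 1) t + of_real (u * g (0, 1))))"
    by (intro trig_sum.add trig_sum_coeff trig_sum.monomial continuous_intros)
  moreover have "A * ?e 1 t + (B * ?e (- 1) t + of_real (u * g (0, 1))) = of_real (g (cis (2 * pi * t), u))" for u t
    unfolding g[of _ u] A_def B_def by (simp add: complex_eq_iff algebra_simps)
  ultimately show ?case by simp
next
  case (const c)
  show ?case by (rule trig_sum_coeff) (rule continuous_on_const)
next
  case (add f g)
  from trig_sum.add[OF add.IH] show ?case by simp
next
  case (mult f g)
  from trig_sum_mult[OF mult.IH] show ?case by simp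
qed

text \<open>Only integer frequencies occur, so the fractional part in the test functions may be
  replaced by the phase itself, as the exponential sums require.\<close>

lemma trig_sum_frac:
  assumes "trig_sum a b p"
  shows "p u (frac t) = p u t"
  using assms
proof (induction rule: trig_sum.induct)
  case (monomial w h)
  have "cis (2 * pi * of_int h * t) = cis (2 * pi * of_int h * frac t + 2 * pi * of_int (h * \<lfloor>t\<rfloor>))"
    by (simp add: frac_def algebra_simps)
  also have "\<dots> = cis (2 * pi * of_int h * frac t) * cis (2 * pi * of_int (h * \<lfloor>t\<rfloor>))"
    by (simp only: cis_mult)
  also have "cis (2 * pi * of_int (h * \<lfloor>t\<rfloor>)) = 1"
    by (rule cis_multiple_2pi) simp
  finally show ?case by simp
qed simp

lemma trig_sum_continuous:
  assumes "trig_sum a b p"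
  shows "continuous_on ({a..b} \<times> A) (\<lambda>(u, t). p u t)"
  using assms
proof (induction rule: trig_sum.induct)
  case (monomial w h)
  show ?case
    unfolding split_beta by (intro continuous_intros continuous_on_compose2[OF monomial]) auto
qed (auto simp: split_beta intro: continuous_on_add)

lemma continuous_on_inner_integral:
  fixes f :: "real \<Rightarrow> real \<Rightarrow> 'b::banach"
  assumes "continuous_on ({a..b} \<times> {c..d}) (\<lambda>(u, t). f u t)"
  shows "continuous_on {a..b} (\<lambda>u. integral {c..d} (f u))"
  using integral_continuous_on_param[of "{a..b}" c d f] assms by simp

lemma continuous_on_section:
  assumes "continuous_on (U \<times> V) (\<lambda>(u, t). f u t)" "u \<in> U"
  shows "continuous_on V (f u)"
proof -
  have "continuous_on V (\<lambda>t. (\<lambda>(u, t). f u t) (u, t))"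
    by (rule continuous_on_compose2[OF assms(1)]) (use assms(2) in \<open>auto intro!: continuous_intros\<close>)
  then show ?thesis by simp
qed

lemma integral_cis_period:
  fixes h :: int assumes "h \<noteq> 0"
  shows "integral {0..1} (\<lambda>t. c * cis (2 * pi * of_int h * t)) = 0"
proof -
  define k where "k = \<i> * of_real (2 * pi * of_int h)"
  have k: "k \<noteq> 0" using assms by (simp add: k_def)
  have cis_exp: "cis (2 * pi * of_int h * t) = exp (k * of_real t)" for t
    by (simp add: k_def cis_conv_exp mult.assoc)
  have "((\<lambda>t. c * exp (k * of_real t)) has_integral (c / k * exp (k * of_real 1) - c / k * exp (k * of_real 0))) {0..1}"
  proof (rule fundamental_theorem_of_calculus)
    fix t :: real assume "t \<in> {0..1}"
    have "((\<lambda>z. c / k * exp (k * z)) has_field_derivative c * exp (k * of_real t)) (at (of_real t))"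
      using k by (auto intro!: derivative_eq_intros)
    then show "((\<lambda>t. c / k * exp (k * of_real t)) has_vector_derivative c * exp (k * of_real t)) (at t within {0..1})"
      by (rule has_vector_derivative_real_field)
  qed simp
  moreover have "exp (k * of_real 1) = 1"
    unfolding cis_exp[symmetric] by (rule cis_multiple_2pi[of "of_int h", THEN trans[rotated]]) simp_all
  ultimately have "((\<lambda>t. c * exp (k * of_real t)) has_integral 0) {0..1}" by simp
  then show ?thesis unfolding cis_exp by (rule integral_unique)
qed

text \<open>What equidistribution asks of a curve: a continuous slope that never takes the same
  value twice, one-sided derivatives being enough at the ends. It is later instantiated by an arc of
  the circle.\<close>

locale curve =
  fixes a b :: real and F G :: "real \<Rightarrow> real"
  assumes ab: "a \<le> b"
    and deriv: "\<And>u. u \<in> {a..b} \<Longrightarrow> (F has_real_derivative G u) (at u within {a..b})"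
    and contG: "continuous_on {a..b} G" and inj: "inj_on G {a..b}"
begin

text \<open>Frequency 0 leaves a Riemann sum. Every other frequency has mean 0 over a period, and
  its exponential sum is o(R). Sums follow by linearity.\<close>

lemma trig_sum_equidistributed:
  assumes "trig_sum a b p"
  shows "((\<lambda>R. (\<Sum>m\<in>{\<lceil>a * R\<rceil>..\<lfloor>b * R\<rfloor>}. p (of_int m / R) (R * F (of_int m / R))) /\<^sub>R R)
    \<longlongrightarrow> integral {a..b} (\<lambda>u. integral {0..1} (p u))) at_top"
  using assms
proof (induction rule: trig_sum.induct)
  case (monomial w h)
  show ?case
  proof (cases "h = 0")
    case True
    then show ?thesis using riemann_sum_tendsto[OF ab monomial] by simp
  next
    case False
    then have z: "integral {0..1} (\<lambda>t. w u * cis (2 * pi * of_int h * t)) = 0" for u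
      by (rule integral_cis_period)
    have h: "2 * pi * of_int h \<noteq> 0" using False by simp
    show ?thesis unfolding z integral_0 by (rule exp_sum_tendsto_0[OF ab _ contG inj monomial h]) (rule deriv)
  qed
next
  case (add p q)
  have c: "continuous_on ({a..b} \<times> {0..1}) (\<lambda>(u, t). p u t)" "continuous_on ({a..b} \<times> {0..1}) (\<lambda>(u, t). q u t)"
    using add.hyps trig_sum_continuous by auto
  have "integral {0..1} (\<lambda>t. p u t + q u t) = integral {0..1} (p u) + integral {0..1} (q u)" if "u \<in> {a..b}" for u
    by (intro integral_add integrable_continuous_real continuous_on_section[OF c(1) that] continuous_on_section[OF c(2) that])
  then have "integral {a..b} (\<lambda>u. integral {0..1} (\<lambda>t. p u t + q u t))
      = integral {a..b} (\<lambda>u. integral {0..1} (p u) + integral {0..1} (q u))"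
    by (intro integral_cong) auto
  also have "\<dots> = integral {a..b} (\<lambda>u. integral {0..1} (p u)) + integral {a..b} (\<lambda>u. integral {0..1} (q u))"
    by (intro integral_add integrable_continuous_real continuous_on_inner_integral c)
  finally show ?case
    using tendsto_add[OF add.IH] by (simp add: sum.distrib scaleR_add_right)
qed

lemma trig_sum_dense:
  fixes Q :: "real \<Rightarrow> real \<Rightarrow> real"
  assumes contQ: "continuous_on ({a..b} \<times> {0..1}) (\<lambda>(u, t). Q u t)"
    and per: "\<And>u. u \<in> {a..b} \<Longrightarrow> Q u 0 = Q u 1" and "e > 0"
  obtains p where "trig_sum a b p" "\<And>u t. u \<in> {a..b} \<Longrightarrow> t \<in> {0..1} \<Longrightarrow> \<bar>Q u t - Re (p u t)\<bar> < e"
proof -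
  define S where "S = {a..b} \<times> {0..1::real}"
  define f :: "real \<times> real \<Rightarrow> complex \<times> real" where "f = (\<lambda>(u, t). (cis (2 * pi * t), u))"
  define q where "q y = (case inv_into S f y of (u, t) \<Rightarrow> Q u t)" for y
  have compS: "compact S" unfolding S_def by (intro compact_Times compact_Icc)
  have contf: "continuous_on S f" unfolding f_def split_beta by (intro continuous_intros)
  have qf: "q (f x) = (case x of (u, t) \<Rightarrow> Q u t)" if "x \<in> S" for x
  proof -
    obtain u t where x: "x = (u, t)" by (cases x)
    obtain u' t' where x': "inv_into S f (f x) = (u', t')" by (cases "inv_into S f (f x)")
    have "(u', t') \<in> S" using inv_into_into[of "f x" f S] that x' by auto
    moreover have "f (u', t') = f (u, t)" using f_inv_into_f[of "f x" f S] that x x' by auto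
    ultimately have *: "u' = u" "cis (2 * pi * t') = cis (2 * pi * t)" "0 \<le> t'" "t' \<le> 1" "0 \<le> t" "t \<le> 1" "u \<in> {a..b}"
      using that x by (auto simp: f_def S_def)
    \<comment> \<open>Two points of \<open>S\<close> with the same image can differ only by
      exchanging \<open>t = 0\<close> and \<open>t = 1\<close>, where \<open>per\<close> applies;
      hence the choice made by \<open>inv_into\<close> is harmless.\<close>
    have "cis (2 * pi * (t' - t)) = 1" using *(2) by (simp add: right_diff_distrib cis_divide[symmetric])
    then have "cos (2 * pi * (t' - t)) = 1" by (metis cis.sel(1) one_complex.sel(1))
    then obtain n :: int where "2 * pi * (t' - t) = of_int n * 2 * pi"
      using cos_one_2pi_int by auto
    then have n: "t' - t = of_int n" by simp
    then have "real_of_int n \<le> 1" "real_of_int n \<ge> -1" using * by auto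
    then have "n = -1 \<or> n = 0 \<or> n = 1" by linarith
    then have "t' = t \<or> (t' = 0 \<and> t = 1) \<or> (t' = 1 \<and> t = 0)" using n * by auto
    then have "Q u t' = Q u t" using per[OF *(7)] by auto
    then show ?thesis using x x' *(1) by (simp add: q_def)
  qed
  \<comment> \<open>A continuous map from a compact set onto its Hausdorff image is a quotient map,
    so continuity of \<open>q\<close> can be checked after composing with \<open>f\<close>, where it
    is that of \<open>Q\<close>.\<close>
  have "continuous_on (f ` S) q"
    unfolding continuous_openin_preimage_eq
  proof (intro allI impI)
    fix V :: "real set" assume "open V"
    have "S \<inter> f -` (f ` S \<inter> q -` V) = S \<inter> (\<lambda>(u, t). Q u t) -` V"
    proof (rule set_eqI)
      fix x show "x \<in> S \<inter> f -` (f ` S \<inter> q -` V) \<longleftrightarrow> x \<in> S \<inter> (\<lambda>(u, t). Q u t) -` V"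
        using qf[of x] by (cases "x \<in> S") simp_all
    qed
    moreover have "openin (top_of_set S) (S \<inter> (\<lambda>(u, t). Q u t) -` V)"
      using contQ \<open>open V\<close> unfolding S_def continuous_openin_preimage_eq by blast
    ultimately show "openin (top_of_set (f ` S)) (f ` S \<inter> q -` V)"
      using Abstract_Topology_2.continuous_imp_quotient_map[OF contf refl compS, of "f ` S \<inter> q -` V"] by auto
  qed
  moreover have "compact (f ` S)" by (intro compact_continuous_image contf compS)
  ultimately obtain g where g: "real_polynomial_function g" "\<And>y. y \<in> f ` S \<Longrightarrow> \<bar>q y - g y\<bar> < e"
    using Stone_Weierstrass_real_polynomial_function[of "f ` S" q e] \<open>e > 0\<close> by blast
  show thesis
  proof (rule that[OF trig_sum_polynomial[OF g(1)]])
    fix u t :: real assume "u \<in> {a..b}" "t \<in> {0..1}"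
    then have "(u, t) \<in> S" by (auto simp: S_def)
    then show "\<bar>Q u t - Re (complex_of_real (g (cis (2 * pi * t), u)))\<bar> < e"
      using g(2)[OF imageI, of "(u, t)"] qf[of "(u, t)"] by (simp add: f_def)
  qed
qed

theorem equidistributed:
  fixes Q :: "real \<Rightarrow> real \<Rightarrow> real"
  assumes contQ: "continuous_on ({a..b} \<times> {0..1}) (\<lambda>(u, t). Q u t)"
    and per: "\<And>u. u \<in> {a..b} \<Longrightarrow> Q u 0 = Q u 1"
  shows "((\<lambda>R. (\<Sum>m\<in>{\<lceil>a * R\<rceil>..\<lfloor>b * R\<rfloor>}. Q (of_int m / R) (frac (R * F (of_int m / R)))) / R)
    \<longlongrightarrow> integral {a..b} (\<lambda>u. integral {0..1} (Q u))) at_top"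
  unfolding tendsto_iff
proof (intro allI impI)
  fix \<epsilon> :: real assume "\<epsilon> > 0"
  \<comment> \<open>One \<open>e\<close> serves both replacements of \<open>Q\<close> by
    \<open>P\<close>: the sum has at most \<open>(b - a + 1) * R\<close> terms and the integral runs
    over length \<open>b - a\<close>, so each costs at most a third of \<open>\<epsilon>\<close>.
    The last third is the limit for \<open>p\<close>.\<close>
  define e where "e = \<epsilon> / (3 * (b - a + 1))"
  have e: "e > 0" "e * (b - a + 1) = \<epsilon> / 3" using \<open>\<epsilon> > 0\<close> ab
    by (simp_all add: e_def) (use ab in \<open>simp add: field_simps\<close>)
  obtain p where p: "trig_sum a b p" "\<And>u t. u \<in> {a..b} \<Longrightarrow> t \<in> {0..1} \<Longrightarrow> \<bar>Q u t - Re (p u t)\<bar> < e"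
    using trig_sum_dense[OF contQ per e(1)] by blast
  define P where "P u t = Re (p u t)" for u t
  have contp: "continuous_on ({a..b} \<times> {0..1}) (\<lambda>(u, t). p u t)" by (rule trig_sum_continuous[OF p(1)])
  have contP: "continuous_on ({a..b} \<times> {0..1}) (\<lambda>(u, t). P u t)"
    using continuous_on_Re[OF contp] by (simp add: P_def split_beta)
  have I_P: "integral {a..b} (\<lambda>u. integral {0..1} (P u)) = Re (integral {a..b} (\<lambda>u. integral {0..1} (p u)))"
  proof -
    have "integral {0..1} (P u) = Re (integral {0..1} (p u))" if "u \<in> {a..b}" for u
      unfolding P_def using continuous_on_section[OF contp that]
      by (intro integral_linear[OF _ bounded_linear_Re, unfolded o_def]) (simp add: integrable_continuous_real)
    then have "integral {a..b} (\<lambda>u. integral {0..1} (P u)) = integral {a..b} (\<lambda>u. Re (integral {0..1} (p u)))"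
      by (intro integral_cong) auto
    also have "\<dots> = Re (integral {a..b} (\<lambda>u. integral {0..1} (p u)))"
      using continuous_on_inner_integral[OF contp]
      by (intro integral_linear[OF _ bounded_linear_Re, unfolded o_def]) (simp add: integrable_continuous_real)
    finally show ?thesis .
  qed
  have I_diff: "\<bar>integral {a..b} (\<lambda>u. integral {0..1} (Q u)) - integral {a..b} (\<lambda>u. integral {0..1} (P u))\<bar> \<le> \<epsilon> / 3"
  proof -
    have i1: "\<bar>integral {0..1} (Q u) - integral {0..1} (P u)\<bar> \<le> e" if "u \<in> {a..b}" for u
    proof -
      have "norm (integral {0..1} (\<lambda>t. Q u t - P u t)) \<le> e * (1 - 0)"
      proof (rule integral_bound)
        show "continuous_on {0..1} (\<lambda>t. Q u t - P u t)"
          using continuous_on_section[OF contQ that] continuous_on_section[OF contP that]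
          by (intro continuous_intros)
        show "norm (Q u t - P u t) \<le> e" if "t \<in> {0..1}" for t
          using p(2)[OF \<open>u \<in> {a..b}\<close> that] by (simp add: P_def)
      qed simp
      then show ?thesis
        using integral_diff[of "Q u" "{0..1}" "P u"] continuous_on_section[OF contQ that] continuous_on_section[OF contP that]
        by (simp add: integrable_continuous_real)
    qed
    have "norm (integral {a..b} (\<lambda>u. integral {0..1} (Q u) - integral {0..1} (P u))) \<le> e * (b - a)"
      using i1 ab continuous_on_inner_integral[OF contQ] continuous_on_inner_integral[OF contP]
      by (intro integral_bound continuous_intros) auto
    also have "\<dots> \<le> \<epsilon> / 3" using e by (simp add: algebra_simps)
    finally show ?thesis
      using integral_diff[of "\<lambda>u. integral {0..1} (Q u)" "{a..b}" "\<lambda>u. integral {0..1} (P u)"]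
        continuous_on_inner_integral[OF contQ] continuous_on_inner_integral[OF contP]
      by (simp add: integrable_continuous_real)
  qed
  have "((\<lambda>R. Re ((\<Sum>m\<in>{\<lceil>a * R\<rceil>..\<lfloor>b * R\<rfloor>}. p (of_int m / R) (R * F (of_int m / R))) /\<^sub>R R))
    \<longlongrightarrow> Re (integral {a..b} (\<lambda>u. integral {0..1} (p u)))) at_top"
    by (intro tendsto_Re trig_sum_equidistributed p)
  then have "\<forall>\<^sub>F R in at_top. dist (Re ((\<Sum>m\<in>{\<lceil>a * R\<rceil>..\<lfloor>b * R\<rfloor>}. p (of_int m / R) (R * F (of_int m / R))) /\<^sub>R R))
     (Re (integral {a..b} (\<lambda>u. integral {0..1} (p u)))) < \<epsilon> / 3"
    using \<open>\<epsilon> > 0\<close> by (intro tendstoD) auto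
  then show "\<forall>\<^sub>F R in at_top. dist ((\<Sum>m\<in>{\<lceil>a * R\<rceil>..\<lfloor>b * R\<rfloor>}. Q (of_int m / R) (frac (R * F (of_int m / R)))) / R)
      (integral {a..b} (\<lambda>u. integral {0..1} (Q u))) < \<epsilon>"
    using eventually_gt_at_top[of 1]
  proof eventually_elim
    case (elim R)
    let ?N = "{\<lceil>a * R\<rceil>..\<lfloor>b * R\<rfloor>}"
    let ?SQ = "\<Sum>m\<in>?N. Q (of_int m / R) (frac (R * F (of_int m / R)))"
    let ?SP = "\<Sum>m\<in>?N. P (of_int m / R) (frac (R * F (of_int m / R)))"
    have "\<bar>?SQ - ?SP\<bar> = norm (\<Sum>m\<in>?N. Q (of_int m / R) (frac (R * F (of_int m / R))) - P (of_int m / R) (frac (R * F (of_int m / R))))"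
      by (simp add: sum_subtractf)
    also have "\<dots> \<le> (\<Sum>m\<in>?N. e)"
    proof (rule sum_norm_le)
      fix m assume "m \<in> ?N"
      then have "of_int m / R \<in> {a..b}" using elim by (auto simp: ceiling_le_iff le_floor_iff field_simps)
      from p(2)[OF this, of "frac (R * F (of_int m / R))"]
      show "norm (Q (of_int m / R) (frac (R * F (of_int m / R))) - P (of_int m / R) (frac (R * F (of_int m / R)))) \<le> e"
        by (simp add: P_def frac_lt_1 less_imp_le)
    qed
    also have "\<dots> = card ?N * e" by simp
    also have "\<dots> \<le> ((b - a + 1) * R) * e"
      using card_scaled_interval_le[of a b R] ab elim e by (intro mult_right_mono) auto
    also have "\<dots> = \<epsilon> / 3 * R" using e(2) by (metis mult.commute mult.left_commute)
    finally have "\<bar>?SQ - ?SP\<bar> / R \<le> \<epsilon> / 3"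
      using elim by (simp only: pos_divide_le_eq)
    then have d1: "\<bar>?SQ / R - ?SP / R\<bar> \<le> \<epsilon> / 3"
      using elim by (simp only: diff_divide_distrib[symmetric] abs_divide abs_of_pos)
    have d2: "?SP / R = Re ((\<Sum>m\<in>?N. p (of_int m / R) (R * F (of_int m / R))) /\<^sub>R R)"
      by (simp add: P_def trig_sum_frac[OF p(1)] divide_inverse mult.commute)
    have "\<bar>?SP / R - integral {a..b} (\<lambda>u. integral {0..1} (P u))\<bar> < \<epsilon> / 3"
      using elim(1) unfolding dist_real_def d2 I_P .
    then show ?case using d1 I_diff unfolding dist_real_def by linarith
  qed
qed

end

section \<open>Area and plane isometries\<close>

definition measure_preserving :: "(real \<times> real \<Rightarrow> real \<times> real) \<Rightarrow> bool" where
  "measure_preserving T \<longleftrightarrow> T \<in> borel_measurable borel \<and> distr lborel lborel T = lborel"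

lemma measure_preserving_comp:
  assumes "measure_preserving S" "measure_preserving T"
  shows "measure_preserving (\<lambda>z. S (T z))"
proof -
  have m: "S \<in> borel_measurable borel" "T \<in> borel_measurable borel"
    and d: "distr lborel lborel S = lborel" "distr lborel lborel T = lborel"
    using assms by (auto simp: measure_preserving_def)
  have "distr lborel lborel (\<lambda>z. S (T z)) = distr (distr lborel lborel T) lborel S"
    using m by (subst distr_distr) (auto simp: comp_def)
  then show ?thesis using m d by (simp add: measure_preserving_def)
qed

lemma area_image:
  assumes "measure_preserving T" "inj T" "T ` A \<in> sets borel"
  shows "area (T ` A) = area A"
proof -
  have "measure lborel (T ` A) = measure (distr lborel lborel T) (T ` A)"
    using assms(1) by (simp add: measure_preserving_def)
  also have "\<dots> = measure lborel (T -` (T ` A) \<inter> space lborel)"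
    using assms by (intro measure_distr) (auto simp: measure_preserving_def)
  also have "T -` (T ` A) \<inter> space lborel = A"
    using assms(2) by (simp add: inj_vimage_image_eq)
  finally show ?thesis by (simp add: area_def)
qed

lemma measure_preserving_translation: "measure_preserving (\<lambda>z. l + z)"
  unfolding measure_preserving_def using lborel_distr_plus[of l] by (auto cong: distr_cong)

lemma emeasure_lborel_translation:
  fixes c :: real
  assumes "A \<in> sets borel"
  shows "emeasure lborel ((\<lambda>x. c + x) -` A) = emeasure lborel A"
proof -
  have "emeasure lborel A = emeasure (distr lborel borel ((+) c)) A"
    using lborel_distr_plus[of c] by simp
  also have "\<dots> = emeasure lborel ((+) c -` A \<inter> space lborel)"
    using assms by (intro emeasure_distr) auto
  finally show ?thesis by simp
qed

lemma emeasure_lborel_pair: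
  assumes "A \<in> sets (borel :: (real \<times> real) measure)"
  shows "emeasure lborel A = (\<integral>\<^sup>+x. emeasure lborel {y. (x, y) \<in> A} \<partial>lborel)"
    and "emeasure lborel A = (\<integral>\<^sup>+y. emeasure lborel {x. (x, y) \<in> A} \<partial>lborel)"
proof -
  have A: "A \<in> sets (lborel \<Otimes>\<^sub>M lborel)" by (metis assms lborel_prod sets_lborel)
  show "emeasure lborel A = (\<integral>\<^sup>+x. emeasure lborel {y. (x, y) \<in> A} \<partial>lborel)"
    using lborel.emeasure_pair_measure_alt[OF A] by (simp add: lborel_prod vimage_def)
  show "emeasure lborel A = (\<integral>\<^sup>+y. emeasure lborel {x. (x, y) \<in> A} \<partial>lborel)"
    using lborel_pair.emeasure_pair_measure_alt2[OF A] by (simp add: lborel_prod vimage_def)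
qed

lemma sets_borel_section:
  assumes "A \<in> sets (borel :: (real \<times> real) measure)"
  shows "{y. (x, y) \<in> A} \<in> sets borel" "{x. (x, y) \<in> A} \<in> sets borel"
proof -
  have "(\<lambda>y. (x, y)) \<in> borel_measurable borel" "(\<lambda>x. (x, y)) \<in> borel_measurable borel"
    by (intro borel_measurable_continuous_onI continuous_intros)+
  from this[THEN measurable_sets, OF assms] show "{y. (x, y) \<in> A} \<in> sets borel" "{x. (x, y) \<in> A} \<in> sets borel"
    by (simp_all add: vimage_def)
qed

lemma measure_preserving_swap: "measure_preserving (\<lambda>(x, y). (y, x))"
proof -
  have m: "(\<lambda>(x, y). (y, x)) \<in> borel_measurable (borel :: (real \<times> real) measure)"
    unfolding split_beta by (intro borel_measurable_continuous_onI continuous_intros)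
  have "distr lborel lborel (\<lambda>(x, y). (y, x)) = (lborel :: (real \<times> real) measure)"
  proof (rule measure_eqI)
    fix A :: "(real \<times> real) set" assume "A \<in> sets (distr lborel lborel (\<lambda>(x, y). (y, x)))"
    then have A: "A \<in> sets borel" by simp
    have B: "(\<lambda>(x, y). (y, x)) -` A \<in> sets (borel :: (real \<times> real) measure)"
      using measurable_sets[OF m A] by simp
    have "emeasure (distr lborel lborel (\<lambda>(x, y). (y, x))) A = emeasure lborel ((\<lambda>(x, y). (y, x)) -` A)"
      using A m by (subst emeasure_distr) auto
    also have "\<dots> = (\<integral>\<^sup>+y. emeasure lborel {x. (y, x) \<in> A} \<partial>lborel)"
      unfolding emeasure_lborel_pair(2)[OF B] by simp
    also have "\<dots> = emeasure lborel A" using emeasure_lborel_pair(1)[OF A] by simp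
    finally show "emeasure (distr lborel lborel (\<lambda>(x, y). (y, x))) A = emeasure lborel A" .
  qed simp
  with m show ?thesis by (simp add: measure_preserving_def)
qed

text \<open>On each horizontal line the map is a translation, by \<open>k * y\<close>; slicing by
  \<open>y\<close> reduces the claim to dimension one.\<close>

lemma measure_preserving_shear: "measure_preserving (\<lambda>(x, y). (x + k * y, y))"
proof -
  let ?T = "\<lambda>(x::real, y::real). (x + k * y, y)"
  have m: "?T \<in> borel_measurable (borel :: (real \<times> real) measure)"
    unfolding split_beta by (intro borel_measurable_continuous_onI continuous_intros)
  have "distr lborel lborel ?T = (lborel :: (real \<times> real) measure)"
  proof (rule measure_eqI)
    fix A :: "(real \<times> real) set" assume "A \<in> sets (distr lborel lborel ?T)"
    then have A: "A \<in> sets borel" by simp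
    have B: "?T -` A \<in> sets (borel :: (real \<times> real) measure)"
      using measurable_sets[OF m A] by simp
    have "emeasure lborel {x. (x + k * y, y) \<in> A} = emeasure lborel {x. (x, y) \<in> A}" for y
      using emeasure_lborel_translation[OF sets_borel_section(2)[OF A], of "k * y" y]
      by (simp add: vimage_def add.commute)
    then have "(\<integral>\<^sup>+y. emeasure lborel {x. (x + k * y, y) \<in> A} \<partial>lborel) = emeasure lborel A"
      using emeasure_lborel_pair(2)[OF A] by simp
    moreover have "emeasure (distr lborel lborel ?T) A = emeasure lborel (?T -` A)"
      using A m by (subst emeasure_distr) auto
    ultimately show "emeasure (distr lborel lborel ?T) A = emeasure lborel A"
      unfolding emeasure_lborel_pair(2)[OF B] by simp
  qed simp
  with m show ?thesis by (simp add: measure_preserving_def)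
qed

lemma rotation_add: "rotation \<alpha> (rotation \<beta> z) = rotation (\<alpha> + \<beta>) z"
  by (cases z) (simp add: rotation_def cos_add sin_add algebra_simps)

text \<open>A rotation is a product of three shears: horizontal by -tan(\<theta>/2), vertical by sin
  \<theta>, horizontal by -tan(\<theta>/2). The vertical shear is the horizontal one conjugated by
  the swap. The hypothesis makes the tangent finite.\<close>

lemma measure_preserving_rotation_aux:
  assumes "cos (\<theta> / 2) \<noteq> 0"
  shows "measure_preserving (rotation \<theta>)"
proof -
  define c s where "c = cos (\<theta> / 2)" and "s = sin (\<theta> / 2)"
  have c: "c \<noteq> 0" and cs: "c\<^sup>2 + s\<^sup>2 = 1" using assms by (auto simp: c_def s_def)
  have st: "sin \<theta> = 2 * s * c" "cos \<theta> = c\<^sup>2 - s\<^sup>2"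
    using sin_double[of "\<theta> / 2"] cos_double[of "\<theta> / 2"] by (simp_all add: c_def s_def)
  let ?X = "\<lambda>k (x::real, y::real). (x + k * y, y)"
  let ?W = "\<lambda>(x::real, y::real). (y, x)"
  have *: "measure_preserving (\<lambda>z. ?X (- (s / c)) (?W (?X (sin \<theta>) (?W (?X (- (s / c)) z)))))"
    by (rule measure_preserving_comp[OF measure_preserving_shear measure_preserving_comp[OF measure_preserving_swap
          measure_preserving_comp[OF measure_preserving_shear measure_preserving_comp[OF measure_preserving_swap
            measure_preserving_shear]]]])
  have "(\<lambda>z. ?X (- (s / c)) (?W (?X (sin \<theta>) (?W (?X (- (s / c)) z))))) = rotation \<theta>"
  proof
    fix z :: "real \<times> real"
    obtain x y where z: "z = (x, y)" by (cases z)
    have 1: "1 - s / c * sin \<theta> = cos \<theta>" using c cs by (simp add: st power2_eq_square)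
    have 2: "- (s / c) + (- (s / c)) * cos \<theta> = - sin \<theta>"
    proof -
      have "1 + cos \<theta> = 2 * c\<^sup>2" using cs st by simp
      then have "- (s / c) * (1 + cos \<theta>) = - (s / c) * (2 * c\<^sup>2)" by simp
      also have "\<dots> = - sin \<theta>" unfolding st(1) using c by (simp add: power2_eq_square)
      finally have "- (s / c) * (1 + cos \<theta>) = - sin \<theta>" .
      then show ?thesis by (simp add: algebra_simps)
    qed
    have a: "x + - (s / c) * y + - (s / c) * (y + sin \<theta> * (x + - (s / c) * y))
        = x * (1 - s / c * sin \<theta>) + y * (- (s / c) + (- (s / c)) * (1 - s / c * sin \<theta>))"
      by (simp add: algebra_simps)
    have b: "y + sin \<theta> * (x + - (s / c) * y) = x * sin \<theta> + y * (1 - s / c * sin \<theta>)"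
      by (simp add: algebra_simps)
    have "x + - (s / c) * y + - (s / c) * (y + sin \<theta> * (x + - (s / c) * y)) = x * cos \<theta> - y * sin \<theta>"
      unfolding a unfolding 1 2 by simp
    moreover have "y + sin \<theta> * (x + - (s / c) * y) = x * sin \<theta> + y * cos \<theta>"
      unfolding b unfolding 1 ..
    ultimately show "?X (- (s / c)) (?W (?X (sin \<theta>) (?W (?X (- (s / c)) z)))) = rotation \<theta> z"
      unfolding z rotation_def prod.case by (rule arg_cong2[where f = Pair])
  qed
  with * show ?thesis by simp
qed

text \<open>In the exceptional case the double-angle formula gives cos(\<theta>/4) squared equal to
  1/2, so the rotation by \<theta>/2 is covered and is applied twice.\<close>

lemma measure_preserving_rotation: "measure_preserving (rotation \<theta>)"
proof (cases "cos (\<theta> / 2) = 0")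
  case True
  have "cos (\<theta> / 2) = 2 * (cos (\<theta> / 2 / 2))\<^sup>2 - 1" by (metis cos_double_cos field_sum_of_halves mult_2)
  with True have "cos (\<theta> / 2 / 2) \<noteq> 0" by auto
  then have *: "measure_preserving (rotation (\<theta> / 2))" by (rule measure_preserving_rotation_aux)
  have "measure_preserving (\<lambda>z. rotation (\<theta> / 2) (rotation (\<theta> / 2) z))"
    by (rule measure_preserving_comp[OF * *])
  then show ?thesis by (simp add: rotation_add)
qed (rule measure_preserving_rotation_aux)

lemma inj_rotation: "inj (rotation \<theta>)"
proof (rule injI)
  fix z w assume "rotation \<theta> z = rotation \<theta> w"
  then have "rotation (- \<theta>) (rotation \<theta> z) = rotation (- \<theta>) (rotation \<theta> w)" by simp
  then show "z = w" by (simp add: rotation_add) (simp add: rotation_def split_beta prod_eq_iff)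
qed

lemma continuous_on_rotation: "continuous_on A (rotation \<theta>)"
  unfolding rotation_def split_beta by (intro continuous_intros)

section \<open>The unit square cut by a half-plane\<close>

definition sq_cut :: "real \<Rightarrow> real \<Rightarrow> real \<Rightarrow> real" where
  "sq_cut r c s = area {z \<in> unit_square. r + c * fst z + s * snd z \<le> 0}"

lemma compact_unit_square: "compact unit_square"
  unfolding unit_square_def by (intro compact_Times compact_Icc)

lemma compact_sq_cut: "compact {z \<in> unit_square. r + c * fst z + s * snd z \<le> 0}"
proof -
  have "{z \<in> unit_square. r + c * fst z + s * snd z \<le> 0} = unit_square \<inter> {z. r + c * fst z + s * snd z \<le> 0}"
    by auto
  moreover have "closed {z::real \<times> real. r + c * fst z + s * snd z \<le> 0}"
    by (intro closed_Collect_le continuous_intros)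
  ultimately show ?thesis using compact_unit_square by auto
qed

text \<open>Undoing the rigid motion keeps the square fixed and moves the half-plane instead: the
  first coordinate of the moved point becomes an affine function on the unit square whose normal is
  a unit vector and whose constant is \<open>r\<close>.\<close>

lemma area_limit_eq_sq_cut: "area_limit (r, \<theta>) = sq_cut r (cos \<theta>) (- sin \<theta>)"
proof -
  let ?A = "{z \<in> unit_square. r + cos \<theta> * fst z + - sin \<theta> * snd z \<le> 0}"
  let ?T = "\<lambda>z. (r, 0) + rotation \<theta> z"
  have "{(x, y). (x, y) \<in> moved_square r \<theta> \<and> x \<le> 0} = ?T ` ?A"
  proof -
    have "fst (?T z) = r + cos \<theta> * fst z + - sin \<theta> * snd z" for z
      by (simp add: rotation_def split_beta)
    then have "?T ` ?A = {w \<in> ?T ` unit_square. fst w \<le> 0}" by auto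
    moreover have "moved_square r \<theta> = ?T ` unit_square"
      by (simp add: moved_square_def image_image)
    moreover have "{(x, y). (x, y) \<in> moved_square r \<theta> \<and> x \<le> 0} = {w \<in> moved_square r \<theta>. fst w \<le> 0}" by auto
    ultimately show ?thesis by (simp only:)
  qed
  moreover have "area (?T ` ?A) = area ?A"
  proof (rule area_image)
    show "measure_preserving ?T"
      by (rule measure_preserving_comp[OF measure_preserving_translation measure_preserving_rotation])
    show "inj ?T" using inj_rotation[of \<theta>] by (auto simp: inj_on_def)
    show "?T ` ?A \<in> sets borel"
      by (intro borel_compact compact_continuous_image compact_sq_cut continuous_intros continuous_on_rotation)
  qed
  ultimately show ?thesis by (simp add: area_limit_def sq_cut_def)
qed

text \<open>This swap and the quarter turn below generate the symmetry group of the square, acting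
  on the normal \<open>(c, s)\<close>. Hence signs and order of \<open>c\<close> and
  \<open>s\<close> are irrelevant, and the variance needs only an eighth of the circle.\<close>

lemma sq_cut_swap: "sq_cut r c s = sq_cut r s c"
proof -
  let ?T = "\<lambda>(x::real, y::real). (y, x)"
  have "?T ` {z \<in> unit_square. r + s * fst z + c * snd z \<le> 0} = {z \<in> unit_square. r + c * fst z + s * snd z \<le> 0}"
    by (auto simp: unit_square_def image_iff algebra_simps)
  moreover have "area (?T ` {z \<in> unit_square. r + s * fst z + c * snd z \<le> 0}) = area {z \<in> unit_square. r + s * fst z + c * snd z \<le> 0}"
    unfolding split_beta
    by (intro area_image borel_compact compact_continuous_image compact_sq_cut continuous_intros
        measure_preserving_swap[unfolded split_beta]) (auto simp: inj_on_def prod_eq_iff)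
  ultimately show ?thesis by (simp add: sq_cut_def)
qed

lemma sq_cut_quarter_turn: "sq_cut r c s = sq_cut r (- s) c"
proof -
  have T: "rotation (pi / 2) z = (- snd z, fst z)" for z by (simp add: rotation_def split_beta)
  have "rotation (pi / 2) ` {z \<in> unit_square. r + c * fst z + s * snd z \<le> 0} = {z \<in> unit_square. r + - s * fst z + c * snd z \<le> 0}"
    (is "_ ` ?A = ?B")
  proof
    show "rotation (pi / 2) ` ?A \<subseteq> ?B"
      unfolding T by (auto simp: unit_square_def algebra_simps)
    show "?B \<subseteq> rotation (pi / 2) ` ?A"
    proof
      fix z assume "z \<in> ?B"
      then have "(snd z, - fst z) \<in> ?A" by (cases z) (auto simp: unit_square_def algebra_simps)
      moreover have "z = rotation (pi / 2) (snd z, - fst z)" by (simp add: T)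
      ultimately show "z \<in> rotation (pi / 2) ` ?A" by blast
    qed
  qed
  moreover have "area (rotation (pi / 2) ` {z \<in> unit_square. r + c * fst z + s * snd z \<le> 0}) = area {z \<in> unit_square. r + c * fst z + s * snd z \<le> 0}"
    by (intro area_image borel_compact compact_continuous_image compact_sq_cut continuous_on_rotation
        measure_preserving_rotation inj_rotation)
  ultimately show ?thesis by (simp add: sq_cut_def)
qed

text \<open>The length of the part of the interval from -1/2 to 1/2 that lies below
  \<open>v\<close>: the vertical cross section of the cut square.\<close>

definition ramp :: "real \<Rightarrow> real" where "ramp v = max 0 (min 1 (v + 1/2))"

lemma ramp_bounds: "0 \<le> ramp v" "ramp v \<le> 1"
  by (auto simp: ramp_def)

lemma ramp_lipschitz: "v \<le> w \<Longrightarrow> ramp w - ramp v \<le> w - v"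
  by (auto simp: ramp_def)

lemma ramp_minus: "ramp (- v) = 1 - ramp v"
  by (auto simp: ramp_def)

lemma continuous_on_ramp [continuous_intros]:
  "continuous_on A f \<Longrightarrow> continuous_on A (\<lambda>x. ramp (f x))"
  unfolding ramp_def by (intro continuous_intros)

text \<open>For \<open>s > 0\<close> the half-plane is the region below a graph, and each vertical
  slice of the cut square is an interval of length \<open>ramp\<close>. Continuity, the Lipschitz
  bound, the reflection symmetry and the closed forms are all read off from this integral.\<close>

lemma sq_cut_eq_integral:
  assumes "s > 0"
  shows "sq_cut r c s = integral {-1/2..1/2} (\<lambda>x. ramp ((- r - c * x) / s))"
proof -
  let ?A = "{z \<in> unit_square. r + c * fst z + s * snd z \<le> 0}"
  let ?g = "\<lambda>x. ramp ((- r - c * x) / s)"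
  let ?f = "\<lambda>x. if x \<in> {-1/2..1/2} then ?g x else 0"
  have "(?g has_integral integral {-1/2..1/2} ?g) {-1/2..1/2}"
    using assms by (intro integrable_integral integrable_continuous_real continuous_intros) auto
  then have hi: "(?f has_integral integral {-1/2..1/2} ?g) UNIV"
    by (simp only: has_integral_restrict_UNIV)
  have "?A \<in> sets borel" by (intro borel_compact compact_sq_cut)
  then have "emeasure lborel ?A = (\<integral>\<^sup>+x. emeasure lborel {y. (x, y) \<in> ?A} \<partial>lborel)"
    by (rule emeasure_lborel_pair)
  also have "\<dots> = (\<integral>\<^sup>+x. ennreal (?f x) \<partial>lborel)"
  proof (rule nn_integral_cong)
    fix x :: real
    show "emeasure lborel {y. (x, y) \<in> ?A} = ennreal (?f x)"
    proof (cases "x \<in> {-1/2..1/2}")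
      case True
      define v where "v = (- r - c * x) / s"
      have v: "r + c * x + s * y \<le> 0 \<longleftrightarrow> y \<le> v" for y
        using assms by (auto simp: v_def field_simps)
      have "{y. (x, y) \<in> ?A} = {y \<in> {-1/2..1/2}. r + c * x + s * y \<le> 0}"
        using True by (simp add: unit_square_def)
      also have "\<dots> = {-1/2..min (1/2) v}" unfolding v by auto
      finally have "emeasure lborel {y. (x, y) \<in> ?A} = ennreal (ramp v)"
        by (simp only: emeasure_lborel_Icc_eq) (auto simp: ramp_def ennreal_neg)
      then show ?thesis using True by (simp add: v_def)
    qed (auto simp: unit_square_def)
  qed
  also have "\<dots> = ennreal (integral {-1/2..1/2} ?g)"
  proof (rule nn_integral_has_integral_lborel[OF _ _ hi])
    show "?f \<in> borel_measurable borel"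
      using assms by (intro measurable_If borel_measurable_continuous_onI continuous_intros) auto
  qed (simp add: ramp_bounds)
  finally have em: "emeasure lborel ?A = ennreal (integral {-1/2..1/2} ?g)" .
  have "0 \<le> integral {-1/2..1/2} ?g"
    using assms by (intro integral_nonneg integrable_continuous_real continuous_intros ramp_bounds) auto
  then show ?thesis
    unfolding sq_cut_def area_def measure_def em by (rule enn2real_ennreal)
qed

section \<open>Squares cut by lines and by large discs\<close>

lemma area_subset_unit_square:
  assumes "A \<subseteq> unit_square" "A \<in> sets borel"
  shows "0 \<le> area A" "area A \<le> 1"
proof -
  have sq: "unit_square = cbox (-1/2, -1/2) (1/2, 1/2)"
    by (auto simp: unit_square_def cbox_Pair_eq)
  have "area unit_square = 1"
    unfolding area_def sq by (simp add: content_Pair)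
  moreover have "area A \<le> area unit_square"
    unfolding area_def using assms compact_unit_square
    by (intro measure_mono_fmeasurable) (auto simp: fmeasurable_compact)
  ultimately show "area A \<le> 1" by simp
qed (simp add: area_def)

lemma sq_cut_bounds: "0 \<le> sq_cut r c s" "sq_cut r c s \<le> 1"
  unfolding sq_cut_def by (intro area_subset_unit_square borel_compact compact_sq_cut; auto)+

text \<open>Moving the line by \<open>\<delta>\<close> moves the threshold of every slice by
  \<open>\<delta> / s\<close>, which is at most \<open>2 * \<delta>\<close>, and \<open>ramp\<close>
  is 1-Lipschitz.\<close>

lemma sq_cut_diff_le:
  assumes "s \<ge> 1/2" "\<delta> \<ge> 0"
  shows "sq_cut r c s - sq_cut (r + \<delta>) c s \<le> 2 * \<delta>"
proof -
  have s: "s > 0" using assms by simp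
  let ?f = "\<lambda>r x. ramp ((- r - c * x) / s)"
  have int: "?f r integrable_on {-1/2..1/2}" for r
    using s by (intro integrable_continuous_real continuous_intros) auto
  have "sq_cut r c s - sq_cut (r + \<delta>) c s = integral {-1/2..1/2} (\<lambda>x. ?f r x - ?f (r + \<delta>) x)"
    unfolding sq_cut_eq_integral[OF s] by (rule integral_diff[symmetric, OF int int])
  also have "\<dots> \<le> integral {-1/2..1/2} (\<lambda>x::real. 2 * \<delta>)"
  proof (rule integral_le)
    fix x :: real
    have eq: "(- r - c * x) / s = (- (r + \<delta>) - c * x) / s + \<delta> / s"
      using s by (simp add: add_divide_distrib[symmetric])
    have "0 \<le> \<delta> / s" "\<delta> / s \<le> 2 * \<delta>" using assms s mult_right_mono[of "1/2" s \<delta>] by (auto simp: field_simps)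
    then show "?f r x - ?f (r + \<delta>) x \<le> 2 * \<delta>"
      using ramp_lipschitz[of "(- (r + \<delta>) - c * x) / s" "(- r - c * x) / s"] eq by linarith
  qed (intro integrable_diff int integrable_const_ivl)+
  also have "\<dots> = 2 * \<delta>" by simp
  finally show ?thesis .
qed

text \<open>The point reflection of the square exchanges the two sides of the cut. Analytically:
  reflect \<open>x\<close> and use \<open>ramp_minus\<close>. This yields the mean 1/2 and the
  evenness in \<open>r\<close> of the variance integrand.\<close>

lemma sq_cut_uminus:
  assumes "s > 0"
  shows "sq_cut (- r) c s = 1 - sq_cut r c s"
proof -
  let ?f = "\<lambda>x. ramp ((- r - c * x) / s)"
  have int: "?f integrable_on {-1/2..1/2}"
    using assms by (intro integrable_continuous_real continuous_intros) auto
  have "sq_cut (- r) c s = integral {-1/2..1/2} (\<lambda>x. ramp ((r - c * x) / s))"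
    using sq_cut_eq_integral[OF assms, of "- r" c] by simp
  also have "\<dots> = integral {-1/2..1/2} (\<lambda>x. ramp ((r - c * (- x)) / s))"
    using Henstock_Kurzweil_Integration.integral_reflect_real[where a = "-1/2" and b = "1/2" and f = "\<lambda>x. ramp ((r - c * x) / s)"] by simp
  also have "\<dots> = integral {-1/2..1/2} (\<lambda>x. 1 - ?f x)"
  proof (rule integral_cong)
    fix x
    have "(r - c * (- x)) / s = - ((- r - c * x) / s)" by (simp add: minus_divide_left)
    then show "ramp ((r - c * (- x)) / s) = 1 - ?f x" by (simp only: ramp_minus)
  qed
  also have "\<dots> = integral {-1/2..1/2} (\<lambda>x::real. 1) - integral {-1/2..1/2} ?f"
    by (intro integral_diff int integrable_const_ivl)
  finally show ?thesis using sq_cut_eq_integral[OF assms, of r c] by simp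
qed

lemma continuous_on_sq_cut:
  fixes f g k :: "'a::topological_space \<Rightarrow> real"
  assumes "continuous_on A f" "continuous_on A g" "continuous_on A k" "\<And>x. x \<in> A \<Longrightarrow> k x > 0"
  shows "continuous_on A (\<lambda>x. sq_cut (f x) (g x) (k x))"
proof -
  let ?q = "\<lambda>p::real \<times> real \<times> real. sq_cut (fst p) (fst (snd p)) (snd (snd p))"
  let ?U = "{p::real \<times> real \<times> real. snd (snd p) > 0}"
  have "continuous_on ?U (\<lambda>p. integral (cbox (-1/2) (1/2)) (\<lambda>x. ramp ((- fst p - fst (snd p) * x) / snd (snd p))))"
    by (rule integral_continuous_on_param) (auto simp: split_beta intro!: continuous_intros)
  then have *: "continuous_on ?U ?q"
    by (rule continuous_on_eq) (simp add: sq_cut_eq_integral)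
  have "continuous_on A (\<lambda>x. ?q (f x, g x, k x))"
    by (rule continuous_on_compose2[OF *]) (use assms in \<open>auto intro!: continuous_intros\<close>)
  then show ?thesis by simp
qed

section \<open>The unit square cut by a large disc\<close>

lemma sets_disc_cut: "{z \<in> unit_square. norm (l + z) < R} \<in> sets borel"
proof -
  have "{z \<in> unit_square. norm (l + z) < R} = unit_square \<inter> {z. norm (l + z) < R}" by auto
  moreover have "open {z. norm (l + z) < R}" by (intro open_Collect_less continuous_intros)
  ultimately show ?thesis using borel_compact[OF compact_unit_square] by auto
qed

lemma area_disc_eq: "area_disc R l = area {z \<in> unit_square. norm (l + z) < R}"
proof -
  let ?A = "{z \<in> unit_square. norm (l + z) < R}"
  have eq: "(\<lambda>z. l + z) ` unit_square \<inter> ball 0 R = (\<lambda>z. l + z) ` ?A"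
  proof -
    have "ball 0 R = {z :: real \<times> real. norm z < R}"
      by (rule set_eqI) (simp only: mem_ball_0 mem_Collect_eq)
    then show ?thesis by auto
  qed
  have "compact ((\<lambda>z. l + z) ` unit_square)"
    by (intro compact_continuous_image continuous_intros compact_unit_square)
  then have "(\<lambda>z. l + z) ` ?A \<in> sets borel"
    unfolding eq[symmetric] by (intro sets.Int borel_compact borel_open) auto
  then show ?thesis
    unfolding area_disc_def eq by (intro area_image measure_preserving_translation) auto
qed

lemma area_disc_bounds: "0 \<le> area_disc R l" "area_disc R l \<le> 1"
  unfolding area_disc_eq by (intro area_subset_unit_square sets_disc_cut; auto)+

lemma area_disc_quarter_turn: "area_disc R (- y, x) = area_disc R (x, y)"
proof -
  let ?A = "{z \<in> unit_square. norm ((x, y) + z) < R}" and ?B = "{z \<in> unit_square. norm ((- y, x) + z) < R}"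
  have T: "rotation (pi / 2) z = (- snd z, fst z)" for z by (simp add: rotation_def split_beta)
  have n: "norm ((- y, x) + (- v, u)) = norm ((x, y) + (u, v))" for u v
  proof -
    have "- y + - v = - (y + v)" by simp
    then show ?thesis by (simp only: add_Pair norm_Pair norm_minus_cancel add.commute)
  qed
  have eq: "rotation (pi / 2) ` ?A = ?B"
  proof
    show "rotation (pi / 2) ` ?A \<subseteq> ?B" unfolding T using n by (auto simp: unit_square_def)
    show "?B \<subseteq> rotation (pi / 2) ` ?A"
    proof
      fix z assume z: "z \<in> ?B"
      have "norm ((- y, x) + z) = norm ((x, y) + (snd z, - fst z))"
        using n[of "- fst z" "snd z"] by simp
      then have "(snd z, - fst z) \<in> ?A" using z by (auto simp: unit_square_def)
      moreover have "z = rotation (pi / 2) (snd z, - fst z)" by (simp add: T)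
      ultimately show "z \<in> rotation (pi / 2) ` ?A" by blast
    qed
  qed
  show ?thesis
    unfolding area_disc_eq eq[symmetric] using sets_disc_cut[of "(- y, x)" R] unfolding eq[symmetric]
    by (intro area_image measure_preserving_rotation inj_rotation)
qed

text \<open>With \<open>p\<close> the component of the displacement along the unit normal
  \<open>(u, v)\<close>, the squared norm is \<open>R\<^sup>2 + 2 * R * p\<close> plus the squared
  length of the displacement. Completing the square gives the linear lower bound; the slack
  \<open>25 / R\<close> absorbs the tangential part.\<close>

lemma norm_near_circle:
  fixes R u v x y :: real
  assumes uv: "u\<^sup>2 + v\<^sup>2 = 1" and xy: "x\<^sup>2 + y\<^sup>2 \<le> 25" and R: "R \<ge> 10"
  shows "R + (u * x + v * y) \<le> norm (R * u + x, R * v + y)"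
    and "norm (R * u + x, R * v + y) \<le> R + (u * x + v * y) + 25 / R"
proof -
  define p where "p = u * x + v * y"
  have nsq: "(R * u + x)\<^sup>2 + (R * v + y)\<^sup>2 = R\<^sup>2 + 2 * R * p + (x\<^sup>2 + y\<^sup>2)"
  proof -
    have "(R * u + x)\<^sup>2 + (R * v + y)\<^sup>2 = R\<^sup>2 * (u\<^sup>2 + v\<^sup>2) + 2 * R * p + (x\<^sup>2 + y\<^sup>2)"
      unfolding p_def by algebra
    then show ?thesis using uv by simp
  qed
  \<comment> \<open>Lagrange's identity, that is, Cauchy-Schwarz with its remainder.\<close>
  have "(x\<^sup>2 + y\<^sup>2) * (u\<^sup>2 + v\<^sup>2) = p\<^sup>2 + (u * y - v * x)\<^sup>2" unfolding p_def by algebra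
  then have p2: "p\<^sup>2 \<le> x\<^sup>2 + y\<^sup>2" using uv by simp
  then have "p\<^sup>2 \<le> 5\<^sup>2" using xy by simp
  then have "\<bar>p\<bar> \<le> 5" using abs_le_square_iff[of p 5] by simp
  then have p: "-5 \<le> p" "p \<le> 5" by auto
  have n: "norm (R * u + x, R * v + y) = sqrt (R\<^sup>2 + 2 * R * p + (x\<^sup>2 + y\<^sup>2))"
    unfolding norm_Pair real_norm_def power2_abs nsq ..
  have "(R + p)\<^sup>2 \<le> R\<^sup>2 + 2 * R * p + (x\<^sup>2 + y\<^sup>2)" using p2 by (simp add: power2_sum)
  then have "R + p \<le> norm (R * u + x, R * v + y)" unfolding n by (rule real_le_rsqrt)
  then show "R + (u * x + v * y) \<le> norm (R * u + x, R * v + y)" by (simp add: p_def)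
  have R0: "R > 0" using R by simp
  \<comment> \<open>As \<open>p\<close> is at least -5 and \<open>R\<close> at least 10,
    \<open>R + p\<close> is at least half of \<open>R\<close>; the cross term of the square below
    then pays for the whole squared displacement.\<close>
  have "25 \<le> 2 * (R + p) * (25 / R)"
  proof -
    have "R \<le> 2 * (R + p)" using p R by simp
    then have "R * (25 / R) \<le> 2 * (R + p) * (25 / R)" using R0 by (intro mult_right_mono) auto
    then show ?thesis using R0 by simp
  qed
  moreover have "(R + p + 25 / R)\<^sup>2 = R\<^sup>2 + 2 * R * p + p\<^sup>2 + 2 * (R + p) * (25 / R) + (25 / R)\<^sup>2"
    by (simp add: power2_eq_square algebra_simps)
  moreover have "0 \<le> p\<^sup>2" "0 \<le> (25 / R)\<^sup>2" by simp_all
  ultimately have "R\<^sup>2 + 2 * R * p + (x\<^sup>2 + y\<^sup>2) \<le> (R + p + 25 / R)\<^sup>2"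
    using xy by linarith
  then have "norm (R * u + x, R * v + y) \<le> R + p + 25 / R"
    unfolding n using p R R0 by (intro real_le_lsqrt) (auto intro: add_nonneg_nonneg)
  then show "norm (R * u + x, R * v + y) \<le> R + (u * x + v * y) + 25 / R" by (simp add: p_def)
qed

text \<open>The point lies \<open>t\<close> above the point \<open>(R * u, R * v)\<close> of the
  circle, so its signed distance is nearly \<open>t * v\<close>. The cut by the disc is squeezed
  between the cut by the half-plane and the cut by the same half-plane moved slightly
  inwards.\<close>

lemma near_circle_estimates:
  assumes uv: "u\<^sup>2 + v\<^sup>2 = 1" and v: "v \<ge> 1/2" and t: "\<bar>t\<bar> \<le> 3" and R: "R \<ge> 10"
  shows "\<bar>norm (R * u, R * v + t) - R - t * v\<bar> \<le> 25 / R"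
    and "\<bar>area_disc R (R * u, R * v + t) - sq_cut (t * v) u v\<bar> \<le> 100 / R"
proof -
  have R0: "R > 0" using R by simp
  have t2: "t\<^sup>2 \<le> 9" using t abs_le_square_iff[of t 3] by simp
  show "\<bar>norm (R * u, R * v + t) - R - t * v\<bar> \<le> 25 / R"
    using norm_near_circle[OF uv _ R, of 0 t] t2 by (simp add: mult.commute abs_le_iff)
  define \<delta> where "\<delta> = 25 / R"
  have \<delta>: "\<delta> > 0" using R0 by (simp add: \<delta>_def)
  let ?l = "(R * u, R * v + t)"
  have est: "R + (t * v + u * fst z + v * snd z) \<le> norm (?l + z)"
      "norm (?l + z) \<le> R + (t * v + u * fst z + v * snd z) + \<delta>" if "z \<in> unit_square" for z
  proof -
    obtain x y where z: "z = (x, y)" by (cases z)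
    have "-1/2 \<le> x" "x \<le> 1/2" "-1/2 \<le> y" "y \<le> 1/2" using that z by (auto simp: unit_square_def)
    then have "\<bar>x\<bar> \<le> 1/2" "\<bar>t + y\<bar> \<le> 7/2" using t by linarith+
    then have "x\<^sup>2 \<le> (1/2)\<^sup>2" "(t + y)\<^sup>2 \<le> (7/2)\<^sup>2" unfolding abs_le_square_iff[symmetric] by auto
    then have "x\<^sup>2 + (t + y)\<^sup>2 \<le> 25" by (simp add: power2_eq_square)
    from norm_near_circle[OF uv this R]
    show "R + (t * v + u * fst z + v * snd z) \<le> norm (?l + z)"
      "norm (?l + z) \<le> R + (t * v + u * fst z + v * snd z) + \<delta>"
      by (simp_all add: z \<delta>_def algebra_simps)
  qed
  have "area_disc R ?l \<le> sq_cut (t * v) u v"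
    unfolding area_disc_eq sq_cut_def area_def
  proof (rule measure_mono_fmeasurable)
    show "{z \<in> unit_square. norm (?l + z) < R} \<subseteq> {z \<in> unit_square. t * v + u * fst z + v * snd z \<le> 0}"
      using est(1) by force
  qed (use sets_disc_cut compact_sq_cut in \<open>auto intro: fmeasurable_compact\<close>)
  \<comment> \<open>A move by \<open>\<delta>\<close> would only give norm at most \<open>R\<close>,
    while the disc is open; \<open>2 * \<delta>\<close> gives the strict inequality. With the
    Lipschitz constant 2 this costs \<open>4 * \<delta> = 100 / R\<close>.\<close>
  moreover have "sq_cut (t * v + 2 * \<delta>) u v \<le> area_disc R ?l"
    unfolding area_disc_eq sq_cut_def area_def
  proof (rule measure_mono_fmeasurable)
    show "{z \<in> unit_square. t * v + 2 * \<delta> + u * fst z + v * snd z \<le> 0} \<subseteq> {z \<in> unit_square. norm (?l + z) < R}"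
    proof
      fix z assume "z \<in> {z \<in> unit_square. t * v + 2 * \<delta> + u * fst z + v * snd z \<le> 0}"
      then have z: "z \<in> unit_square" "t * v + 2 * \<delta> + u * fst z + v * snd z \<le> 0" by auto
      have "norm (?l + z) < R" using est(2)[OF z(1)] z(2) \<delta> by linarith
      then show "z \<in> {z \<in> unit_square. norm (?l + z) < R}" using z(1) by simp
    qed
    show "{z \<in> unit_square. norm (?l + z) < R} \<in> fmeasurable lborel"
      using sets_disc_cut compact_unit_square
      by (intro fmeasurableI2[OF fmeasurable_compact[OF compact_unit_square]]) auto
  qed (use compact_sq_cut in \<open>auto intro: borel_compact\<close>)
  moreover have "sq_cut (t * v) u v - sq_cut (t * v + 2 * \<delta>) u v \<le> 2 * (2 * \<delta>)"
    using v \<delta> by (intro sq_cut_diff_le) auto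
  ultimately show "\<bar>area_disc R ?l - sq_cut (t * v) u v\<bar> \<le> 100 / R"
    by (simp add: \<delta>_def)
qed

section \<open>Columns of lattice points near the circle\<close>

text \<open>One number in two roles: the circumradius of the square, hence half the width of the
  annulus, and the sine and cosine of pi/4, hence the end of the quarter arc.\<close>

definition half_diag :: real where "half_diag = 1 / sqrt 2"

lemma half_diag_sq: "half_diag\<^sup>2 = 1/2"
  by (simp add: half_diag_def power_divide)

lemma half_diag_bounds: "7/10 < half_diag" "half_diag < 3/4"
proof -
  have 1: "(7/10)\<^sup>2 < half_diag\<^sup>2" and 2: "half_diag\<^sup>2 < (3/4)\<^sup>2"
    unfolding half_diag_sq by (simp_all add: power2_eq_square)
  have "0 \<le> half_diag" by (simp add: half_diag_def)
  with 1 show "7/10 < half_diag" by (rule power2_less_imp_less)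
  from 2 show "half_diag < 3/4" by (rule power2_less_imp_less) simp
qed

definition circ :: "real \<Rightarrow> real" where "circ u = sqrt (1 - u\<^sup>2)"

lemma circ_facts:
  assumes "\<bar>u\<bar> \<le> half_diag"
  shows "u\<^sup>2 + (circ u)\<^sup>2 = 1" "half_diag \<le> circ u" "circ u \<le> 1" "1/2 < circ u"
proof -
  have "u\<^sup>2 \<le> half_diag\<^sup>2" using assms half_diag_bounds by (intro abs_le_square_iff[THEN iffD1]) auto
  then have u: "u\<^sup>2 \<le> 1/2" by (simp add: half_diag_sq)
  then show 1: "u\<^sup>2 + (circ u)\<^sup>2 = 1" by (simp add: circ_def)
  have "half_diag\<^sup>2 \<le> 1 - u\<^sup>2" using u by (simp add: half_diag_sq)
  then show "half_diag \<le> circ u" unfolding circ_def by (rule real_le_rsqrt)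
  then show "1/2 < circ u" using half_diag_bounds by linarith
  show "circ u \<le> 1" by (simp add: circ_def)
qed

lemma continuous_on_circ [continuous_intros]: "continuous_on A f \<Longrightarrow> continuous_on A (\<lambda>x. circ (f x))"
  unfolding circ_def by (intro continuous_intros)

text \<open>The arc stops at 45 degrees, where the slope is still finite. Equal slopes at
  \<open>u\<close> and \<open>v\<close> force equal squares, hence equal heights, and then the slope
  equation itself gives \<open>u = v\<close>, sign included.\<close>

interpretation circ: curve "- half_diag" half_diag circ "\<lambda>u. - u / circ u"
proof
  show "- half_diag \<le> half_diag" using half_diag_bounds by simp
next
  fix u assume "u \<in> {- half_diag..half_diag}"
  then have "\<bar>u\<bar> \<le> half_diag" by auto
  note c = circ_facts[OF this]
  then have "0 < 1 - u\<^sup>2" by (metis circ_def half_gt_zero_iff less_trans real_sqrt_gt_0_iff zero_less_one)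
  then show "(circ has_real_derivative - u / circ u) (at u within {- half_diag..half_diag})"
    unfolding circ_def by (auto intro!: derivative_eq_intros simp: field_simps)
next
  have "circ x \<noteq> 0" if "x \<in> {- half_diag..half_diag}" for x
    using circ_facts(4)[of x] that by (auto simp: abs_le_iff)
  then show "continuous_on {- half_diag..half_diag} (\<lambda>u. - u / circ u)"
    by (intro continuous_intros) auto
next
  show "inj_on (\<lambda>u. - u / circ u) {- half_diag..half_diag}"
  proof (rule inj_onI)
    fix u v assume uv: "u \<in> {- half_diag..half_diag}" "v \<in> {- half_diag..half_diag}" "- u / circ u = - v / circ v"
    then have c: "u\<^sup>2 + (circ u)\<^sup>2 = 1" "1/2 < circ u" "v\<^sup>2 + (circ v)\<^sup>2 = 1" "1/2 < circ v"
      using circ_facts[of u] circ_facts[of v] by auto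
    then have e: "u * circ v = v * circ u" using uv(3) by (auto simp: field_simps)
    then have "u\<^sup>2 * (circ v)\<^sup>2 = v\<^sup>2 * (circ u)\<^sup>2" by (metis power_mult_distrib)
    moreover have "(circ u)\<^sup>2 = 1 - u\<^sup>2" "(circ v)\<^sup>2 = 1 - v\<^sup>2" using c by auto
    ultimately have "u\<^sup>2 * (1 - v\<^sup>2) = v\<^sup>2 * (1 - u\<^sup>2)" by simp
    then have "u\<^sup>2 = v\<^sup>2" by (simp add: algebra_simps)
    then have "circ u = circ v" by (simp add: circ_def)
    then show "u = v" using e c by simp
  qed
qed

text \<open>As \<open>t\<close> runs through the unit interval, the points
  \<open>(j - t) * v\<close> sweep from \<open>j * v\<close> down to \<open>(j - 1) * v\<close> at
  speed \<open>v\<close>. The six values of \<open>j\<close> tile the interval from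
  \<open>-3 * v\<close> to \<open>3 * v\<close>, which covers the support of \<open>g\<close>
  because \<open>v > 1/2\<close>.\<close>

lemma sum_column_integral:
  fixes g :: "real \<Rightarrow> real" and v :: real
  assumes cont: "continuous_on UNIV g" and zero: "\<And>r. \<bar>r\<bar> \<ge> 1 \<Longrightarrow> g r = 0" and v: "1/2 < v" "v \<le> 1"
  shows "integral {0..1} (\<lambda>t. \<Sum>j\<in>{-2..3::int}. g ((of_int j - t) * v)) = integral {-1..1} g / v"
proof -
  have cg: "continuous_on A g" for A using cont by (rule continuous_on_subset) simp
  \<comment> \<open>All arguments \<open>(j - t) * v\<close> lie between -3 and 3, so bounds -4 and
    4 keep them interior and \<open>P\<close> differentiable there.\<close>
  define P where "P x = integral {-4..x} g" for x
  have dP: "(P has_real_derivative g x) (at x)" if "-4 < x" "x < 4" for x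
  proof -
    have "(P has_real_derivative g x) (at x within {-4..4})"
      unfolding P_def using that by (intro integral_has_real_derivative cg) auto
    then show ?thesis using that at_within_Icc_at[of "-4" x 4] by simp
  qed
  have col: "((\<lambda>t. g ((of_int j - t) * v)) has_integral (P (of_int j * v) - P (of_int (j - 1) * v)) / v) {0..1}"
    if j: "j \<in> {-2..3::int}" for j
  proof -
    let ?F = "\<lambda>t. - P ((of_int j - t) * v) / v"
    have "((\<lambda>t. g ((of_int j - t) * v)) has_integral (?F 1 - ?F 0)) {0..1}"
    proof (rule fundamental_theorem_of_calculus)
      fix t :: real assume t: "t \<in> {0..1}"
      have j': "-2 \<le> real_of_int j" "real_of_int j \<le> 3" using j by auto
      have "\<bar>(of_int j - t) * v\<bar> \<le> 3 * 1" unfolding abs_mult using j' t v by (intro mult_mono) auto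
      then have "-4 < (of_int j - t) * v" "(of_int j - t) * v < 4" by linarith+
      note d = dP[OF this]
      have "((\<lambda>t. P ((of_int j - t) * v)) has_real_derivative g ((of_int j - t) * v) * (- v)) (at t)"
        by (rule DERIV_chain2[where f = P and g = "\<lambda>t. (of_int j - t) * v", OF d]) (auto intro!: derivative_eq_intros)
      then have "(?F has_real_derivative g ((of_int j - t) * v)) (at t)"
        using v by (auto intro!: derivative_eq_intros)
      then show "(?F has_vector_derivative g ((of_int j - t) * v)) (at t within {0..1})"
        by (simp add: has_real_derivative_iff_has_vector_derivative has_vector_derivative_at_within)
    qed simp
    moreover have "?F 1 - ?F 0 = (P (of_int j * v) - P (of_int (j - 1) * v)) / v"
      using v by (simp add: diff_divide_distrib)
    ultimately show ?thesis by simp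
  qed
  have "((\<lambda>t. \<Sum>j\<in>{-2..3::int}. g ((of_int j - t) * v)) has_integral
      (\<Sum>j\<in>{-2..3::int}. (P (of_int j * v) - P (of_int (j - 1) * v)) / v)) {0..1}"
    by (intro has_integral_sum col) auto
  moreover have "(\<Sum>j\<in>{-2..3::int}. (P (of_int j * v) - P (of_int (j - 1) * v)) / v) = (P (3 * v) - P (- 3 * v)) / v"
  proof -
    have "{-2..3::int} = {-2, -1, 0, 1, 2, 3}" by auto
    then show ?thesis by (simp add: diff_divide_distrib)
  qed
  moreover have "P (3 * v) - P (- 3 * v) = integral {-1..1} g"
  proof -
    have i: "g integrable_on {x..y}" for x y by (rule integrable_continuous_real[OF cg])
    have z: "integral {x..y} g = 0" if "y \<le> -1 \<or> x \<ge> 1" for x y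
    proof -
      have "integral {x..y} g = integral {x..y} (\<lambda>_. 0)"
        using that by (intro integral_cong zero) auto
      then show ?thesis by simp
    qed
    have "P (3 * v) = P (- 3 * v) + integral {- 3 * v..3 * v} g"
      unfolding P_def using v by (intro Henstock_Kurzweil_Integration.integral_combine[symmetric] i) auto
    moreover have "integral {- 3 * v..3 * v} g = integral {- 3 * v..- 1} g + integral {-1..3 * v} g"
      using v by (intro Henstock_Kurzweil_Integration.integral_combine[symmetric] i) auto
    moreover have "integral {-1..3 * v} g = integral {- 1..1} g + integral {1..3 * v} g"
      using v by (intro Henstock_Kurzweil_Integration.integral_combine[symmetric] i) auto
    ultimately show ?thesis using z by simp
  qed
  ultimately show ?thesis by (simp add: integral_unique)
qed

lemma column_sums_tendsto:
  fixes g :: "real \<Rightarrow> real \<Rightarrow> real"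
  assumes cont: "continuous_on ({- half_diag..half_diag} \<times> UNIV) (\<lambda>(u, r). g u r)"
    and zero: "\<And>u r. \<bar>r\<bar> \<ge> 1 \<Longrightarrow> g u r = 0"
  shows "((\<lambda>R. (\<Sum>m\<in>{\<lceil>- half_diag * R\<rceil>..\<lfloor>half_diag * R\<rfloor>}. \<Sum>j\<in>{-2..3::int}.
        g (of_int m / R) ((of_int j - frac (R * circ (of_int m / R))) * circ (of_int m / R))) / R)
    \<longlongrightarrow> integral {- half_diag..half_diag} (\<lambda>u. integral {-1..1} (g u) / circ u)) at_top"
proof -
  define Q where "Q u t = (\<Sum>j\<in>{-2..3::int}. g u ((of_int j - t) * circ u))" for u t
  have "continuous_on ({- half_diag..half_diag} \<times> {0..1}) (\<lambda>p. g (fst p) ((of_int j - snd p) * circ (fst p)))" for j :: int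
  proof -
    let ?f = "\<lambda>p::real \<times> real. (fst p, (of_int j - snd p) * circ (fst p))"
    have "continuous_on ({- half_diag..half_diag} \<times> {0..1}) ?f"
      by (intro continuous_intros)
    moreover have "?f ` ({- half_diag..half_diag} \<times> {0..1}) \<subseteq> {- half_diag..half_diag} \<times> UNIV" by auto
    ultimately have "continuous_on ({- half_diag..half_diag} \<times> {0..1}) (\<lambda>p. case ?f p of (u, r) \<Rightarrow> g u r)"
      by (rule continuous_on_compose2[OF cont])
    then show ?thesis by simp
  qed
  then have "continuous_on ({- half_diag..half_diag} \<times> {0..1}) (\<lambda>(u, t). Q u t)"
    unfolding Q_def split_beta by (intro continuous_on_sum)
  moreover have "Q u 0 = Q u 1" if "u \<in> {- half_diag..half_diag}" for u
  proof -
    have "1/2 < circ u" using circ_facts(4)[of u] that by auto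
    \<comment> \<open>Passing from \<open>t = 0\<close> to \<open>t = 1\<close> shifts
      \<open>j\<close> by one, so the two sums differ only in the terms at \<open>3 * circ u\<close>
      and \<open>- 3 * circ u\<close>, both outside the support. This gives the periodicity required
      of a test function.\<close>
    then have "g u (3 * circ u) = 0" "g u (- (3 * circ u)) = 0" by (intro zero; simp)+
    moreover have "{-2..3::int} = {-2, -1, 0, 1, 2, 3}" by auto
    ultimately show ?thesis by (simp add: Q_def)
  qed
  ultimately have "((\<lambda>R. (\<Sum>m\<in>{\<lceil>- half_diag * R\<rceil>..\<lfloor>half_diag * R\<rfloor>}. Q (of_int m / R) (frac (R * circ (of_int m / R)))) / R)
    \<longlongrightarrow> integral {- half_diag..half_diag} (\<lambda>u. integral {0..1} (Q u))) at_top"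
    by (rule circ.equidistributed)
  moreover have "integral {- half_diag..half_diag} (\<lambda>u. integral {0..1} (Q u))
      = integral {- half_diag..half_diag} (\<lambda>u. integral {-1..1} (g u) / circ u)"
  proof (rule integral_cong)
    fix u assume u: "u \<in> {- half_diag..half_diag}"
    show "integral {0..1} (Q u) = integral {-1..1} (g u) / circ u"
      unfolding Q_def using circ_facts[of u] u
      by (intro sum_column_integral zero continuous_on_section[OF cont]) auto
  qed
  ultimately show ?thesis unfolding Q_def by simp
qed

definition quarter :: "real \<Rightarrow> (real \<times> real) set" where
  "quarter R = {l \<in> boundary_lattice R. \<bar>fst l\<bar> \<le> half_diag * R \<and> snd l > 0}"

text \<open>Rows are counted from the height of the circle over \<open>m\<close>, so that the
  vertical offset from the circle is \<open>j\<close> minus the fractional part that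
  equidistributes.\<close>

definition column_point :: "real \<Rightarrow> int \<Rightarrow> int \<Rightarrow> real \<times> real" where
  "column_point R m j = (of_int m, of_int (\<lfloor>R * circ (of_int m / R)\<rfloor> + j))"

lemma boundary_lattice_iff:
  "l \<in> boundary_lattice R \<longleftrightarrow> fst l \<in> \<int> \<and> snd l \<in> \<int> \<and> R - half_diag < norm l \<and> norm l < R + half_diag"
  by (simp only: boundary_lattice_def half_diag_def mem_Times_iff Int_iff mem_Collect_eq conj_assoc)

lemma scaled_interval_iff:
  fixes m :: int
  assumes "R > 0"
  shows "m \<in> {\<lceil>- half_diag * R\<rceil>..\<lfloor>half_diag * R\<rfloor>} \<longleftrightarrow> \<bar>of_int m / R\<bar> \<le> half_diag"
proof -
  have "\<bar>of_int m / R\<bar> \<le> half_diag \<longleftrightarrow> \<bar>real_of_int m\<bar> \<le> half_diag * R"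
    using assms by (simp only: abs_divide abs_of_pos pos_divide_le_eq)
  then show ?thesis unfolding atLeastAtMost_iff ceiling_le_iff le_floor_iff by linarith
qed

text \<open>Why six rows suffice: in the annulus the squares of \<open>n\<close> and of the circle
  height \<open>f\<close> differ by at most \<open>2 * (half_diag * R) + 1/2\<close>, while
  \<open>n + f\<close> exceeds \<open>half_diag * R\<close>; hence \<open>n\<close> is less than 3
  away from \<open>f\<close>. Measured from the floor of \<open>f\<close> this leaves exactly -2 to
  3.\<close>

lemma quarter_eq_image:
  assumes R: "R \<ge> 10"
  shows "quarter R = (\<lambda>(m, j). column_point R m j) `
    {(m, j) \<in> {\<lceil>- half_diag * R\<rceil>..\<lfloor>half_diag * R\<rfloor>} \<times> {-2..3}. column_point R m j \<in> boundary_lattice R}"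
    (is "_ = _ ` ?X")
proof
  have R0: "R > 0" using R by simp
  have f_ge: "half_diag * R \<le> R * circ (of_int m / R)" if "\<bar>of_int m / R\<bar> \<le> half_diag" for m :: int
    using mult_left_mono[OF circ_facts(2)[OF that], of R] R0 by (simp add: mult.commute[of half_diag])
  show "(\<lambda>(m, j). column_point R m j) ` ?X \<subseteq> quarter R"
  proof
    fix l assume "l \<in> (\<lambda>(m, j). column_point R m j) ` ?X"
    then obtain m j where l: "l = column_point R m j"
      and mj: "m \<in> {\<lceil>- half_diag * R\<rceil>..\<lfloor>half_diag * R\<rfloor>}" "j \<in> {-2..3::int}" "column_point R m j \<in> boundary_lattice R"
      by (elim imageE) (auto simp del: atLeastAtMost_iff)
    have m: "\<bar>of_int m / R\<bar> \<le> half_diag" using scaled_interval_iff[OF R0] mj(1) by blast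
    have "half_diag * R \<ge> 7/10 * 10" using half_diag_bounds R by (intro mult_mono) auto
    then have "R * circ (of_int m / R) \<ge> 7" using f_ge[OF m] by simp
    then have "real_of_int (\<lfloor>R * circ (of_int m / R)\<rfloor> + j) > 0" using mj(2) by simp linarith
    moreover have "\<bar>real_of_int m\<bar> \<le> half_diag * R" using m R0 by (simp add: field_simps)
    ultimately show "l \<in> quarter R"
      unfolding l using mj(3) by (simp add: quarter_def column_point_def)
  qed
  show "quarter R \<subseteq> (\<lambda>(m, j). column_point R m j) ` ?X"
  proof
    fix l assume l: "l \<in> quarter R"
    then obtain m n :: int where mn: "l = (of_int m, of_int n)"
      by (cases l) (auto simp: quarter_def boundary_lattice_iff elim!: Ints_cases)
    have ub: "\<bar>of_int m\<bar> \<le> half_diag * R" "n > 0" and nb: "R - half_diag < norm l" "norm l < R + half_diag"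
      using l mn by (auto simp: quarter_def boundary_lattice_iff)
    have m: "\<bar>of_int m / R\<bar> \<le> half_diag" using ub R0 by (simp add: field_simps)
    define f where "f = R * circ (of_int m / R)"
    have f: "half_diag * R \<le> f" using f_ge[OF m] by (simp add: f_def)
    have f2: "f\<^sup>2 = R\<^sup>2 - (of_int m)\<^sup>2"
    proof -
      have "(circ (of_int m / R))\<^sup>2 = 1 - (of_int m / R)\<^sup>2" using circ_facts(1)[OF m] by simp
      then show ?thesis using R0 by (simp add: f_def power_mult_distrib power_divide right_diff_distrib)
    qed
    have n2: "(norm l)\<^sup>2 = (of_int m)\<^sup>2 + (of_int n)\<^sup>2" by (simp add: mn norm_Pair)
    have lo: "(R - half_diag)\<^sup>2 < (norm l)\<^sup>2"
      using nb(1) half_diag_bounds R by (intro power_strict_mono) auto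
    have hi: "(norm l)\<^sup>2 < (R + half_diag)\<^sup>2"
      using nb(2) by (intro power_strict_mono) auto
    have hR: "half_diag * R \<ge> 7/10 * 10" using half_diag_bounds R by (intro mult_mono) auto
    have d: "\<bar>(of_int n)\<^sup>2 - f\<^sup>2\<bar> \<le> 2 * (half_diag * R) + 1/2"
      using lo hi hR half_diag_sq unfolding n2 f2 power2_sum power2_diff by (auto simp: algebra_simps abs_le_iff)
    have "\<bar>of_int n - f\<bar> < 3"
    proof (rule ccontr)
      assume "\<not> \<bar>of_int n - f\<bar> < 3"
      moreover have "of_int n + f > half_diag * R" using ub(2) f by simp
      ultimately have "3 * (half_diag * R) \<le> \<bar>of_int n - f\<bar> * (of_int n + f)"
        using hR by (intro mult_mono) auto
      also have "\<dots> = \<bar>(of_int n)\<^sup>2 - f\<^sup>2\<bar>"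
      proof -
        have "of_int n + f \<ge> 0" using ub(2) f hR by simp
        then have "\<bar>of_int n - f\<bar> * (of_int n + f) = \<bar>(of_int n - f) * (of_int n + f)\<bar>" by (simp add: abs_mult)
        also have "(of_int n - f) * (of_int n + f) = (of_int n)\<^sup>2 - f\<^sup>2" by (simp add: power2_eq_square algebra_simps)
        finally show ?thesis .
      qed
      finally show False using d hR by linarith
    qed
    then have "n - \<lfloor>f\<rfloor> \<in> {-2..3}" by simp linarith
    moreover have "column_point R m (n - \<lfloor>f\<rfloor>) = l" by (simp add: column_point_def f_def mn)
    moreover have "m \<in> {\<lceil>- half_diag * R\<rceil>..\<lfloor>half_diag * R\<rfloor>}" using scaled_interval_iff[OF R0] m by blast
    ultimately have "(m, n - \<lfloor>f\<rfloor>) \<in> ?X" "l = (\<lambda>(m, j). column_point R m j) (m, n - \<lfloor>f\<rfloor>)"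
      using l by (auto simp: quarter_def)
    then show "l \<in> (\<lambda>(m, j). column_point R m j) ` ?X" by blast
  qed
qed

lemma sum_quarter:
  fixes f :: "real \<times> real \<Rightarrow> real"
  assumes R: "R \<ge> 10"
  shows "(\<Sum>l\<in>quarter R. f l) = (\<Sum>m\<in>{\<lceil>- half_diag * R\<rceil>..\<lfloor>half_diag * R\<rfloor>}. \<Sum>j\<in>{-2..3}.
     if column_point R m j \<in> boundary_lattice R then f (column_point R m j) else 0)"
proof -
  let ?N = "{\<lceil>- half_diag * R\<rceil>..\<lfloor>half_diag * R\<rfloor>}"
  let ?p = "\<lambda>(m, j). column_point R m j"
  let ?X = "{(m, j) \<in> ?N \<times> {-2..3}. column_point R m j \<in> boundary_lattice R}"
  have "inj_on ?p ?X" by (auto simp: inj_on_def column_point_def)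
  then have "(\<Sum>l\<in>quarter R. f l) = (\<Sum>x\<in>?X. f (?p x))"
    unfolding quarter_eq_image[OF R] by (simp add: sum.reindex)
  also have "\<dots> = (\<Sum>x\<in>{x \<in> ?N \<times> {-2..3}. ?p x \<in> boundary_lattice R}. f (?p x))"
    by (rule sum.cong) auto
  also have "\<dots> = (\<Sum>x\<in>?N \<times> {-2..3}. if ?p x \<in> boundary_lattice R then f (?p x) else 0)"
    by (rule sum.inter_filter) simp
  also have "\<dots> = (\<Sum>m\<in>?N. \<Sum>j\<in>{-2..3}. if column_point R m j \<in> boundary_lattice R then f (column_point R m j) else 0)"
    unfolding sum.cartesian_product by (rule sum.cong) auto
  finally show ?thesis .
qed

section \<open>The limit over a quarter of the annulus\<close>

text \<open>A continuous replacement from below for the indicator of the annulus in the variable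
  \<open>r\<close>. The companion \<open>edge_bump\<close> is 1 within \<open>e\<close> of the two
  edges and 0 beyond \<open>2 * e\<close>, and bounds the error of this replacement.\<close>

definition cutoff :: "real \<Rightarrow> real \<Rightarrow> real" where
  "cutoff e r = max 0 (min 1 ((half_diag - \<bar>r\<bar>) / e))"

definition edge_bump :: "real \<Rightarrow> real \<Rightarrow> real" where
  "edge_bump e r = max 0 (min 1 (2 - \<bar>\<bar>r\<bar> - half_diag\<bar> / e))"

lemma cutoff_bounds: "0 \<le> cutoff e r" "cutoff e r \<le> 1"
  by (auto simp: cutoff_def)

lemma edge_bump_bounds: "0 \<le> edge_bump e r" "edge_bump e r \<le> 1"
  by (auto simp: edge_bump_def)

lemma continuous_on_cutoff [continuous_intros]:
  "e \<noteq> 0 \<Longrightarrow> continuous_on A f \<Longrightarrow> continuous_on A (\<lambda>x. cutoff e (f x))"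
  unfolding cutoff_def by (intro continuous_intros) auto

lemma continuous_on_edge_bump [continuous_intros]:
  "e \<noteq> 0 \<Longrightarrow> continuous_on A f \<Longrightarrow> continuous_on A (\<lambda>x. edge_bump e (f x))"
  unfolding edge_bump_def by (intro continuous_intros) auto

lemma cutoff_eq_0: "0 < e \<Longrightarrow> half_diag \<le> \<bar>r\<bar> \<Longrightarrow> cutoff e r = 0"
  using divide_nonpos_pos[of "half_diag - \<bar>r\<bar>" e] by (simp add: cutoff_def)

lemma edge_bump_eq_0:
  assumes "0 < e" "2 * e \<le> \<bar>\<bar>r\<bar> - half_diag\<bar>"
  shows "edge_bump e r = 0"
proof -
  have "2 \<le> \<bar>\<bar>r\<bar> - half_diag\<bar> / e" using assms by (simp add: pos_le_divide_eq)
  then show ?thesis by (simp add: edge_bump_def)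
qed

text \<open>\<open>P\<close> stands for membership in the annulus, which the estimate of the norm
  decides only when \<open>r\<close> is more than \<open>e\<close> away from an edge. Closer than
  that the bump equals 1 and covers any discrepancy.\<close>

lemma cutoff_diff_le_edge_bump:
  assumes "0 < e" and P: "\<bar>\<bar>r\<bar> - half_diag\<bar> > e \<Longrightarrow> P \<longleftrightarrow> \<bar>r\<bar> < half_diag"
  shows "\<bar>of_bool P - cutoff e r\<bar> \<le> edge_bump e r"
proof (cases "\<bar>\<bar>r\<bar> - half_diag\<bar> > e")
  case True
  show ?thesis
  proof (cases "\<bar>r\<bar> < half_diag")
    case in_r: True
    then have "e \<le> half_diag - \<bar>r\<bar>" using True by linarith
    then have "1 \<le> (half_diag - \<bar>r\<bar>) / e" using assms(1) by (simp add: pos_le_divide_eq)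
    then have "cutoff e r = 1" by (simp add: cutoff_def)
    then show ?thesis using P[OF True] in_r by (simp add: edge_bump_bounds)
  next
    case False
    then show ?thesis using P[OF True] cutoff_eq_0[OF assms(1)] by (simp add: edge_bump_bounds)
  qed
next
  case False
  then have "\<bar>\<bar>r\<bar> - half_diag\<bar> / e \<le> 1" using assms(1) by (simp add: pos_divide_le_eq)
  then have "edge_bump e r = 1" by (simp add: edge_bump_def)
  then show ?thesis using cutoff_bounds[of e r] by (cases P) auto
qed

text \<open>The bump is supported on two intervals of length \<open>4 * e\<close> around the edges,
  which lie inside the range since \<open>half_diag < 3/4\<close> and \<open>2 * e\<close> is at
  most 1/5.\<close>

lemma integral_edge_bump_le:
  assumes "0 < e" "e \<le> 1/10"
  shows "integral {-1..1} (edge_bump e) \<le> 8 * e"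
proof -
  define I J where "I = {half_diag - 2 * e..half_diag + 2 * e}" and "J = {- half_diag - 2 * e..- half_diag + 2 * e}"
  have sub: "I \<subseteq> {-1..1}" "J \<subseteq> {-1..1}" using half_diag_bounds assms by (auto simp: I_def J_def)
  have "((\<lambda>x. 1::real) has_integral 4 * e) I" "((\<lambda>x. 1::real) has_integral 4 * e) J"
    using has_integral_const_real[of "1::real" "half_diag - 2 * e" "half_diag + 2 * e"]
      has_integral_const_real[of "1::real" "- half_diag - 2 * e" "- half_diag + 2 * e"] assms
    by (simp_all add: I_def J_def)
  then have "((\<lambda>x. if x \<in> I then 1 else 0 :: real) has_integral 4 * e) {-1..1}"
      "((\<lambda>x. if x \<in> J then 1 else 0 :: real) has_integral 4 * e) {-1..1}"
    by (simp_all only: has_integral_restrict[OF sub(1)] has_integral_restrict[OF sub(2)])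
  from has_integral_add[OF this]
  have hi: "((\<lambda>x. (if x \<in> I then 1 else 0) + (if x \<in> J then 1 else 0) :: real) has_integral 8 * e) {-1..1}" by simp
  have "(edge_bump e has_integral integral {-1..1} (edge_bump e)) {-1..1}"
    using assms by (intro integrable_integral integrable_continuous_real continuous_on_edge_bump continuous_on_id) auto
  moreover have "edge_bump e x \<le> (if x \<in> I then 1 else 0) + (if x \<in> J then 1 else 0)" for x
  proof (cases "x \<in> I \<or> x \<in> J")
    case True
    then show ?thesis using edge_bump_bounds[of e x] by auto
  next
    case False
    then have "2 * e \<le> \<bar>\<bar>x\<bar> - half_diag\<bar>" using assms by (auto simp: I_def J_def)
    then show ?thesis using edge_bump_eq_0[OF assms(1)] by simp
  qed
  ultimately show ?thesis using hi by (meson has_integral_le)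
qed

lemma column_point_eq:
  assumes "R > 0"
  shows "column_point R m j = (R * (of_int m / R),
    R * circ (of_int m / R) + (of_int j - frac (R * circ (of_int m / R))))"
  using assms by (simp add: column_point_def frac_def)

lemma column_term_estimate:
  fixes h :: "real \<Rightarrow> real"
  assumes R: "R \<ge> 10" and e: "0 < e" "25 / R < e"
    and h1: "\<And>x. x \<in> {0..1} \<Longrightarrow> \<bar>h x\<bar> \<le> 1"
    and hu: "\<And>x y. x \<in> {0..1} \<Longrightarrow> y \<in> {0..1} \<Longrightarrow> \<bar>x - y\<bar> \<le> 100 / R \<Longrightarrow> \<bar>h x - h y\<bar> \<le> e"
    and m: "\<bar>of_int m / R\<bar> \<le> half_diag" and j: "j \<in> {-2..3}"
    and u: "u = of_int m / R" and r: "r = (of_int j - frac (R * circ u)) * circ u"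
  shows "\<bar>(if column_point R m j \<in> boundary_lattice R then h (area_disc R (column_point R m j)) else 0)
      - cutoff e r * h (sq_cut r u (circ u))\<bar> \<le> e + edge_bump e r"
proof -
  define v where "v = circ u"
  define t where "t = of_int j - frac (R * v)"
  have R0: "R > 0" using R by simp
  have v: "u\<^sup>2 + v\<^sup>2 = 1" "1/2 \<le> v" using circ_facts[of u] m by (auto simp: u v_def)
  have "-2 \<le> real_of_int j" "real_of_int j \<le> 3" using j by auto
  then have t: "\<bar>t\<bar> \<le> 3" using frac_ge_0[of "R * v"] frac_lt_1[of "R * v"] unfolding t_def by linarith
  have r': "r = t * v" by (simp add: r t_def v_def)
  define l where "l = column_point R m j"
  have l: "l = (R * u, R * v + t)" unfolding l_def column_point_eq[OF R0] by (simp add: u v_def t_def)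
  have est: "\<bar>norm l - R - r\<bar> \<le> 25 / R" "\<bar>area_disc R l - sq_cut r u v\<bar> \<le> 100 / R"
    unfolding l r' using near_circle_estimates[OF v t R] by auto
  define A where "A = h (area_disc R l)"
  define C where "C = h (sq_cut r u v)"
  have AC: "\<bar>A - C\<bar> \<le> e" "\<bar>C\<bar> \<le> 1"
    unfolding A_def C_def using area_disc_bounds[of R l] sq_cut_bounds[of r u v] est(2) by (auto intro!: hu h1)
  define P where "P \<longleftrightarrow> l \<in> boundary_lattice R"
  have "P \<longleftrightarrow> R - half_diag < norm l \<and> norm l < R + half_diag"
    unfolding P_def boundary_lattice_iff by (auto simp: l_def column_point_def)
  then have "P \<longleftrightarrow> \<bar>r\<bar> < half_diag" if "\<bar>\<bar>r\<bar> - half_diag\<bar> > e"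
    using that est(1) e half_diag_bounds by linarith
  then have *: "\<bar>of_bool P - cutoff e r\<bar> \<le> edge_bump e r"
    by (rule cutoff_diff_le_edge_bump[OF e(1)])
  \<comment> \<open>The first summand is the error in the area, controlled by the modulus of
    continuity of \<open>h\<close>; the second is the error in the membership, controlled by the
    bump.\<close>
  have "(if P then A else 0) - cutoff e r * C = of_bool P * (A - C) + (of_bool P - cutoff e r) * C"
    by (simp add: algebra_simps)
  also have "\<bar>\<dots>\<bar> \<le> \<bar>of_bool P * (A - C)\<bar> + \<bar>(of_bool P - cutoff e r) * C\<bar>" by (rule abs_triangle_ineq)
  also have "\<bar>of_bool P * (A - C)\<bar> \<le> e" using AC e by (simp add: abs_mult)
  also have "\<bar>(of_bool P - cutoff e r) * C\<bar> \<le> edge_bump e r"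
    unfolding abs_mult using mult_mono[OF * AC(2)] edge_bump_bounds by simp
  finally have "\<bar>(if P then A else 0) - cutoff e r * C\<bar> \<le> e + edge_bump e r" by simp
  then show ?thesis unfolding P_def A_def C_def l_def v_def .
qed

text \<open>With u = sin \<theta> the weight \<open>1 / circ u\<close> turns du into d\<theta>: this
  is the integral of \<open>h\<close> of the cut area over r and over a range of angles of length
  pi/2.\<close>

definition quarter_limit :: "(real \<Rightarrow> real) \<Rightarrow> real" where
  "quarter_limit h = integral {- half_diag..half_diag}
     (\<lambda>u. integral {- half_diag..half_diag} (\<lambda>r. h (sq_cut r u (circ u))) / circ u)"

lemma continuous_on_profile:
  fixes h :: "real \<Rightarrow> real"
  assumes "continuous_on {0..1} h"
  shows "continuous_on ({- half_diag..half_diag} \<times> A) (\<lambda>(u, r). h (sq_cut r u (circ u)))"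
proof -
  have "continuous_on ({- half_diag..half_diag} \<times> A) (\<lambda>p. sq_cut (snd p) (fst p) (circ (fst p)))"
  proof (intro continuous_on_sq_cut continuous_intros)
    fix p assume "p \<in> {- half_diag..half_diag} \<times> A"
    then have "\<bar>fst p\<bar> \<le> half_diag" by auto
    from circ_facts(4)[OF this] show "0 < circ (fst p)" by simp
  qed
  then show ?thesis
    unfolding split_beta by (rule continuous_on_compose2[OF assms]) (auto simp: sq_cut_bounds)
qed

text \<open>The weight \<open>1 / circ u\<close> is below 2 and the interval is shorter than 2,
  whence the factor 4.\<close>

lemma abs_integral_div_circ_le:
  fixes F :: "real \<Rightarrow> real"
  assumes "continuous_on {- half_diag..half_diag} F" "\<And>u. u \<in> {- half_diag..half_diag} \<Longrightarrow> \<bar>F u\<bar> \<le> c"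
  shows "\<bar>integral {- half_diag..half_diag} (\<lambda>u. F u / circ u)\<bar> \<le> 4 * c"
proof -
  have circ: "1/2 < circ u" if "u \<in> {- half_diag..half_diag}" for u using circ_facts(4)[of u] that by (auto simp: abs_le_iff)
  have c0: "0 \<le> c" using assms(2)[of 0] half_diag_bounds by auto
  have "norm (integral {- half_diag..half_diag} (\<lambda>u. F u / circ u)) \<le> 2 * c * (half_diag - - half_diag)"
  proof (rule integral_bound)
    show "continuous_on {- half_diag..half_diag} (\<lambda>u. F u / circ u)"
      using circ by (intro continuous_intros assms) force
    fix u assume u: "u \<in> {- half_diag..half_diag}"
    have "\<bar>F u\<bar> \<le> c * (2 * circ u)"
      using assms(2)[OF u] circ[OF u] c0 mult_left_mono[of 1 "2 * circ u" c] by linarith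
    then show "norm (F u / circ u) \<le> 2 * c"
      using circ[OF u] by (simp add: pos_divide_le_eq mult_ac)
  qed (use half_diag_bounds in simp)
  also have "\<dots> \<le> 2 * c * 2" using half_diag_bounds c0 by (intro mult_left_mono) auto
  finally show ?thesis by simp
qed

lemma quarter_sum_tendsto:
  fixes h :: "real \<Rightarrow> real"
  assumes conth: "continuous_on {0..1} h" and h1: "\<And>x. x \<in> {0..1} \<Longrightarrow> \<bar>h x\<bar> \<le> 1"
  shows "((\<lambda>R. (\<Sum>l\<in>quarter R. h (area_disc R l)) / R) \<longlongrightarrow> quarter_limit h) at_top"
  unfolding tendsto_iff
proof (intro allI impI)
  fix \<epsilon> :: real assume "\<epsilon> > 0"
  \<comment> \<open>Total error: \<open>18 * e\<close> from the areas, \<open>33 * e\<close> from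
    the bump sum, \<open>e\<close> from the limit of the smoothed sum and \<open>32 * e\<close> from
    smoothing the integral, together \<open>84 * e\<close>. The bound 1/10 keeps the bumps inside
    the interval from -1 to 1.\<close>
  define e where "e = min (1/10) (\<epsilon> / 100)"
  have e: "0 < e" "e \<le> 1/10" "100 * e \<le> \<epsilon>" using \<open>\<epsilon> > 0\<close> by (auto simp: e_def)
  define p where "p u r = h (sq_cut r u (circ u))" for u r
  have contp: "continuous_on ({- half_diag..half_diag} \<times> A) (\<lambda>(u, r). p u r)" for A
    unfolding p_def by (rule continuous_on_profile[OF conth])
  have p1: "\<bar>p u r\<bar> \<le> 1" for u r unfolding p_def by (intro h1) (auto simp: sq_cut_bounds)
  define g where "g u r = cutoff e r * p u r" for u r
  define k where "k u r = edge_bump e r" for u r :: real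
  have contg: "continuous_on ({- half_diag..half_diag} \<times> A) (\<lambda>(u, r). g u r)" for A
    unfolding g_def split_beta using contp[of A] e(1)
    by (intro continuous_on_mult continuous_on_cutoff continuous_on_snd continuous_on_id) (auto simp: split_beta)
  have contk: "continuous_on ({- half_diag..half_diag} \<times> A) (\<lambda>(u, r). k u r)" for A
    unfolding k_def split_beta using e(1)
    by (intro continuous_on_edge_bump continuous_on_snd continuous_on_id) auto
  define Sg where "Sg R = (\<Sum>m\<in>{\<lceil>- half_diag * R\<rceil>..\<lfloor>half_diag * R\<rfloor>}. \<Sum>j\<in>{-2..3::int}.
        g (of_int m / R) ((of_int j - frac (R * circ (of_int m / R))) * circ (of_int m / R)))" for R
  define Sk where "Sk R = (\<Sum>m\<in>{\<lceil>- half_diag * R\<rceil>..\<lfloor>half_diag * R\<rfloor>}. \<Sum>j\<in>{-2..3::int}.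
        k (of_int m / R) ((of_int j - frac (R * circ (of_int m / R))) * circ (of_int m / R)))" for R
  define Lg where "Lg = integral {- half_diag..half_diag} (\<lambda>u. integral {-1..1} (g u) / circ u)"
  define Lk where "Lk = integral {- half_diag..half_diag} (\<lambda>u. integral {-1..1} (k u) / circ u)"
  have limg: "((\<lambda>R. Sg R / R) \<longlongrightarrow> Lg) at_top"
    unfolding Sg_def Lg_def
  proof (rule column_sums_tendsto[OF contg])
    show "g u r = 0" if "\<bar>r\<bar> \<ge> 1" for u r
      using cutoff_eq_0[OF e(1), of r] half_diag_bounds that by (simp add: g_def)
  qed
  have limk: "((\<lambda>R. Sk R / R) \<longlongrightarrow> Lk) at_top"
    unfolding Sk_def Lk_def
  proof (rule column_sums_tendsto[OF contk])
    show "k u r = 0" if "\<bar>r\<bar> \<ge> 1" for u r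
      using edge_bump_eq_0[OF e(1), of r] half_diag_bounds that e(2) by (simp add: k_def)
  qed
  have kint: "k u integrable_on {x..y}" for u x y
    unfolding k_def using e(1) by (intro integrable_continuous_real continuous_on_edge_bump continuous_on_id) auto
  have k_le: "0 \<le> integral {-1..1} (k u)" "integral {-1..1} (k u) \<le> 8 * e" for u
  proof -
    show "0 \<le> integral {-1..1} (k u)" using kint by (intro integral_nonneg) (auto simp: k_def edge_bump_bounds)
    show "integral {-1..1} (k u) \<le> 8 * e" unfolding k_def by (rule integral_edge_bump_le[OF e(1,2)])
  qed
  have Lk: "Lk \<le> 32 * e"
  proof -
    have "\<bar>Lk\<bar> \<le> 4 * (8 * e)"
      unfolding Lk_def using k_le by (intro abs_integral_div_circ_le continuous_on_inner_integral contk) (auto simp: abs_le_iff intro: order_trans)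
    then show ?thesis by simp
  qed
  have Lg: "\<bar>quarter_limit h - Lg\<bar> \<le> 32 * e"
  proof -
    let ?D = "{- half_diag..half_diag}"
    let ?P = "\<lambda>u. integral ?D (p u)" and ?G = "\<lambda>u. integral {-1..1} (g u)"
    have contP: "continuous_on ?D ?P" and contG: "continuous_on ?D ?G"
      by (intro continuous_on_inner_integral contp contg)+
    have circ: "circ u \<noteq> 0" if "u \<in> ?D" for u using circ_facts(4)[of u] that by (auto simp: abs_le_iff)
    have "quarter_limit h - Lg = integral ?D (\<lambda>u. ?P u / circ u - ?G u / circ u)"
      unfolding quarter_limit_def Lg_def p_def[symmetric]
      by (intro integral_diff[symmetric] integrable_continuous_real continuous_on_divide contP contG
          continuous_on_circ continuous_on_id) (auto simp: circ)
    also have "\<dots> = integral ?D (\<lambda>u. (?P u - ?G u) / circ u)" by (simp add: diff_divide_distrib)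
    also have "\<bar>\<dots>\<bar> \<le> 4 * (8 * e)"
    proof (rule abs_integral_div_circ_le)
      show "continuous_on ?D (\<lambda>u. ?P u - ?G u)" by (intro continuous_intros contP contG)
      fix u assume u: "u \<in> ?D"
      have pint: "p u integrable_on {x..y}" and gint: "g u integrable_on {x..y}" for x y
        by (intro integrable_continuous_real continuous_on_section[OF contp u] continuous_on_section[OF contg u])+
      have "?G u = integral ?D (g u)"
      proof -
        have z: "integral {x..y} (g u) = 0" if "y \<le> - half_diag \<or> x \<ge> half_diag" for x y
        proof -
          have "integral {x..y} (g u) = integral {x..y} (\<lambda>_. 0)"
            using that cutoff_eq_0[OF e(1)] by (intro integral_cong) (auto simp: g_def)
          then show ?thesis by simp
        qed
        have "integral {-1..- half_diag} (g u) + integral {- half_diag..1} (g u) = ?G u"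
          using half_diag_bounds gint by (intro Henstock_Kurzweil_Integration.integral_combine) auto
        moreover have "integral {- half_diag..half_diag} (g u) + integral {half_diag..1} (g u) = integral {- half_diag..1} (g u)"
          using half_diag_bounds gint by (intro Henstock_Kurzweil_Integration.integral_combine) auto
        ultimately show ?thesis using z by simp
      qed
      then have "?P u - ?G u = integral ?D (\<lambda>r. p u r - g u r)"
        using integral_diff[OF pint gint] by simp
      also have "\<bar>\<dots>\<bar> \<le> integral ?D (k u)"
        unfolding real_norm_def[symmetric]
      proof (rule integral_norm_bound_integral)
        fix r assume r: "r \<in> ?D"
        have "\<bar>of_bool True - cutoff e r\<bar> \<le> edge_bump e r"
        proof (rule cutoff_diff_le_edge_bump[OF e(1)])
          show "True \<longleftrightarrow> \<bar>r\<bar> < half_diag" if "\<bar>\<bar>r\<bar> - half_diag\<bar> > e" using r that e(1) by auto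
        qed
        then have "\<bar>1 - cutoff e r\<bar> * \<bar>p u r\<bar> \<le> edge_bump e r * 1"
          using p1 edge_bump_bounds by (intro mult_mono) auto
        moreover have "p u r - g u r = (1 - cutoff e r) * p u r" by (simp add: g_def algebra_simps)
        ultimately show "norm (p u r - g u r) \<le> k u r" by (simp add: k_def abs_mult)
      qed (intro integrable_diff pint gint kint)+
      also have "\<dots> \<le> integral {-1..1} (k u)"
        using half_diag_bounds kint by (intro integral_subset_le) (auto simp: k_def edge_bump_bounds)
      finally show "\<bar>?P u - ?G u\<bar> \<le> 8 * e" using k_le(2)[of u] by linarith
    qed
    finally show ?thesis by simp
  qed
  have "uniformly_continuous_on {0..1} h" by (rule compact_uniformly_continuous[OF conth]) simp
  then obtain d where d: "d > 0" "\<And>x y. x \<in> {0..1} \<Longrightarrow> y \<in> {0..1} \<Longrightarrow> dist y x < d \<Longrightarrow> dist (h y) (h x) < e"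
    unfolding uniformly_continuous_on_def using e(1) by metis
  have evg: "\<forall>\<^sub>F R in at_top. dist (Sg R / R) Lg < e" using tendstoD[OF limg e(1)] .
  have evk: "\<forall>\<^sub>F R in at_top. dist (Sk R / R) Lk < e" using tendstoD[OF limk e(1)] .
  show "\<forall>\<^sub>F R in at_top. dist ((\<Sum>l\<in>quarter R. h (area_disc R l)) / R) (quarter_limit h) < \<epsilon>"
    using evg evk eventually_ge_at_top[of 10] eventually_gt_at_top[of "25 / e"] eventually_gt_at_top[of "100 / d"]
  proof eventually_elim
    case (elim R)
    have R: "R \<ge> 10" "R > 0" "25 / R < e" "100 / R < d"
      using elim(3-5) e(1) d(1) by (auto simp: field_simps)
    let ?N = "{\<lceil>- half_diag * R\<rceil>..\<lfloor>half_diag * R\<rfloor>}"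
    define S where "S = (\<Sum>l\<in>quarter R. h (area_disc R l))"
    let ?D = "\<lambda>m j. if column_point R m j \<in> boundary_lattice R then h (area_disc R (column_point R m j)) else 0"
    let ?r = "\<lambda>m j. (of_int j - frac (R * circ (of_int m / R))) * circ (of_int m / R)"
    have S_eq: "S - Sg R = (\<Sum>m\<in>?N. \<Sum>j\<in>{-2..3}. ?D m j - g (of_int m / R) (?r m j))"
      unfolding S_def Sg_def sum_quarter[OF R(1)] by (simp only: sum_subtractf)
    have "\<bar>S - Sg R\<bar> \<le> (\<Sum>m\<in>?N. \<Sum>j\<in>{-2..3::int}. e + k (of_int m / R) (?r m j))"
      unfolding real_norm_def[symmetric] S_eq
    proof (intro sum_norm_le)
      fix m j assume m: "m \<in> ?N" and j: "j \<in> {-2..3::int}"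
      have mm: "\<bar>of_int m / R\<bar> \<le> half_diag" using m scaled_interval_iff[OF R(2)] by blast
      show "norm (?D m j - g (of_int m / R) (?r m j)) \<le> e + k (of_int m / R) (?r m j)"
        unfolding real_norm_def g_def p_def k_def
      proof (rule column_term_estimate[OF R(1) e(1) R(3) h1 _ mm j refl refl])
        fix x y :: real assume "x \<in> {0..1}" "y \<in> {0..1}" "\<bar>x - y\<bar> \<le> 100 / R"
        then show "\<bar>h x - h y\<bar> \<le> e" using d(2)[of y x] R(4) by (simp add: dist_real_def)
      qed
    qed
    also have "\<dots> = real (card ?N) * (6 * e) + Sk R"
    proof -
      have "card {-2..3::int} = 6" by simp
      then show ?thesis unfolding Sk_def by (simp only: sum.distrib sum_constant of_nat_numeral)
    qed
    \<comment> \<open>Six rows in each of at most \<open>(2 * half_diag + 1) * R\<close> columns;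
      the coefficient is below 3.\<close>
    also have "\<dots> \<le> (3 * R) * (6 * e) + Sk R"
    proof -
      have "real (card ?N) \<le> (half_diag - - half_diag + 1) * R"
        using card_scaled_interval_le[of "- half_diag" half_diag R] half_diag_bounds R by simp
      also have "\<dots> \<le> 3 * R" using half_diag_bounds R by (intro mult_right_mono) auto
      finally show ?thesis using e(1) by simp
    qed
    finally have "\<bar>S - Sg R\<bar> / R \<le> ((3 * R) * (6 * e) + Sk R) / R"
      using R by (intro divide_right_mono) auto
    also have "\<dots> = 18 * e + Sk R / R" using R by (simp add: field_simps)
    finally have "\<bar>S / R - Sg R / R\<bar> \<le> 18 * e + Sk R / R"
      using R(2) by (simp only: diff_divide_distrib[symmetric] abs_divide abs_of_pos)
    then show ?case
      using elim(1,2) Lg Lk e(1,3) unfolding dist_real_def S_def[symmetric] by linarith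
  qed
qed

section \<open>The limit over the whole annulus\<close>

lemma finite_boundary_lattice: "finite (boundary_lattice R)"
proof (rule finite_subset)
  let ?K = "\<lceil>R + 1\<rceil>"
  show "boundary_lattice R \<subseteq> (\<lambda>(m, n). (real_of_int m, real_of_int n)) ` ({-?K..?K} \<times> {-?K..?K})"
  proof
    fix l assume l: "l \<in> boundary_lattice R"
    then obtain m n :: int where mn: "l = (of_int m, of_int n)"
      by (cases l) (auto simp: boundary_lattice_iff elim!: Ints_cases)
    have "norm l < R + 1" using l half_diag_bounds by (simp add: boundary_lattice_iff)
    moreover have "\<bar>of_int m\<bar> \<le> norm l" "\<bar>of_int n\<bar> \<le> norm l"
      using norm_fst_le[of "of_int m :: real" "of_int n :: real"] norm_snd_le[of "of_int n :: real" "of_int m :: real"]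
      unfolding mn by simp_all
    ultimately have "m \<in> {-?K..?K}" "n \<in> {-?K..?K}" by auto linarith+
    then show "l \<in> (\<lambda>(m, n). (real_of_int m, real_of_int n)) ` ({-?K..?K} \<times> {-?K..?K})"
      unfolding mn by (intro image_eqI[of _ _ "(m, n)"]) auto
  qed
qed simp

text \<open>The rotation by a right angle. It preserves the lattice, the annulus, the square and the
  disc at once, so one quarter determines the whole sum.\<close>

definition turn :: "real \<times> real \<Rightarrow> real \<times> real" where "turn l = (- snd l, fst l)"

lemma inj_turn: "inj_on turn A"
  by (auto simp: inj_on_def turn_def prod_eq_iff)

lemma norm_turn: "norm (turn l) = norm l"
  by (cases l) (simp add: turn_def norm_Pair add.commute)

lemma turn_in_boundary_lattice: "turn l \<in> boundary_lattice R \<longleftrightarrow> l \<in> boundary_lattice R"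
  unfolding boundary_lattice_iff norm_turn by (auto simp: turn_def)

lemma area_disc_turn: "area_disc R (turn l) = area_disc R l"
  using area_disc_quarter_turn[of R "snd l" "fst l"] by (simp add: turn_def)

lemma card_near_abs:
  fixes c :: real
  shows "finite {x::int. \<bar>\<bar>of_int x\<bar> - c\<bar> \<le> 3}" "card {x::int. \<bar>\<bar>of_int x\<bar> - c\<bar> \<le> 3} \<le> 14"
proof -
  let ?I = "{\<lceil>c - 3\<rceil>..\<lfloor>c + 3\<rfloor>} \<union> {\<lceil>- c - 3\<rceil>..\<lfloor>- c + 3\<rfloor>}"
  have sub: "{x::int. \<bar>\<bar>of_int x\<bar> - c\<bar> \<le> 3} \<subseteq> ?I"
  proof
    fix x :: int assume "x \<in> {x. \<bar>\<bar>of_int x\<bar> - c\<bar> \<le> 3}"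
    then have "\<bar>\<bar>real_of_int x\<bar> - c\<bar> \<le> 3" by simp
    then have "(c - 3 \<le> of_int x \<and> of_int x \<le> c + 3) \<or> (- c - 3 \<le> of_int x \<and> of_int x \<le> - c + 3)" by linarith
    then show "x \<in> ?I" unfolding Un_iff atLeastAtMost_iff ceiling_le_iff le_floor_iff .
  qed
  then show "finite {x::int. \<bar>\<bar>of_int x\<bar> - c\<bar> \<le> 3}" by (rule finite_subset) simp
  have "card {x::int. \<bar>\<bar>of_int x\<bar> - c\<bar> \<le> 3} \<le> card ?I" by (rule card_mono[OF _ sub]) simp
  also have "\<dots> \<le> card {\<lceil>c - 3\<rceil>..\<lfloor>c + 3\<rfloor>} + card {\<lceil>- c - 3\<rceil>..\<lfloor>- c + 3\<rfloor>}" by (rule card_Un_le)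
  also have "\<dots> \<le> 7 + 7"
  proof (rule add_mono)
    have "\<lfloor>c + 3\<rfloor> + 1 - \<lceil>c - 3\<rceil> \<le> 7" "\<lfloor>- c + 3\<rfloor> + 1 - \<lceil>- c - 3\<rceil> \<le> 7" by linarith+
    then show "card {\<lceil>c - 3\<rceil>..\<lfloor>c + 3\<rfloor>} \<le> 7" "card {\<lceil>- c - 3\<rceil>..\<lfloor>- c + 3\<rfloor>} \<le> 7"
      unfolding card_atLeastAtMost_int by (simp_all only: nat_le_iff)
  qed
  finally show "card {x::int. \<bar>\<bar>of_int x\<bar> - c\<bar> \<le> 3} \<le> 14" by simp
qed

text \<open>The lattice points near the four places where the circle crosses the diagonals; only
  there can the turned quarters overlap or leave gaps.\<close>

definition corner :: "real \<Rightarrow> (real \<times> real) set" where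
  "corner R = {l \<in> boundary_lattice R. \<bar>\<bar>fst l\<bar> - half_diag * R\<bar> \<le> 3 \<and> \<bar>\<bar>snd l\<bar> - half_diag * R\<bar> \<le> 3}"

lemma card_corner: "card (corner R) \<le> 196"
proof -
  let ?I = "{x::int. \<bar>\<bar>of_int x\<bar> - half_diag * R\<bar> \<le> 3}"
  let ?p = "\<lambda>(m, n). (real_of_int m, real_of_int n)"
  have "corner R \<subseteq> ?p ` (?I \<times> ?I)"
  proof
    fix l assume l: "l \<in> corner R"
    then obtain m n :: int where mn: "l = (of_int m, of_int n)"
      by (cases l) (auto simp: corner_def boundary_lattice_iff elim!: Ints_cases)
    then show "l \<in> ?p ` (?I \<times> ?I)"
      using l by (intro image_eqI[of _ _ "(m, n)"]) (auto simp: corner_def)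
  qed
  then have "card (corner R) \<le> card (?p ` (?I \<times> ?I))"
    using card_near_abs(1)[of "half_diag * R"] by (intro card_mono finite_imageI finite_cartesian_product)
  also have "\<dots> \<le> card (?I \<times> ?I)"
    using card_near_abs(1)[of "half_diag * R"] by (intro card_image_le finite_cartesian_product)
  also have "\<dots> \<le> 14 * 14"
    unfolding card_cartesian_product using card_near_abs(2)[of "half_diag * R"] by (intro mult_mono) auto
  finally show ?thesis by simp
qed

text \<open>With \<open>w = half_diag * R\<close> the squared norm is within
  \<open>2 * w + 1/2\<close> of \<open>2 * w\<^sup>2\<close>. If both squared coordinates lie on the
  same side of \<open>w\<^sup>2\<close>, their deviations cannot cancel, so each is at most
  \<open>2 * w + 1/2\<close>, and each coordinate is within 3 of \<open>w\<close> in absolute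
  value.\<close>

lemma corner_cases:
  assumes R: "R \<ge> 10" and l: "l \<in> boundary_lattice R"
    and c: "(\<bar>fst l\<bar> \<le> half_diag * R \<and> \<bar>snd l\<bar> \<le> half_diag * R) \<or> (half_diag * R < \<bar>fst l\<bar> \<and> half_diag * R < \<bar>snd l\<bar>)"
  shows "l \<in> corner R"
proof -
  define w where "w = half_diag * R"
  have w: "w \<ge> 7" using mult_mono[of "7/10" half_diag 10 R] half_diag_bounds R by (simp add: w_def)
  have w2: "2 * w\<^sup>2 = R\<^sup>2" by (simp add: w_def power_mult_distrib half_diag_sq)
  have n2: "(norm l)\<^sup>2 = (fst l)\<^sup>2 + (snd l)\<^sup>2" by (cases l) (simp add: norm_Pair)
  have "(R - half_diag)\<^sup>2 < (norm l)\<^sup>2"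
    using l half_diag_bounds R by (intro power_strict_mono) (auto simp: boundary_lattice_iff)
  then have lo: "2 * w\<^sup>2 - 2 * w < (fst l)\<^sup>2 + (snd l)\<^sup>2"
    unfolding n2 power2_diff half_diag_sq w2 by (simp add: w_def algebra_simps)
  have "(norm l)\<^sup>2 < (R + half_diag)\<^sup>2"
    using l by (intro power_strict_mono) (auto simp: boundary_lattice_iff)
  then have hi: "(fst l)\<^sup>2 + (snd l)\<^sup>2 < 2 * w\<^sup>2 + 2 * w + 1/2"
    unfolding n2 power2_sum half_diag_sq w2 by (simp add: w_def algebra_simps)
  have key: "\<bar>\<bar>a\<bar> - w\<bar> \<le> 3"
    if ab: "a\<^sup>2 + b\<^sup>2 > 2 * w\<^sup>2 - 2 * w" "a\<^sup>2 + b\<^sup>2 < 2 * w\<^sup>2 + 2 * w + 1/2"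
      and cc: "(\<bar>a\<bar> \<le> w \<and> \<bar>b\<bar> \<le> w) \<or> (w < \<bar>a\<bar> \<and> w < \<bar>b\<bar>)" for a b
    using cc
  proof
    assume A: "\<bar>a\<bar> \<le> w \<and> \<bar>b\<bar> \<le> w"
    then have "b\<^sup>2 \<le> w\<^sup>2" using w abs_le_square_iff[of b w] by simp
    then have "w\<^sup>2 - 2 * w < a\<^sup>2" using ab(1) by simp
    moreover have "(w - 3)\<^sup>2 \<le> w\<^sup>2 - 2 * w" using w by (simp add: power2_diff)
    ultimately have "(w - 3)\<^sup>2 \<le> \<bar>a\<bar>\<^sup>2" by simp
    then have "w - 3 \<le> \<bar>a\<bar>" by (rule power2_le_imp_le) simp
    then show ?thesis using A by simp
  next
    assume A: "w < \<bar>a\<bar> \<and> w < \<bar>b\<bar>"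
    then have "w\<^sup>2 \<le> b\<^sup>2" using w abs_le_square_iff[of w b] by simp
    then have "a\<^sup>2 < w\<^sup>2 + 2 * w + 1/2" using ab(2) by simp
    moreover have "w\<^sup>2 + 2 * w + 1/2 \<le> (w + 3)\<^sup>2" using w by (simp add: power2_sum)
    ultimately have "\<bar>a\<bar>\<^sup>2 \<le> (w + 3)\<^sup>2" by simp
    then have "\<bar>a\<bar> \<le> w + 3" by (rule power2_le_imp_le) (use w in simp)
    then show ?thesis using A by simp
  qed
  have "\<bar>\<bar>fst l\<bar> - w\<bar> \<le> 3" by (rule key[OF lo hi c[folded w_def]])
  moreover have "\<bar>\<bar>snd l\<bar> - w\<bar> \<le> 3"
    by (rule key[of "snd l" "fst l"]) (use lo hi c in \<open>auto simp: w_def add.commute\<close>)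
  ultimately show ?thesis using l by (simp add: corner_def w_def)
qed

text \<open>Away from the corners exactly one coordinate is at most \<open>half_diag * R\<close> in
  absolute value, and the sign of the other then selects exactly one of the four turned
  quarters.\<close>

lemma lattice_sum_near_quarters:
  fixes f :: "real \<times> real \<Rightarrow> real"
  assumes R: "R \<ge> 10" and f1: "\<And>l. \<bar>f l\<bar> \<le> 1" and inv: "\<And>l. f (turn l) = f l"
  shows "\<bar>(\<Sum>l\<in>boundary_lattice R. f l) - 4 * (\<Sum>l\<in>quarter R. f l)\<bar> \<le> 588"
proof -
  let ?B = "boundary_lattice R"
  define w where "w = half_diag * R"
  define T where "T = (\<lambda>i::nat. (turn ^^ i) ` quarter R)"
  have T0: "T 0 = {l \<in> ?B. \<bar>fst l\<bar> \<le> w \<and> snd l > 0}" by (simp add: T_def quarter_def w_def)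
  have turn_image: "turn ` {l \<in> ?B. P l} = {l \<in> ?B. P (snd l, - fst l)}" for P
  proof
    show "turn ` {l \<in> ?B. P l} \<subseteq> {l \<in> ?B. P (snd l, - fst l)}"
      by (auto simp: turn_in_boundary_lattice) (auto simp: turn_def)
    show "{l \<in> ?B. P (snd l, - fst l)} \<subseteq> turn ` {l \<in> ?B. P l}"
    proof
      fix l assume l: "l \<in> {l \<in> ?B. P (snd l, - fst l)}"
      have "l = turn (snd l, - fst l)" by (simp add: turn_def)
      moreover from this have "(snd l, - fst l) \<in> ?B" using l turn_in_boundary_lattice by (metis (no_types, lifting) mem_Collect_eq)
      ultimately show "l \<in> turn ` {l \<in> ?B. P l}" using l by blast
    qed
  qed
  have Suc: "T (Suc i) = turn ` T i" for i by (simp add: T_def image_comp comp_def)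
  have T1: "T 1 = {l \<in> ?B. \<bar>snd l\<bar> \<le> w \<and> fst l < 0}"
    unfolding Suc[of 0, folded One_nat_def] T0 turn_image by auto
  have T2: "T 2 = {l \<in> ?B. \<bar>fst l\<bar> \<le> w \<and> snd l < 0}"
  proof -
    have "T 2 = turn ` T 1" using Suc[of 1] by (simp only: Suc_1)
    then show ?thesis unfolding T1 turn_image by auto
  qed
  have T3: "T 3 = {l \<in> ?B. \<bar>snd l\<bar> \<le> w \<and> fst l > 0}"
  proof -
    have "T 3 = turn ` T 2" using Suc[of 2] by (simp only: eval_nat_numeral)
    then show ?thesis unfolding T2 turn_image by auto
  qed
  have sumT: "(\<Sum>l\<in>T i. f l) = (\<Sum>l\<in>quarter R. f l)" for i
  proof (induction i)
    case (Suc i)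
    then show ?case unfolding \<open>\<And>i. T (Suc i) = turn ` T i\<close> by (simp add: sum.reindex[OF inj_turn] inv)
  qed (simp add: T_def)
  have sub: "T i \<subseteq> ?B" for i
  proof (induction i)
    case (Suc i)
    then show ?case unfolding \<open>\<And>i. T (Suc i) = turn ` T i\<close> by (auto simp: turn_in_boundary_lattice)
  qed (simp add: T0)
  \<comment> \<open>\<open>N\<close> is the covering multiplicity: 1 off the corners and between 0
    and 4 on them.\<close>
  define N where "N l = (\<Sum>i<4. of_bool (l \<in> T i) :: real)" for l
  have N4: "N l = of_bool (l \<in> T 0) + of_bool (l \<in> T 1) + of_bool (l \<in> T 2) + of_bool (l \<in> T 3)" for l
    by (simp add: N_def eval_nat_numeral)
  have "(\<Sum>l\<in>?B. f l * N l) = (\<Sum>i<4. \<Sum>l\<in>?B. f l * of_bool (l \<in> T i))"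
    unfolding N_def sum_distrib_left by (rule sum.swap)
  also have "\<dots> = (\<Sum>i<4. \<Sum>l\<in>T i. f l)"
  proof (rule sum.cong[OF refl])
    fix i
    have "(\<Sum>l\<in>?B. f l * of_bool (l \<in> T i)) = (\<Sum>l\<in>?B. if l \<in> T i then f l else 0)" by (rule sum.cong) auto
    also have "\<dots> = (\<Sum>l\<in>?B \<inter> T i. f l)" by (rule sum.inter_restrict[symmetric, OF finite_boundary_lattice])
    also have "?B \<inter> T i = T i" using sub by blast
    finally show "(\<Sum>l\<in>?B. f l * of_bool (l \<in> T i)) = (\<Sum>l\<in>T i. f l)" .
  qed
  also have "\<dots> = 4 * (\<Sum>l\<in>quarter R. f l)" by (simp add: sumT)
  finally have "(\<Sum>l\<in>?B. f l) - 4 * (\<Sum>l\<in>quarter R. f l) = (\<Sum>l\<in>?B. f l * (1 - N l))"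
    by (simp add: right_diff_distrib sum_subtractf)
  also have "\<dots> = (\<Sum>l\<in>corner R. f l * (1 - N l))"
  proof (rule sum.mono_neutral_right[OF finite_boundary_lattice])
    show "corner R \<subseteq> ?B" by (auto simp: corner_def)
    show "\<forall>l\<in>?B - corner R. f l * (1 - N l) = 0"
    proof
      fix l assume "l \<in> ?B - corner R"
      then have l: "l \<in> ?B" "(\<bar>fst l\<bar> \<le> w \<and> \<bar>snd l\<bar> > w) \<or> (\<bar>fst l\<bar> > w \<and> \<bar>snd l\<bar> \<le> w)"
        using corner_cases[OF R, of l] unfolding w_def by (auto simp only: Diff_iff not_le[symmetric])
      have "w > 0" using half_diag_bounds R by (simp add: w_def)
      then have "N l = 1" unfolding N4 T0 T1 T2 T3 using l by auto
      then show "f l * (1 - N l) = 0" by simp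
    qed
  qed
  finally have eq: "(\<Sum>l\<in>?B. f l) - 4 * (\<Sum>l\<in>quarter R. f l) = (\<Sum>l\<in>corner R. f l * (1 - N l))" .
  \<comment> \<open>The multiplicity is off by at most 3 at each of at most 196 corner points, which
    gives 588.\<close>
  have "\<bar>(\<Sum>l\<in>?B. f l) - 4 * (\<Sum>l\<in>quarter R. f l)\<bar> \<le> (\<Sum>l\<in>corner R. 3)"
    unfolding eq real_norm_def[symmetric]
  proof (rule sum_norm_le)
    fix l
    have "0 \<le> N l" "N l \<le> 4" unfolding N4 by auto
    then have "\<bar>1 - N l\<bar> \<le> 3" by simp
    then have "\<bar>f l\<bar> * \<bar>1 - N l\<bar> \<le> 1 * 3" using f1[of l] by (intro mult_mono) auto
    then show "norm (f l * (1 - N l)) \<le> 3" by (simp add: abs_mult)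
  qed
  also have "\<dots> \<le> 588" using card_corner[of R] by simp
  finally show ?thesis .
qed

lemma lattice_sum_tendsto:
  fixes h :: "real \<Rightarrow> real"
  assumes conth: "continuous_on {0..1} h" and h1: "\<And>x. x \<in> {0..1} \<Longrightarrow> \<bar>h x\<bar> \<le> 1"
  shows "((\<lambda>R. (\<Sum>l\<in>boundary_lattice R. h (area_disc R l)) / R) \<longlongrightarrow> 4 * quarter_limit h) at_top"
proof (rule Lim_transform)
  show "((\<lambda>R. 4 * ((\<Sum>l\<in>quarter R. h (area_disc R l)) / R)) \<longlongrightarrow> 4 * quarter_limit h) at_top"
    by (intro tendsto_mult tendsto_const quarter_sum_tendsto conth h1)
  show "((\<lambda>R. (\<Sum>l\<in>boundary_lattice R. h (area_disc R l)) / R - 4 * ((\<Sum>l\<in>quarter R. h (area_disc R l)) / R)) \<longlongrightarrow> 0) at_top"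
  proof (rule Lim_null_comparison)
    show "((\<lambda>R::real. 588 / R) \<longlongrightarrow> 0) at_top" by real_asymp
    show "\<forall>\<^sub>F R in at_top. norm ((\<Sum>l\<in>boundary_lattice R. h (area_disc R l)) / R - 4 * ((\<Sum>l\<in>quarter R. h (area_disc R l)) / R)) \<le> 588 / R"
      using eventually_ge_at_top[of 10]
    proof eventually_elim
      case (elim R)
      have "\<bar>(\<Sum>l\<in>boundary_lattice R. h (area_disc R l)) - 4 * (\<Sum>l\<in>quarter R. h (area_disc R l))\<bar> \<le> 588"
        by (rule lattice_sum_near_quarters[OF elim]) (auto simp: area_disc_turn area_disc_bounds intro!: h1)
      then have "\<bar>(\<Sum>l\<in>boundary_lattice R. h (area_disc R l)) - 4 * (\<Sum>l\<in>quarter R. h (area_disc R l))\<bar> / R \<le> 588 / R"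
        using elim by (intro divide_right_mono) auto
      moreover have "(\<Sum>l\<in>boundary_lattice R. h (area_disc R l)) / R - 4 * ((\<Sum>l\<in>quarter R. h (area_disc R l)) / R)
          = ((\<Sum>l\<in>boundary_lattice R. h (area_disc R l)) - 4 * (\<Sum>l\<in>quarter R. h (area_disc R l))) / R"
        by (simp add: diff_divide_distrib)
      moreover have "\<bar>R\<bar> = R" using elim by simp
      ultimately show ?case by (simp only: real_norm_def abs_divide)
    qed
  qed
qed

section \<open>Weak convergence\<close>

lemma sq_cut_minus_right: "sq_cut r c (- s) = sq_cut r c s"
  using sq_cut_quarter_turn[of r c s] sq_cut_swap[of r "- s" c] by simp

lemma sq_cut_minus_left: "sq_cut r (- c) s = sq_cut r c s"
  using sq_cut_minus_right[of r s c] sq_cut_swap[of r "- c" s] sq_cut_swap[of r c s] by simp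

text \<open>The symmetries of the square bring the normal into the order
  \<open>(sin \<theta>, cos \<theta>)\<close>, matching \<open>(u, circ u)\<close> under u = sin
  \<theta>.\<close>

lemma area_limit_eq: "area_limit (r, \<theta>) = sq_cut r (sin \<theta>) (cos \<theta>)"
  unfolding area_limit_eq_sq_cut sq_cut_minus_right by (rule sq_cut_swap)

lemma area_limit_quarter_period: "area_limit (r, \<theta> + pi / 2) = area_limit (r, \<theta>)"
  unfolding area_limit_eq sin_add cos_add by (simp add: sq_cut_minus_right sq_cut_swap[of r "cos \<theta>"])

lemma area_limit_bounds: "0 \<le> area_limit p" "area_limit p \<le> 1"
  by (cases p; simp add: area_limit_eq sq_cut_bounds)+

text \<open>The parameters and the points of the cut square together form a closed set
  \<open>X\<close> in dimension four, and the measure of a section depends measurably on the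
  parameters.\<close>

lemma borel_measurable_area_limit: "area_limit \<in> borel_measurable borel"
proof -
  define X where "X = {w::(real \<times> real) \<times> (real \<times> real). snd w \<in> unit_square \<and>
    fst (fst w) + sin (snd (fst w)) * fst (snd w) + cos (snd (fst w)) * snd (snd w) \<le> 0}"
  have "X = (UNIV \<times> unit_square) \<inter> {w. fst (fst w) + sin (snd (fst w)) * fst (snd w) + cos (snd (fst w)) * snd (snd w) \<le> 0}"
    by (auto simp: X_def)
  moreover have "closed (UNIV \<times> unit_square :: ((real \<times> real) \<times> (real \<times> real)) set)"
    by (intro closed_Times compact_imp_closed[OF compact_unit_square]) auto
  moreover have "closed {w::(real \<times> real) \<times> (real \<times> real). fst (fst w) + sin (snd (fst w)) * fst (snd w) + cos (snd (fst w)) * snd (snd w) \<le> 0}"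
    by (intro closed_Collect_le continuous_intros)
  ultimately have "closed X" by auto
  then have "X \<in> sets borel" by (rule borel_closed)
  then have "X \<in> sets (borel \<Otimes>\<^sub>M lborel)" 
    unfolding sets_pair_measure_cong[OF refl sets_lborel] borel_prod .
  then have "(\<lambda>p. emeasure lborel (Pair p -` X)) \<in> borel_measurable borel"
    by (rule lborel.measurable_emeasure_Pair)
  then have "(\<lambda>p. enn2real (emeasure lborel (Pair p -` X))) \<in> borel_measurable borel"
    by measurable
  moreover have "enn2real (emeasure lborel (Pair p -` X)) = area_limit p" for p
  proof -
    obtain r \<theta> where p: "p = (r, \<theta>)" by (cases p)
    have "Pair p -` X = {z \<in> unit_square. r + sin \<theta> * fst z + cos \<theta> * snd z \<le> 0}" by (auto simp: X_def p)
    then show ?thesis by (simp add: p area_limit_eq sq_cut_def area_def measure_def)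
  qed
  ultimately show ?thesis by simp
qed

lemma param_rect_eq: "param_rect = {- half_diag..half_diag} \<times> {0..<2 * pi}"
  by (simp add: param_rect_def half_diag_def)

lemma param_rect_borel: "param_rect \<in> sets borel"
  unfolding param_rect_eq borel_prod[symmetric] by (intro pair_measureI) auto

lemma emeasure_param_rect: "emeasure lborel param_rect = ennreal (4 * pi * half_diag)"
proof -
  have "emeasure lborel param_rect = emeasure (lborel \<Otimes>\<^sub>M lborel) ({- half_diag..half_diag} \<times> {0..<2 * pi})"
    by (simp add: lborel_prod param_rect_eq)
  also have "\<dots> = emeasure lborel {- half_diag..half_diag} * emeasure lborel {0..<2 * pi}"
    by (intro lborel.emeasure_pair_measure_Times) auto
  also have "\<dots> = ennreal (2 * half_diag) * ennreal (2 * pi)"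
    using half_diag_bounds by simp
  also have "\<dots> = ennreal (4 * pi * half_diag)"
    using half_diag_bounds by (simp add: ennreal_mult[symmetric] mult_ac)
  finally show ?thesis .
qed

lemma prob_space_param_rect: "prob_space (uniform_measure lborel param_rect)"
  using half_diag_bounds by (intro prob_space_uniform_measure) (auto simp: emeasure_param_rect ennreal_eq_0_iff not_le)

definition angle_profile :: "(real \<Rightarrow> real) \<Rightarrow> real \<Rightarrow> real" where
  "angle_profile h \<theta> = integral {- half_diag..half_diag} (\<lambda>r. h (area_limit (r, \<theta>)))"

lemma half_diag_eq: "half_diag = sqrt 2 / 2"
  using real_sqrt_mult_self[of 2] by (simp add: half_diag_def field_simps)

lemma cos_ge_half_diag:
  assumes "\<theta> \<in> {- (pi / 4)..pi / 4}"
  shows "half_diag \<le> cos \<theta>"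
proof -
  have "cos (pi / 4) \<le> cos \<bar>\<theta>\<bar>" using assms by (intro cos_monotone_0_pi_le) auto
  then show ?thesis by (simp add: half_diag_eq cos_45)
qed

text \<open>In the substitution u = sin \<theta> the derivative cos \<theta> cancels the weight
  \<open>1 / circ u\<close>, since cos \<theta> is positive between -pi/4 and pi/4.\<close>

lemma angle_profile_quarter:
  assumes "continuous_on {0..1} h"
  shows "(angle_profile h has_integral quarter_limit h) {- (pi / 4)..pi / 4}"
proof -
  let ?D = "{- half_diag..half_diag}"
  define f where "f u = integral ?D (\<lambda>r. h (sq_cut r u (circ u))) / circ u" for u
  have circ: "circ u \<noteq> 0" if "u \<in> ?D" for u using circ_facts(4)[of u] that by (auto simp: abs_le_iff)
  have contf: "continuous_on ?D f"
    unfolding f_def using circ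
    by (intro continuous_on_divide continuous_on_inner_integral continuous_on_profile assms continuous_on_circ continuous_on_id) auto
  have s45: "sin (pi / 4) = half_diag" by (simp add: half_diag_eq sin_45)
  have "((\<lambda>\<theta>. cos \<theta> *\<^sub>R f (sin \<theta>)) has_integral (integral {sin (- (pi / 4))..sin (pi / 4)} f)) {- (pi / 4)..pi / 4}"
  proof (rule has_integral_substitution[where c = "- half_diag" and d = half_diag])
    show "sin ` {- (pi / 4)..pi / 4} \<subseteq> ?D"
    proof
      fix y assume "y \<in> sin ` {- (pi / 4)..pi / 4}"
      then obtain \<theta> where \<theta>: "y = sin \<theta>" "- (pi / 4) \<le> \<theta>" "\<theta> \<le> pi / 4" by auto
      have "sin (- (pi / 4)) \<le> sin \<theta>" "sin \<theta> \<le> sin (pi / 4)"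
        using \<theta> by (intro sin_monotone_2pi_le; simp)+
      then show "y \<in> ?D" using \<theta>(1) s45 by simp
    qed
    show "sin (- (pi / 4)) \<le> sin (pi / 4)" using s45 half_diag_bounds by simp
    show "(sin has_real_derivative cos x) (at x within {- (pi / 4)..pi / 4})" for x
      by (auto intro!: derivative_eq_intros)
  qed (use contf in auto)
  moreover have "quarter_limit h = integral ?D f" by (simp only: quarter_limit_def f_def[abs_def])
  ultimately have "((\<lambda>\<theta>. cos \<theta> *\<^sub>R f (sin \<theta>)) has_integral quarter_limit h) {- (pi / 4)..pi / 4}"
    by (simp only: sin_minus s45)
  moreover have "cos \<theta> *\<^sub>R f (sin \<theta>) = angle_profile h \<theta>" if "\<theta> \<in> {- (pi / 4)..pi / 4}" for \<theta>
  proof -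
    have c: "cos \<theta> > 0" using cos_ge_half_diag[OF that] half_diag_bounds by linarith
    then have "circ (sin \<theta>) = cos \<theta>" by (simp add: circ_def cos_squared_eq[symmetric])
    then show ?thesis using c by (simp add: f_def angle_profile_def area_limit_eq)
  qed
  ultimately show ?thesis by (rule has_integral_eq[rotated])
qed

lemma has_integral_periodic_shift:
  fixes f :: "real \<Rightarrow> real"
  assumes "(f has_integral I) {a..b}" "\<And>x. f (x + c) = f x"
  shows "(f has_integral I) {a + c..b + c}"
proof -
  have "((\<lambda>x. f (1 *\<^sub>R x + - c)) has_integral (1 / (\<bar>1\<bar> ^ DIM(real))) *\<^sub>R I) ((\<lambda>x. (1 / 1) *\<^sub>R x + - ((1 / 1) *\<^sub>R - c)) ` cbox a b)"
    using assms(1) by (intro has_integral_affinity) auto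
  moreover have "f (x - c) = f x" for x using assms(2)[of "x - c"] by simp
  moreover have "(\<lambda>x. x + c) ` {a..b} = {a + c..b + c}" by (simp add: add.commute)
  ultimately show ?thesis by simp
qed

text \<open>The profile has period pi/2. The half from -pi/4 to 0 is moved to pi/4 up to pi/2, which
  fills the first quadrant; shifts by pi/2 and then by pi double the range twice.\<close>

lemma angle_profile_full:
  assumes "continuous_on {0..1} h"
  shows "(angle_profile h has_integral 4 * quarter_limit h) {0..2 * pi}"
proof -
  let ?f = "angle_profile h"
  have per: "?f (x + pi / 2) = ?f x" for x
    by (simp add: angle_profile_def area_limit_quarter_period)
  note q = angle_profile_quarter[OF assms]
  have int: "?f integrable_on {- (pi / 4)..pi / 4}" using q by (rule has_integral_integrable)
  define A where "A = integral {- (pi / 4)..0} ?f"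
  define B where "B = integral {0..pi / 4} ?f"
  have A: "(?f has_integral A) {- (pi / 4)..0}"
    unfolding A_def by (intro integrable_integral integrable_subinterval_real[OF int]) auto
  have B: "(?f has_integral B) {0..pi / 4}"
    unfolding B_def by (intro integrable_integral integrable_subinterval_real[OF int]) auto
  have "(?f has_integral A + B) {- (pi / 4)..pi / 4}"
    by (rule has_integral_combine[OF _ _ A B]) auto
  then have AB: "A + B = quarter_limit h" using q by (rule has_integral_unique)
  have "(?f has_integral A) {- (pi / 4) + pi / 2..0 + pi / 2}"
    by (rule has_integral_periodic_shift[OF A per])
  then have A': "(?f has_integral A) {pi / 4..pi / 2}" by simp
  have "(?f has_integral B + A) {0..pi / 2}"
    by (rule has_integral_combine[OF _ _ B A']) auto
  then have 1: "(?f has_integral quarter_limit h) {0..pi / 2}" using AB by (simp add: add.commute)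
  have 2: "(?f has_integral quarter_limit h) {pi / 2..pi}"
    using has_integral_periodic_shift[OF 1 per] by simp
  have 3: "(?f has_integral quarter_limit h + quarter_limit h) {0..pi}"
    by (rule has_integral_combine[OF _ _ 1 2]) auto
  have per2: "?f (x + pi) = ?f x" for x
    using per[of x] per[of "x + pi / 2"] by (simp add: add.assoc)
  have 4: "(?f has_integral quarter_limit h + quarter_limit h) {pi..2 * pi}"
    using has_integral_periodic_shift[OF 3 per2] by simp
  have "(?f has_integral (quarter_limit h + quarter_limit h) + (quarter_limit h + quarter_limit h)) {0..2 * pi}"
    by (rule has_integral_combine[OF _ _ 3 4]) auto
  then show ?thesis by simp
qed

text \<open>Fubini with \<open>r\<close> innermost produces \<open>angle_profile\<close>, whose
  integral over a full turn is four quarters; the denominator is the area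
  \<open>4 * pi * half_diag\<close> of the parameter rectangle.\<close>

lemma expectation_area_limit:
  fixes h :: "real \<Rightarrow> real"
  assumes cont: "continuous_on UNIV h" and h1: "\<And>x. x \<in> {0..1} \<Longrightarrow> \<bar>h x\<bar> \<le> 1"
  shows "(\<integral>p. h (area_limit p) \<partial>uniform_measure lborel param_rect) = quarter_limit h / (pi * half_diag)"
proof -
  let ?V = "4 * pi * half_diag"
  have V: "?V > 0" using half_diag_bounds by simp
  have hm: "(\<lambda>p. h (area_limit p)) \<in> borel_measurable borel"
    using borel_measurable_continuous_onI[OF cont] borel_measurable_area_limit by (rule measurable_compose[rotated])
  have h1': "\<bar>h (area_limit p)\<bar> \<le> 1" for p by (intro h1) (simp add: area_limit_bounds)
  define F where "F r \<theta> = indicator {- half_diag..half_diag} r * (indicator {0..<2 * pi} \<theta> * h (area_limit (r, \<theta>)))" for r \<theta> :: real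
  have F_eq: "(\<lambda>(r, \<theta>). F r \<theta>) = (\<lambda>p. indicator param_rect p * h (area_limit p))"
    by (auto simp: F_def param_rect_eq indicator_def fun_eq_iff)
  have dens: "uniform_measure lborel param_rect = density lborel (\<lambda>p. ennreal (indicator param_rect p / ?V))"
    unfolding uniform_measure_def
  proof (rule density_cong)
    have [measurable]: "param_rect \<in> sets lborel" using param_rect_borel by simp
    show "(\<lambda>x. indicator param_rect x / emeasure lborel param_rect) \<in> borel_measurable lborel"
      "(\<lambda>p. ennreal (indicator param_rect p / ?V)) \<in> borel_measurable lborel" by measurable
    show "AE x in lborel. indicator param_rect x / emeasure lborel param_rect = ennreal (indicator param_rect x / ?V)"
      using divide_ennreal[OF _ V, of 1] by (auto simp: emeasure_param_rect split: split_indicator)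
  qed
  have "(\<integral>p. h (area_limit p) \<partial>uniform_measure lborel param_rect) = (\<integral>p. (indicator param_rect p / ?V) *\<^sub>R h (area_limit p) \<partial>lborel)"
    unfolding dens
  proof (rule integral_density)
    have [measurable]: "param_rect \<in> sets lborel" using param_rect_borel by simp
    show "(\<lambda>p. indicator param_rect p / ?V) \<in> borel_measurable lborel" by measurable
  qed (use hm V in auto)
  also have "\<dots> = (\<integral>p. (\<lambda>(r, \<theta>). F r \<theta>) p / ?V \<partial>lborel)"
    unfolding F_eq by simp
  also have "\<dots> = (\<integral>p. (\<lambda>(r, \<theta>). F r \<theta>) p \<partial>lborel) / ?V"
    by (rule integral_divide_zero)
  also have "(\<integral>p. (\<lambda>(r, \<theta>). F r \<theta>) p \<partial>lborel) = 4 * quarter_limit h"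
  proof -
    have int: "integrable lborel (\<lambda>(r, \<theta>). F r \<theta>)"
      unfolding F_eq
    proof (rule Bochner_Integration.integrable_bound)
      show "integrable lborel (indicator param_rect :: real \<times> real \<Rightarrow> real)"
        by (intro integrable_real_indicator) (auto simp: param_rect_borel emeasure_param_rect)
      show "(\<lambda>p. indicator param_rect p * h (area_limit p)) \<in> borel_measurable lborel"
        using hm param_rect_borel by (intro borel_measurable_times) auto
      show "AE p in lborel. norm (indicator param_rect p * h (area_limit p)) \<le> norm (indicator param_rect p :: real)"
        using h1' by (auto simp: abs_mult split: split_indicator)
    qed
    then have int': "integrable (lborel \<Otimes>\<^sub>M lborel) (\<lambda>(r, \<theta>). F r \<theta>)" by (simp add: lborel_prod)
    have inner: "(\<integral>r. F r \<theta> \<partial>lborel) = indicator {0..<2 * pi} \<theta> *\<^sub>R angle_profile h \<theta>" for \<theta>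
    proof -
      have hm2: "(\<lambda>r. h (area_limit (r, \<theta>))) \<in> borel_measurable borel"
        by (rule measurable_compose[OF _ hm]) (intro borel_measurable_continuous_onI continuous_intros)
      have "set_integrable lborel {- half_diag..half_diag} (\<lambda>r. h (area_limit (r, \<theta>)))"
        unfolding set_integrable_def
      proof (rule Bochner_Integration.integrable_bound)
        show "integrable lborel (indicator {- half_diag..half_diag} :: real \<Rightarrow> real)"
          by (intro integrable_real_indicator) (auto simp: emeasure_lborel_Icc_eq)
        show "(\<lambda>r. indicator {- half_diag..half_diag} r *\<^sub>R h (area_limit (r, \<theta>))) \<in> borel_measurable lborel"
          using hm2 by (intro borel_measurable_scaleR) auto
        show "AE r in lborel. norm (indicator {- half_diag..half_diag} r *\<^sub>R h (area_limit (r, \<theta>))) \<le> norm (indicator {- half_diag..half_diag} r :: real)"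
          using h1' by (auto simp: abs_mult split: split_indicator)
      qed
      from set_borel_integral_eq_integral(2)[OF this]
      have "(\<integral>r. indicator {- half_diag..half_diag} r * h (area_limit (r, \<theta>)) \<partial>lborel) = angle_profile h \<theta>"
        by (simp add: set_lebesgue_integral_def angle_profile_def)
      then show ?thesis by (simp add: F_def mult.left_commute[of _ "indicator {0..<2 * pi} \<theta>"])
    qed
    have "(\<integral>p. (\<lambda>(r, \<theta>). F r \<theta>) p \<partial>lborel) = (\<integral>\<theta>. (\<integral>r. F r \<theta> \<partial>lborel) \<partial>lborel)"
      using lborel_pair.integral_snd[OF int'] by (simp add: lborel_prod)
    also have "\<dots> = (\<integral>\<theta>. indicator {0..<2 * pi} \<theta> *\<^sub>R angle_profile h \<theta> \<partial>lborel)"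
      by (simp only: inner)
    also have "\<dots> = integral {0..<2 * pi} (angle_profile h)"
    proof -
      have "integrable lborel (\<lambda>\<theta>. \<integral>r. F r \<theta> \<partial>lborel)"
        using lborel_pair.integrable_snd[OF int'] .
      then have "set_integrable lborel {0..<2 * pi} (angle_profile h)"
        unfolding set_integrable_def inner .
      from set_borel_integral_eq_integral(2)[OF this] show ?thesis
        by (simp add: set_lebesgue_integral_def)
    qed
    also have "\<dots> = integral {0..2 * pi} (angle_profile h)"
    proof (rule integral_spike_set)
      show "negligible {x \<in> {0..<2 * pi} - {0..2 * pi}. angle_profile h x \<noteq> 0}"
        by (rule negligible_subset[of "{}"]) auto
      show "negligible {x \<in> {0..2 * pi} - {0..<2 * pi}. angle_profile h x \<noteq> 0}"
        by (rule negligible_subset[of "{2 * pi}"]) auto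
    qed
    also have "\<dots> = 4 * quarter_limit h"
      using angle_profile_full[of h] cont by (intro integral_unique) (auto intro: continuous_on_subset)
    finally show ?thesis .
  qed
  also have "4 * quarter_limit h / ?V = quarter_limit h / (pi * half_diag)" by simp
  finally show ?thesis .
qed

text \<open>The formula for expectations is read backwards: the constant 1 has expectation 1, which
  yields the integral of \<open>1 / circ u\<close> for free.\<close>

lemma quarter_limit_1: "quarter_limit (\<lambda>_. 1) = pi * half_diag"
proof -
  have "(\<integral>p. 1 \<partial>uniform_measure lborel param_rect) = (1::real)"
    using prob_space.prob_space[OF prob_space_param_rect] by simp
  moreover have "(\<integral>p. 1 \<partial>uniform_measure lborel param_rect) = quarter_limit (\<lambda>_. 1) / (pi * half_diag)"
    by (rule expectation_area_limit[of "\<lambda>_. 1"]) auto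
  ultimately have "quarter_limit (\<lambda>_. 1) / (pi * half_diag) = 1" by (simp only:)
  then show ?thesis by (simp only: divide_eq_1_iff)
qed

lemma boundary_lattice_nonempty: "R \<ge> 1 \<Longrightarrow> boundary_lattice R \<noteq> {}"
proof -
  assume R: "R \<ge> 1"
  have "round R \<ge> 0" using R by (simp add: round_def)
  then have "norm (real_of_int (round R), 0::real) = real_of_int (round R)" by (simp add: norm_Pair)
  moreover have "\<bar>real_of_int (round R) - R\<bar> \<le> 1/2" by (rule of_int_round_abs_le)
  ultimately have "R - half_diag < norm (real_of_int (round R), 0::real)" "norm (real_of_int (round R), 0::real) < R + half_diag"
    using half_diag_bounds by linarith+
  then have "(real_of_int (round R), 0) \<in> boundary_lattice R"
    unfolding boundary_lattice_iff by simp
  then show ?thesis by blast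
qed

text \<open>The quotient of two instances of the same limit, one for \<open>h\<close> and one for
  the constant 1; the latter says that the annulus holds asymptotically as many lattice points as
  its area.\<close>

lemma expectation_lattice_tendsto:
  fixes h :: "real \<Rightarrow> real"
  assumes cont: "continuous_on UNIV h" and h1: "\<And>x. x \<in> {0..1} \<Longrightarrow> \<bar>h x\<bar> \<le> 1"
  shows "((\<lambda>R. (\<Sum>l\<in>boundary_lattice R. h (area_disc R l)) / real (card (boundary_lattice R)))
    \<longlongrightarrow> (\<integral>p. h (area_limit p) \<partial>uniform_measure lborel param_rect)) at_top"
proof -
  have "continuous_on {0..1} h" using cont by (rule continuous_on_subset) simp
  from lattice_sum_tendsto[OF this h1]
  have 1: "((\<lambda>R. (\<Sum>l\<in>boundary_lattice R. h (area_disc R l)) / R) \<longlongrightarrow> 4 * quarter_limit h) at_top" by simp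
  have 2: "((\<lambda>R. real (card (boundary_lattice R)) / R) \<longlongrightarrow> 4 * (pi * half_diag)) at_top"
    using lattice_sum_tendsto[of "\<lambda>_. 1"] by (simp add: quarter_limit_1)
  have "((\<lambda>R. ((\<Sum>l\<in>boundary_lattice R. h (area_disc R l)) / R) / (real (card (boundary_lattice R)) / R))
      \<longlongrightarrow> (4 * quarter_limit h) / (4 * (pi * half_diag))) at_top"
    using half_diag_bounds by (intro tendsto_divide 1 2) auto
  moreover have "(4 * quarter_limit h) / (4 * (pi * half_diag)) = (\<integral>p. h (area_limit p) \<partial>uniform_measure lborel param_rect)"
    using expectation_area_limit[OF cont h1] by simp
  ultimately have "((\<lambda>R. ((\<Sum>l\<in>boundary_lattice R. h (area_disc R l)) / R) / (real (card (boundary_lattice R)) / R))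
      \<longlongrightarrow> (\<integral>p. h (area_limit p) \<partial>uniform_measure lborel param_rect)) at_top"
    by (simp only:)
  moreover have "\<forall>\<^sub>F R in at_top. ((\<Sum>l\<in>boundary_lattice R. h (area_disc R l)) / R) / (real (card (boundary_lattice R)) / R)
      = (\<Sum>l\<in>boundary_lattice R. h (area_disc R l)) / real (card (boundary_lattice R))"
    using eventually_gt_at_top[of 0] by eventually_elim simp
  ultimately show ?thesis by (rule Lim_transform_eventually)
qed

text \<open>A limit along the reals is tested on all sequences tending to infinity, which reduces
  the claim to weak convergence of sequences. There the continuous step functions
  \<open>cts_step\<close> suffice, and they are bounded by 1 as the convergence of expectations
  asks.\<close>

theorem weak_convergence:
  "weak_conv_along
     (\<lambda>R::real. distr (uniform_count_measure (boundary_lattice R)) borel (area_disc R))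
     (distr (uniform_measure lborel param_rect) borel area_limit) at_top"
  (is "weak_conv_along ?\<mu> ?M at_top")
  unfolding weak_conv_along_def
proof (intro allI impI)
  fix x assume x: "isCont (cdf ?M) x"
  have distM: "real_distribution ?M"
    using borel_measurable_area_limit
    by (intro prob_space.real_distribution_distr prob_space_param_rect) simp
  have meas: "area_disc R \<in> borel_measurable (uniform_count_measure (boundary_lattice R))" for R
    by (simp add: measurable_def space_uniform_count_measure sets_uniform_count_measure)
  have dist: "real_distribution (?\<mu> R)" if "R \<ge> 1" for R
    by (rule prob_space.real_distribution_distr[OF prob_space_uniform_count_measure[OF finite_boundary_lattice
          boundary_lattice_nonempty[OF that]] meas])
  show "((\<lambda>R. cdf (?\<mu> R) x) \<longlongrightarrow> cdf ?M x) at_top"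
  proof (rule tendsto_at_topI_sequentially)
    fix X :: "nat \<Rightarrow> real" assume X: "filterlim X at_top sequentially"
    \<comment> \<open>The criterion wants a probability measure for every index, but for small radii
      the lattice set may be empty; changing finitely many members of the sequence avoids
      this.\<close>
    define Y where "Y n = max 1 (X n)" for n
    have ev: "\<forall>\<^sub>F n in sequentially. X n = Y n"
      using X[unfolded filterlim_at_top, rule_format, of 1] by eventually_elim (simp add: Y_def)
    have Y: "filterlim Y at_top sequentially"
      by (rule filterlim_cong[THEN iffD1, OF refl refl ev X])
    have "weak_conv_m (\<lambda>n. ?\<mu> (Y n)) ?M"
    proof (rule integral_cts_step_conv_imp_weak_conv)
      show "real_distribution (?\<mu> (Y n))" for n by (rule dist) (simp add: Y_def)
      show "real_distribution ?M" by (rule distM)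
      fix a b :: real assume "a < b"
      let ?h = "cts_step a b"
      have hc: "continuous_on UNIV ?h"
        using cts_step_uniformly_continuous[OF \<open>a < b\<close>] by (rule uniformly_continuous_imp_continuous)
      have hm: "?h \<in> borel_measurable borel" using hc by (rule borel_measurable_continuous_onI)
      have h1: "\<bar>?h y\<bar> \<le> 1" for y using \<open>a < b\<close> by (auto simp: cts_step_def)
      have "integral\<^sup>L (?\<mu> R) ?h = (\<Sum>l\<in>boundary_lattice R. ?h (area_disc R l)) / real (card (boundary_lattice R))" for R
        using integral_distr[OF meas hm] by (simp add: integral_uniform_count_measure finite_boundary_lattice)
      moreover have "integral\<^sup>L ?M ?h = (\<integral>p. ?h (area_limit p) \<partial>uniform_measure lborel param_rect)"
        using hm borel_measurable_area_limit by (intro integral_distr) auto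
      ultimately show "(\<lambda>n. integral\<^sup>L (?\<mu> (Y n)) ?h) \<longlonglongrightarrow> integral\<^sup>L ?M ?h"
        using filterlim_compose[OF expectation_lattice_tendsto[OF hc h1] Y] by simp
    qed
    then have "(\<lambda>n. cdf (?\<mu> (Y n)) x) \<longlonglongrightarrow> cdf ?M x"
      using x by (simp add: weak_conv_m_def weak_conv_def)
    then show "(\<lambda>n. cdf (?\<mu> (X n)) x) \<longlonglongrightarrow> cdf ?M x"
      by (rule Lim_transform_eventually) (use ev in eventually_elim, simp)
  qed
qed

section \<open>The variance\<close>

text \<open>For a normal \<open>(s, c)\<close> with \<open>s \<le> c\<close> the line crosses the
  two vertical sides as long as \<open>r\<close> is at most \<open>(c - s) / 2\<close>. The cut is
  then a trapezoid and \<open>ramp\<close> is never clipped. Beyond this the cut is a triangle, and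
  beyond \<open>(c + s) / 2\<close> the line has left the square.\<close>

lemma sq_cut_middle:
  assumes "0 \<le> s" "s \<le> c" "0 < c" "0 \<le> r" "r \<le> (c - s) / 2"
  shows "sq_cut r s c = 1/2 - r / c"
proof -
  have "integral {-1/2..1/2} (\<lambda>x. ramp ((- r - s * x) / c)) = integral {-1/2..1/2} (\<lambda>x. (1/2 - r / c) - (s / c) * x)"
  proof (rule integral_cong)
    fix x :: real assume "x \<in> {-1/2..1/2}"
    then have "\<bar>x\<bar> \<le> 1/2" by auto
    then have "\<bar>s * x\<bar> \<le> s * (1/2)" unfolding abs_mult using assms by (intro mult_mono) auto
    then have "s * x \<le> s / 2" "- (s * x) \<le> s / 2" unfolding abs_le_iff by simp_all
    then have "\<bar>- r - s * x\<bar> \<le> c * (1/2)" unfolding abs_le_iff using assms by simp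
    then have "\<bar>(- r - s * x) / c\<bar> \<le> 1/2" using assms by (simp add: abs_divide pos_divide_le_eq mult.commute)
    moreover have "ramp w = w + 1/2" if "\<bar>w\<bar> \<le> 1/2" for w using that by (auto simp: ramp_def)
    ultimately have "ramp ((- r - s * x) / c) = (- r - s * x) / c + 1/2" by blast
    then show "ramp ((- r - s * x) / c) = (1/2 - r / c) - (s / c) * x"
      by (simp add: diff_divide_distrib)
  qed
  moreover have "((\<lambda>x. (1/2 - r / c) - (s / c) * x) has_integral
      (((1/2 - r / c) * (1/2) - (s / c) * (1/2)\<^sup>2 / 2) - ((1/2 - r / c) * (-1/2) - (s / c) * (-1/2)\<^sup>2 / 2))) {-1/2..1/2}"
    using assms(3) by (intro fundamental_theorem_of_calculus)
      (auto intro!: derivative_eq_intros simp: has_real_derivative_iff_has_vector_derivative[symmetric])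
  ultimately show ?thesis
    unfolding sq_cut_eq_integral[OF assms(3)] by (simp add: integral_unique power2_eq_square algebra_simps)
qed

text \<open>The cut is a right triangle at the vertex \<open>(-1/2, -1/2)\<close>. With
  \<open>d = (c + s) / 2 - r\<close> its legs are \<open>d / s\<close> and
  \<open>d / c\<close>.\<close>

lemma sq_cut_corner:
  assumes "0 < s" "s \<le> c" "(c - s) / 2 \<le> r" "r \<le> (c + s) / 2"
  shows "sq_cut r s c = ((c + s) / 2 - r)\<^sup>2 / (2 * c * s)"
proof -
  have c: "c > 0" using assms by simp
  \<comment> \<open>The abscissa where the line meets the bottom side; to its right every slice is
    empty.\<close>
  define x0 where "x0 = (c / 2 - r) / s"
  have sx: "s * x0 = c / 2 - r" using assms by (simp add: x0_def)
  have x0: "- (1/2) \<le> x0" "x0 \<le> 1/2" using assms by (auto simp: x0_def field_simps)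
  let ?f = "\<lambda>x. ramp ((- r - s * x) / c)"
  let ?P = "\<lambda>x. - (c / 2 - r - s * x)\<^sup>2 / (2 * c * s)"
  have e: "(- r - s * x) / c + 1/2 = (c / 2 - r - s * x) / c" for x using c by (simp add: field_simps)
  have "((\<lambda>x. (c / 2 - r - s * x) / c) has_integral (?P x0 - ?P (- (1/2)))) {- (1/2)..x0}"
  proof (rule fundamental_theorem_of_calculus[OF x0(1)])
    fix x assume "x \<in> {- (1/2)..x0}"
    have "(?P has_real_derivative (c / 2 - r - s * x) / c) (at x within {- (1/2)..x0})"
      using assms(1) c by (auto intro!: derivative_eq_intros simp: field_simps)
    then show "(?P has_vector_derivative (c / 2 - r - s * x) / c) (at x within {- (1/2)..x0})"
      by (simp add: has_real_derivative_iff_has_vector_derivative)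
  qed
  then have 1: "(?f has_integral (?P x0 - ?P (- (1/2)))) {- (1/2)..x0}"
  proof (rule has_integral_eq[rotated])
    fix x assume x: "x \<in> {- (1/2)..x0}"
    have "s * x \<le> s * x0" "s * - (1/2) \<le> s * x" using x assms(1) by (intro mult_left_mono; simp)+
    then have "0 \<le> (c / 2 - r - s * x) / c" "(c / 2 - r - s * x) / c \<le> 1"
      using sx assms c by (auto simp: pos_divide_le_eq)
    then show "(c / 2 - r - s * x) / c = ?f x" unfolding ramp_def e by simp
  qed
  have 2: "(?f has_integral 0) {x0..1/2}"
  proof (rule has_integral_is_0)
    fix x assume x: "x \<in> {x0..1/2}"
    have "s * x0 \<le> s * x" using x assms(1) by (intro mult_left_mono) auto
    then have "(c / 2 - r - s * x) / c \<le> 0" using sx c by (simp add: divide_le_0_iff)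
    then show "?f x = 0" unfolding ramp_def e by simp
  qed
  have "(?f has_integral (?P x0 - ?P (- (1/2))) + 0) {- (1/2)..1/2}"
    by (rule has_integral_combine[OF x0 1 2])
  moreover have "(?P x0 - ?P (- (1/2))) + 0 = ((c + s) / 2 - r)\<^sup>2 / (2 * c * s)"
  proof -
    have "c / 2 - r - s * x0 = 0" "c / 2 - r - s * - (1/2) = (c + s) / 2 - r"
      using sx by (simp_all add: field_simps)
    then show ?thesis by (simp only:) simp
  qed
  ultimately have "(?f has_integral ((c + s) / 2 - r)\<^sup>2 / (2 * c * s)) {- (1/2)..1/2}" by (simp only:)
  then show ?thesis unfolding sq_cut_eq_integral[OF c] by (simp add: integral_unique)
qed

lemma sq_cut_outside:
  assumes "0 \<le> s" "0 < c" "(c + s) / 2 \<le> r"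
  shows "sq_cut r s c = 0"
proof -
  have "integral {-1/2..1/2} (\<lambda>x. ramp ((- r - s * x) / c)) = integral {-1/2..1/2} (\<lambda>x::real. 0)"
  proof (rule integral_cong)
    fix x :: real assume "x \<in> {-1/2..1/2}"
    then have "s * - (1/2) \<le> s * x" using assms by (intro mult_left_mono) auto
    then have "- r - s * x \<le> - (c / 2)" using assms by simp
    then have "(- r - s * x) / c \<le> - (1/2)" using assms by (simp add: pos_divide_le_eq)
    then show "ramp ((- r - s * x) / c) = 0" by (simp add: ramp_def)
  qed
  then show ?thesis unfolding sq_cut_eq_integral[OF assms(2)] by simp
qed

lemma has_integral_polynomialI:
  fixes f P :: "real \<Rightarrow> real"
  assumes "a \<le> b" "\<And>x. (P has_real_derivative g x) (at x)" "\<And>x. x \<in> {a..b} \<Longrightarrow> f x = g x"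
  shows "(f has_integral (P b - P a)) {a..b}"
proof -
  have "(g has_integral (P b - P a)) {a..b}"
  proof (rule fundamental_theorem_of_calculus[OF assms(1)])
    show "(P has_vector_derivative g x) (at x within {a..b})" for x
      using assms(2)[of x] by (simp add: has_real_derivative_iff_has_vector_derivative has_vector_derivative_at_within)
  qed
  then show ?thesis by (rule has_integral_eq[rotated]) (simp add: assms(3))
qed

text \<open>The three shapes of the cut give three polynomial pieces on \<open>r \<ge> 0\<close>,
  with breaks at \<open>p\<close> and \<open>q\<close>; evenness in \<open>r\<close> doubles the
  result.\<close>

lemma has_integral_sq_cut_variance:
  assumes cs: "0 < s" "s \<le> c" "s\<^sup>2 + c\<^sup>2 = 1"
  shows "((\<lambda>r. (sq_cut r s c - 1/2)\<^sup>2) has_integral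
    (half_diag / 2 - c / 6 - s\<^sup>2 / (12 * c) + s ^ 3 / (60 * c\<^sup>2))) {- half_diag..half_diag}"
proof -
  have c: "c > 0" using cs by simp
  let ?f = "\<lambda>r. (sq_cut r s c - 1/2)\<^sup>2"
  define p q where "p = (c - s) / 2" and "q = (c + s) / 2"
  \<comment> \<open>The last break \<open>q\<close> stays within the range of \<open>r\<close>,
    because no vertex of the square is farther from the centre than
    \<open>half_diag\<close>.\<close>
  have "(c + s)\<^sup>2 \<le> 2" using cs(3) sum_squares_bound[of c s] by (simp add: power2_sum)
  then have "q\<^sup>2 \<le> half_diag\<^sup>2" unfolding q_def half_diag_sq by (simp add: power_divide)
  then have q_le: "q \<le> half_diag" by (rule power2_le_imp_le) (use half_diag_bounds in simp)
  have pq: "0 \<le> p" "p \<le> q" using cs by (auto simp: p_def q_def)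
  have 1: "(?f has_integral p ^ 3 / (3 * c\<^sup>2) - 0 ^ 3 / (3 * c\<^sup>2)) {0..p}"
  proof (rule has_integral_polynomialI[OF pq(1), where g = "\<lambda>r. (r / c)\<^sup>2"])
    show "((\<lambda>r. r ^ 3 / (3 * c\<^sup>2)) has_real_derivative (r / c)\<^sup>2) (at r)" for r
      using c by (auto intro!: derivative_eq_intros simp: field_simps power2_eq_square)
    fix r assume r: "r \<in> {0..p}"
    have "sq_cut r s c = 1/2 - r / c" using cs c r by (intro sq_cut_middle) (auto simp: p_def)
    then show "?f r = (r / c)\<^sup>2" by simp
  qed
  \<comment> \<open>The expanded square is integrated in the variable \<open>q - r\<close>, hence
    the minus sign in front; \<open>?Q\<close> vanishes at \<open>q\<close>.\<close>
  let ?Q = "\<lambda>r. - ((q - r) / 4 - (q - r) ^ 3 / (6 * c * s) + (q - r) ^ 5 / (20 * c\<^sup>2 * s\<^sup>2))"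
  have 2: "(?f has_integral ?Q q - ?Q p) {p..q}"
  proof (rule has_integral_polynomialI[OF pq(2), where g = "\<lambda>r. ((q - r)\<^sup>2 / (2 * c * s) - 1/2)\<^sup>2"])
    fix r
    have "(?Q has_real_derivative (1/4 - 3 * (q - r)\<^sup>2 / (6 * c * s) + 5 * (q - r) ^ 4 / (20 * c\<^sup>2 * s\<^sup>2))) (at r)"
      using c cs(1) by (auto intro!: derivative_eq_intros)
    moreover have "1/4 - 3 * (q - r)\<^sup>2 / (6 * c * s) + 5 * (q - r) ^ 4 / (20 * c\<^sup>2 * s\<^sup>2) = ((q - r)\<^sup>2 / (2 * c * s) - 1/2)\<^sup>2"
      using c cs(1) by (simp add: power2_diff power_divide power_mult_distrib power2_eq_square[of "2::real"] field_simps) (simp add: power2_eq_square eval_nat_numeral algebra_simps)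
    ultimately show "(?Q has_real_derivative ((q - r)\<^sup>2 / (2 * c * s) - 1/2)\<^sup>2) (at r)" by simp
  next
    fix r assume r: "r \<in> {p..q}"
    have "sq_cut r s c = ((c + s) / 2 - r)\<^sup>2 / (2 * c * s)" using cs r by (intro sq_cut_corner) (auto simp: p_def q_def)
    then show "?f r = ((q - r)\<^sup>2 / (2 * c * s) - 1/2)\<^sup>2" by (simp add: q_def)
  qed
  have 3: "(?f has_integral half_diag / 4 - q / 4) {q..half_diag}"
  proof (rule has_integral_polynomialI[OF q_le, where g = "\<lambda>r. 1/4"])
    show "((\<lambda>r::real. r / 4) has_real_derivative 1/4) (at r)" for r by (auto intro!: derivative_eq_intros)
    fix r assume r: "r \<in> {q..half_diag}"
    have "sq_cut r s c = 0" using cs c r by (intro sq_cut_outside) (auto simp: q_def)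
    then show "?f r = 1/4" by (simp add: power2_eq_square)
  qed
  define J where "J = (p ^ 3 / (3 * c\<^sup>2) - 0 ^ 3 / (3 * c\<^sup>2)) + (?Q q - ?Q p) + (half_diag / 4 - q / 4)"
  have "(?f has_integral (p ^ 3 / (3 * c\<^sup>2) - 0 ^ 3 / (3 * c\<^sup>2)) + (?Q q - ?Q p)) {0..q}"
    by (rule has_integral_combine[OF pq 1 2])
  then have pos: "(?f has_integral J) {0..half_diag}"
    unfolding J_def by (rule has_integral_combine[rotated 2, OF _ 3]) (use pq q_le in auto)
  have even: "?f (- r) = ?f r" for r
    unfolding sq_cut_uminus[OF c] by (simp add: power2_eq_square algebra_simps)
  have "((\<lambda>r. ?f (- r)) has_integral J) {- half_diag..- 0}"
    by (rule has_integral_reflect_real[THEN iffD2, OF pos])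
  then have neg: "(?f has_integral J) {- half_diag..0}" by (simp only: even minus_zero)
  have "(?f has_integral J + J) {- half_diag..half_diag}"
    by (rule has_integral_combine[OF _ _ neg pos]) (use half_diag_bounds in auto)
  moreover have "J + J = half_diag / 2 - c / 6 - s\<^sup>2 / (12 * c) + s ^ 3 / (60 * c\<^sup>2)"
  proof -
    have qp: "q - p = s" by (simp add: p_def q_def field_simps)
    have "J = p ^ 3 / (3 * c\<^sup>2) + (s / 4 - s ^ 3 / (6 * c * s) + s ^ 5 / (20 * c\<^sup>2 * s\<^sup>2)) + (half_diag / 4 - q / 4)"
      unfolding J_def qp by simp
    moreover have "s ^ 3 / (6 * c * s) = s\<^sup>2 / (6 * c)" "s ^ 5 / (20 * c\<^sup>2 * s\<^sup>2) = s ^ 3 / (20 * c\<^sup>2)"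
      using cs(1) by (simp_all add: eval_nat_numeral)
    moreover have "p ^ 3 / (3 * c\<^sup>2) = c / 24 - s / 8 + s\<^sup>2 / (8 * c) - s ^ 3 / (24 * c\<^sup>2)"
      unfolding p_def using c by (simp add: eval_nat_numeral field_simps)
    ultimately have J_eq: "J = c / 24 - s / 8 + s\<^sup>2 / (8 * c) - s ^ 3 / (24 * c\<^sup>2)
        + (s / 4 - s\<^sup>2 / (6 * c) + s ^ 3 / (20 * c\<^sup>2)) + (half_diag / 4 - (c + s) / 8)"
      by (simp add: q_def)
    \<comment> \<open>With these two quotients as atoms the identity is linear.\<close>
    define X Y where "X = s\<^sup>2 / c" and "Y = s ^ 3 / c\<^sup>2"
    have XY: "s\<^sup>2 / (8 * c) = X / 8" "s\<^sup>2 / (6 * c) = X / 6" "s\<^sup>2 / (12 * c) = X / 12"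
      "s ^ 3 / (24 * c\<^sup>2) = Y / 24" "s ^ 3 / (20 * c\<^sup>2) = Y / 20" "s ^ 3 / (60 * c\<^sup>2) = Y / 60"
      by (simp_all add: X_def Y_def)
    show ?thesis unfolding J_eq XY by (simp add: field_simps)
  qed
  ultimately show ?thesis by simp
qed

text \<open>The integral over \<open>r\<close> is a function of sine and cosine with an elementary
  antiderivative. The integrand is even in the angle, so the range from 0 to pi/4 is doubled, and
  there the condition sin \<theta> \<le> cos \<theta> holds.\<close>

lemma quarter_limit_variance:
  "quarter_limit (\<lambda>x. (x - 1/2)\<^sup>2) = 2 * (half_diag * pi / 8 - half_diag / 30 - 1/30 - ln (1 + sqrt 2) / 12)"
proof -
  let ?h = "\<lambda>x::real. (x - 1/2)\<^sup>2"
  let ?f = "angle_profile ?h"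
  \<comment> \<open>By the Pythagorean identity \<open>s\<^sup>2 / c = 1 / c - c\<close> and
    \<open>s ^ 3 / c\<^sup>2 = s / c\<^sup>2 - s\<close>. The term \<open>1 / c\<close> integrates
    to the logarithm, the source of \<open>ln (1 + sqrt 2)\<close>, and the second expression to
    \<open>1 / cos \<theta> + cos \<theta>\<close>.\<close>
  let ?P = "\<lambda>\<theta>. half_diag / 2 * \<theta> - sin \<theta> / 6 - (ln ((1 + sin \<theta>) / cos \<theta>) - sin \<theta>) / 12 + (1 / cos \<theta> + cos \<theta>) / 60"
  let ?g = "\<lambda>\<theta>. half_diag / 2 - cos \<theta> / 6 - (sin \<theta>)\<^sup>2 / (12 * cos \<theta>) + (sin \<theta>) ^ 3 / (60 * (cos \<theta>)\<^sup>2)"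
  have "(?g has_integral (?P (pi / 4) - ?P 0)) {0..pi / 4}"
  proof (rule fundamental_theorem_of_calculus)
    fix \<theta> assume \<theta>: "\<theta> \<in> {0..pi / 4}"
    define c s where "c = cos \<theta>" and "s = sin \<theta>"
    have c: "c > 0" using cos_ge_half_diag[of \<theta>] \<theta> half_diag_bounds by (auto simp: c_def)
    have s: "s \<ge> 0" using \<theta> by (auto simp: s_def intro!: sin_ge_zero)
    have s2: "s\<^sup>2 = 1 - c\<^sup>2" by (simp add: s_def c_def sin_squared_eq)
    have "((\<lambda>\<theta>. (1 + sin \<theta>) / cos \<theta>) has_real_derivative (1 + s) / c\<^sup>2) (at \<theta>)"
    proof -
      have "((\<lambda>\<theta>. (1 + sin \<theta>) / cos \<theta>) has_real_derivative (c * c - (1 + s) * - s) / (c * c)) (at \<theta>)"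
        using c by (auto intro!: derivative_eq_intros simp: c_def s_def)
      moreover have "c * c - (1 + s) * - s = 1 + s" using s2 by (simp add: power2_eq_square algebra_simps)
      ultimately show ?thesis by (simp add: power2_eq_square)
    qed
    from DERIV_chain2[OF DERIV_ln_divide this] have "((\<lambda>\<theta>. ln ((1 + sin \<theta>) / cos \<theta>)) has_real_derivative
        (1 / ((1 + sin \<theta>) / cos \<theta>)) * ((1 + s) / c\<^sup>2)) (at \<theta>)"
      using c s by (simp add: c_def s_def)
    moreover have "(1 / ((1 + sin \<theta>) / cos \<theta>)) * ((1 + s) / c\<^sup>2) = 1 / c"
      using c s by (simp add: c_def[symmetric] s_def[symmetric] power2_eq_square)
    ultimately have dln: "((\<lambda>\<theta>. ln ((1 + sin \<theta>) / cos \<theta>)) has_real_derivative 1 / c) (at \<theta>)" by simp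
    have dinv: "((\<lambda>\<theta>. 1 / cos \<theta>) has_real_derivative s / c\<^sup>2) (at \<theta>)"
      using c by (auto intro!: derivative_eq_intros simp: c_def s_def power2_eq_square)
    have "(?P has_real_derivative (half_diag / 2 * 1 - c / 6 - (1 / c - c) / 12 + (s / c\<^sup>2 + - s) / 60)) (at \<theta>)"
      unfolding c_def s_def
      by (intro DERIV_add DERIV_diff DERIV_cmult DERIV_cdivide DERIV_ident DERIV_sin DERIV_cos
          dln[unfolded c_def] dinv[unfolded c_def s_def])
    moreover have "half_diag / 2 * 1 - c / 6 - (1 / c - c) / 12 + (s / c\<^sup>2 + - s) / 60 = ?g \<theta>"
    proof -
      have "1 / c - c = s\<^sup>2 / c" unfolding s2 using c by (simp add: diff_divide_distrib power2_eq_square)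
      moreover have "s / c\<^sup>2 + - s = s ^ 3 / c\<^sup>2"
      proof -
        have "s ^ 3 = s * s\<^sup>2" by (simp add: eval_nat_numeral)
        then have "s ^ 3 = s - s * c\<^sup>2" unfolding s2 by (simp add: right_diff_distrib)
        then show ?thesis using c by (simp add: diff_divide_distrib)
      qed
      ultimately show ?thesis by (simp add: c_def s_def)
    qed
    ultimately have "(?P has_real_derivative ?g \<theta>) (at \<theta>)" by (simp only:)
    then show "(?P has_vector_derivative ?g \<theta>) (at \<theta> within {0..pi / 4})"
      by (simp add: has_real_derivative_iff_has_vector_derivative has_vector_derivative_at_within)
  qed simp
  \<comment> \<open>At angle 0 the line is parallel to a side and the triangular range degenerates;
    the formula in \<open>r\<close> asks for a positive sine, so this one point is
    discarded.\<close>
  then have pos: "(?f has_integral (?P (pi / 4) - ?P 0)) {0..pi / 4}"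
  proof (rule has_integral_spike_finite[of "{0}", rotated 2])
    fix \<theta> assume "\<theta> \<in> {0..pi / 4} - {0}"
    then have \<theta>: "0 < \<theta>" "\<theta> \<le> pi / 4" by auto
    have "sin \<theta> > 0" using \<theta> by (intro sin_gt_zero) auto
    moreover have "sin \<theta> \<le> cos \<theta>"
    proof -
      have "sin \<theta> \<le> sin (pi / 4)" using \<theta> by (intro sin_monotone_2pi_le) auto
      then show ?thesis using cos_ge_half_diag[of \<theta>] \<theta> by (simp add: half_diag_eq sin_45)
    qed
    ultimately have "((\<lambda>r. (sq_cut r (sin \<theta>) (cos \<theta>) - 1/2)\<^sup>2) has_integral ?g \<theta>) {- half_diag..half_diag}"
      by (intro has_integral_sq_cut_variance) auto
    then show "?f \<theta> = ?g \<theta>"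
      unfolding angle_profile_def area_limit_eq by (rule integral_unique)
  qed simp
  have even: "?f (- \<theta>) = ?f \<theta>" for \<theta>
    by (simp add: angle_profile_def area_limit_eq sq_cut_minus_left)
  have "((\<lambda>\<theta>. ?f (- \<theta>)) has_integral (?P (pi / 4) - ?P 0)) {- (pi / 4)..- 0}"
    by (rule has_integral_reflect_real[THEN iffD2, OF pos])
  then have neg: "(?f has_integral (?P (pi / 4) - ?P 0)) {- (pi / 4)..0}" by (simp only: even minus_zero)
  have total: "(?f has_integral (?P (pi / 4) - ?P 0) + (?P (pi / 4) - ?P 0)) {- (pi / 4)..pi / 4}"
    by (rule has_integral_combine[OF _ _ neg pos]) auto
  have "(?f has_integral quarter_limit ?h) {- (pi / 4)..pi / 4}"
    by (intro angle_profile_quarter continuous_intros)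
  from has_integral_unique[OF this total]
  have "quarter_limit ?h = 2 * (?P (pi / 4) - ?P 0)" by (simp only: mult_2)
  moreover have "sin (pi / 4) = half_diag" "cos (pi / 4) = half_diag" by (simp_all add: half_diag_eq sin_45 cos_45)
  moreover have "(1 + half_diag) / half_diag = 1 + sqrt 2" "1 / half_diag = 2 * half_diag"
  proof -
    have "1 / half_diag = sqrt 2" by (simp add: half_diag_def)
    moreover have "half_diag \<noteq> 0" using half_diag_bounds by simp
    ultimately show "(1 + half_diag) / half_diag = 1 + sqrt 2" by (simp add: add_divide_distrib)
    show "1 / half_diag = 2 * half_diag" using \<open>1 / half_diag = sqrt 2\<close> by (simp add: half_diag_eq)
  qed
  ultimately show ?thesis by (simp add: add_divide_distrib diff_divide_distrib algebra_simps)
qed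

text \<open>Averaging over \<open>r\<close> and \<open>-r\<close> pairs complementary cuts, so for
  every direction the mean over \<open>r\<close> is 1/2.\<close>

lemma expectation_area_limit_half:
  "(\<integral>p. area_limit p \<partial>uniform_measure lborel param_rect) = 1/2"
proof -
  let ?D = "{- half_diag..half_diag}"
  have half: "integral ?D (\<lambda>r. sq_cut r u (circ u)) = 1/2 * integral ?D (\<lambda>r. 1)" if u: "u \<in> ?D" for u
  proof -
    have c: "circ u > 0" using circ_facts(4)[of u] u by (auto simp: abs_le_iff)
    have int: "(\<lambda>r. sq_cut r u (circ u)) integrable_on ?D"
      using c by (intro integrable_continuous_real continuous_on_sq_cut continuous_intros)
    have "integral ?D (\<lambda>r. sq_cut r u (circ u)) = integral ?D (\<lambda>r. sq_cut (- r) u (circ u))"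
      using Henstock_Kurzweil_Integration.integral_reflect_real[where a = "- half_diag" and b = half_diag and f = "\<lambda>r. sq_cut r u (circ u)"] by simp
    also have "\<dots> = integral ?D (\<lambda>r. 1 - sq_cut r u (circ u))" by (simp only: sq_cut_uminus[OF c])
    also have "\<dots> = integral ?D (\<lambda>r. 1) - integral ?D (\<lambda>r. sq_cut r u (circ u))"
      by (intro integral_diff int integrable_const_ivl)
    finally show ?thesis by simp
  qed
  have "quarter_limit (\<lambda>x. x) = integral ?D (\<lambda>u. 1/2 * (integral ?D (\<lambda>r. 1) / circ u))"
    unfolding quarter_limit_def by (rule integral_cong) (simp only: half times_divide_eq_right)
  also have "\<dots> = 1/2 * quarter_limit (\<lambda>_. 1)"
    unfolding quarter_limit_def by (rule integral_mult_right)
  finally have "quarter_limit (\<lambda>x. x) = 1/2 * (pi * half_diag)" unfolding quarter_limit_1 .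
  moreover have "(\<integral>p. area_limit p \<partial>uniform_measure lborel param_rect) = quarter_limit (\<lambda>x. x) / (pi * half_diag)"
    by (rule expectation_area_limit[of "\<lambda>x. x"]) auto
  moreover have "pi * half_diag \<noteq> 0" using half_diag_bounds by simp
  ultimately show ?thesis by simp
qed

text \<open>With the mean known to be 1/2, the variance is the expectation of the continuous
  function \<open>(x - 1/2)\<^sup>2\<close>, which is bounded by 1 on the range of the areas, so the
  formula for expectations applies.\<close>

theorem variance_area_limit:
  "prob_space.variance (uniform_measure lborel param_rect) area_limit = c0"
proof -
  have h1: "\<bar>(x - 1/2)\<^sup>2\<bar> \<le> 1" if "x \<in> {0..1}" for x :: real
  proof -
    have "\<bar>x - 1/2\<bar> \<le> 1" using that by (auto simp: abs_le_iff)
    then show ?thesis using abs_le_square_iff[of "x - 1/2" 1] by simp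
  qed
  have "prob_space.variance (uniform_measure lborel param_rect) area_limit
      = (\<integral>p. (area_limit p - 1/2)\<^sup>2 \<partial>uniform_measure lborel param_rect)"
    by (simp only: expectation_area_limit_half)
  also have "\<dots> = quarter_limit (\<lambda>x. (x - 1/2)\<^sup>2) / (pi * half_diag)"
    by (rule expectation_area_limit[OF _ h1]) (auto intro!: continuous_intros)
  also have "\<dots> = c0"
  proof -
    have "sqrt 2 * sqrt 2 = 2" by simp
    then show ?thesis
      unfolding quarter_limit_variance c0_def half_diag_eq by (simp add: field_simps)
  qed
  finally show ?thesis .
qed

theorem theorem2p2:
  shows "weak_conv_along
           (\<lambda>R::real. distr (uniform_count_measure (boundary_lattice R)) borel (area_disc R))
           (distr (uniform_measure lborel param_rect) borel area_limit)
           at_top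
       \<and> prob_space.variance (uniform_measure lborel param_rect) area_limit = c0"
  using weak_convergence variance_area_limit by blast

end
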